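(* Let $f\in\mathcal C(\mathbb R)$ be a nonnegative nondecreasing function with $f(0)=0$, and let $0\le u_0\in L^1(I)$. Let $v$ be any weak solution of the problem $$\partial_t u-(|u_x|^{p-2}u_x)_x+u^{-\beta}\chi_{\{u>0\}}+f(u)=0\ \text{ in } I\times(0,\infty),\qquad u(\pm l,t)=0\ (t>0),\qquad u(\cdot,0)=u_0\ \text{ in } I .$$ Then there is a finite time $T_0=T_0(\beta,p,|I|,\|u_0\|_{L^1(I)})$ such that $v(t)=0$ for $t\ge T_0$.
   Context: Here $I=(-l,l)$ is a bounded open interval of length $|I|$, $\beta\in(0,1)$, $p>2$. $\chi_{\{u>0\}}$ is the characteristic function of the set of $(x,t)$ with $u(x,t)>0$, with the convention $u^{-\beta}\chi_{\{u>0\}}=0$ where $u=0$. $T_0(\beta,p,|I|,\|u_0\|_{L^1(I)})$ means that $T_0$ depends only on the listed quantities. Weak solution: for $0\le u_0\in L^1(I)$, a function $u\ge0$ is a weak solution if $f(u),\,u^{-\beta}\chi_{\{u>0\}}\in L^1(I\times(0,\infty))$, $u\in L^p_{loc}(0,\infty;W^{1,p}_0(I))\cap L^\infty_{loc}(\overline I\times(0,\infty))\cap\mathcal C([0,\infty);L^1(I))$, $u(\cdot,0)=u_0$, and $$\int_0^\infty\int_I\left(-u\phi_t+|u_x|^{p-2}u_x\phi_x+u^{-\beta}\chi_{\{u>0\}}\phi+f(u)\phi\right)dx\,dt=0\quad\forall\phi\in\mathcal C_c^\infty(I\times(0,\infty)).$$ *)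

theory Defs
  imports "HOL-Analysis.Analysis"
begin

section \<open>Test functions\<close>

primrec Ck :: "nat \<Rightarrow> ('a::euclidean_space \<Rightarrow> real) \<Rightarrow> bool" where
  "Ck 0 \<phi> \<longleftrightarrow> continuous_on UNIV \<phi>"
| "Ck (Suc k) \<phi> \<longleftrightarrow> \<phi> differentiable_on UNIV \<and>
     (\<forall>b\<in>Basis. Ck k (\<lambda>z. frechet_derivative \<phi> (at z) b))"

text \<open>Elements of \<open>C\<^sub>c\<^sup>\<infinity>(S)\<close> are represented by their extensions by zero to the whole space.\<close>

definition test_function :: "'a::euclidean_space set \<Rightarrow> ('a \<Rightarrow> real) \<Rightarrow> bool" where
  "test_function S \<phi> \<longleftrightarrow> (\<forall>k. Ck k \<phi>) \<and>
     compact (closure {z. \<phi> z \<noteq> 0}) \<and> closure {z. \<phi> z \<noteq> 0} \<subseteq> S"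

section \<open>Lebesgue and Sobolev spaces\<close>

text \<open>
  Function spaces are sets of representatives: a function on \<open>S\<close> is a total function whose values
  off \<open>S\<close> are irrelevant, and almost everywhere equal functions are not identified.
\<close>

definition Lp_space :: "real \<Rightarrow> 'a::euclidean_space set \<Rightarrow> ('a \<Rightarrow> real) set" where
  "Lp_space p S = {g. g \<in> borel_measurable (lebesgue_on S) \<and>
     integrable (lebesgue_on S) (\<lambda>x. \<bar>g x\<bar> powr p)}"

definition L1_loc :: "'a::euclidean_space set \<Rightarrow> ('a \<Rightarrow> real) set" where
  "L1_loc S = {g. g \<in> borel_measurable (lebesgue_on S) \<and>
     (\<forall>K. compact K \<and> K \<subseteq> S \<longrightarrow> integrable (lebesgue_on K) g)}"

definition has_weak_derivative :: "real set \<Rightarrow> (real \<Rightarrow> real) \<Rightarrow> (real \<Rightarrow> real) \<Rightarrow> bool" where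
  "has_weak_derivative S g h \<longleftrightarrow> g \<in> L1_loc S \<and> h \<in> L1_loc S \<and>
     (\<forall>\<phi>. test_function S \<phi> \<longrightarrow>
        (LINT x|lebesgue_on S. g x * deriv \<phi> x) = - (LINT x|lebesgue_on S. h x * \<phi> x))"

text \<open>
  For open \<open>S\<close> the weak derivative is unique up to a null set; everything below is
  insensitive to the choice of representative.
\<close>

definition weak_derivative :: "real set \<Rightarrow> (real \<Rightarrow> real) \<Rightarrow> real \<Rightarrow> real" where
  "weak_derivative S g = (SOME h. has_weak_derivative S g h)"

definition W1p :: "real \<Rightarrow> real set \<Rightarrow> (real \<Rightarrow> real) set" where
  "W1p p S = {g \<in> Lp_space p S. \<exists>h \<in> Lp_space p S. has_weak_derivative S g h}"

definition W1p_norm :: "real \<Rightarrow> real set \<Rightarrow> (real \<Rightarrow> real) \<Rightarrow> real" where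
  "W1p_norm p S g = ((LINT x|lebesgue_on S. \<bar>g x\<bar> powr p) +
     (LINT x|lebesgue_on S. \<bar>weak_derivative S g x\<bar> powr p)) powr (1 / p)"

definition W1p_0 :: "real \<Rightarrow> real set \<Rightarrow> (real \<Rightarrow> real) set" where
  "W1p_0 p S = {g \<in> W1p p S. \<exists>\<phi>. (\<forall>n. test_function S (\<phi> n)) \<and>
     (\<lambda>n::nat. W1p_norm p S (\<lambda>x. \<phi> n x - g x)) \<longlonglongrightarrow> 0}"

section \<open>Spaces of functions of space and time\<close>

text \<open>
  A function of \<open>(x, t)\<close> is curried with the time first, so that \<open>u t\<close> is the spatial profile
  at time \<open>t\<close>. \<open>X\<close> is a space of profiles with norm \<open>N\<close>; strong (Bochner) measurability is
  almost everywhere approximability by simple functions.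
\<close>

definition strongly_measurable ::
  "real set \<Rightarrow> (real \<Rightarrow> real) set \<Rightarrow> ((real \<Rightarrow> real) \<Rightarrow> real) \<Rightarrow> (real \<Rightarrow> real \<Rightarrow> real) \<Rightarrow> bool" where
  "strongly_measurable T X N u \<longleftrightarrow>
     (\<exists>s. (\<forall>n::nat. simple_function (lebesgue_on T) (s n) \<and> s n ` T \<subseteq> X) \<and>
          (AE t in lebesgue_on T. (\<lambda>n. N (\<lambda>x. s n t x - u t x)) \<longlonglongrightarrow> 0))"

definition Lp_loc_Bochner ::
  "real \<Rightarrow> real set \<Rightarrow> (real \<Rightarrow> real) set \<Rightarrow> ((real \<Rightarrow> real) \<Rightarrow> real) \<Rightarrow> (real \<Rightarrow> real \<Rightarrow> real) set" where
  "Lp_loc_Bochner p T X N = {u. (AE t in lebesgue_on T. u t \<in> X) \<and>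
     strongly_measurable T X N u \<and>
     (\<forall>K. compact K \<and> K \<subseteq> T \<longrightarrow> integrable (lebesgue_on K) (\<lambda>t. N (u t) powr p))}"

text \<open>
  Functions on \<open>S\<close> that are essentially bounded near every point of \<open>D\<close>, where
  \<open>S \<subseteq> D \<subseteq> closure S\<close>.
\<close>

definition Linf_loc :: "'a::euclidean_space set \<Rightarrow> 'a set \<Rightarrow> ('a \<Rightarrow> real) set" where
  "Linf_loc S D = {g. g \<in> borel_measurable (lebesgue_on S) \<and>
     (\<forall>K. compact K \<and> K \<subseteq> D \<longrightarrow>
        (\<exists>C. AE z in lebesgue_on S. z \<in> K \<longrightarrow> \<bar>g z\<bar> \<le> C))}"

definition C_L1 :: "real set \<Rightarrow> real set \<Rightarrow> (real \<Rightarrow> real \<Rightarrow> real) set" where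
  "C_L1 T S = {u. (\<forall>t\<in>T. integrable (lebesgue_on S) (u t)) \<and>
     (\<forall>t\<in>T. ((\<lambda>r. LINT x|lebesgue_on S. \<bar>u r x - u t x\<bar>) \<longlongrightarrow> 0) (at t within T))}"

section \<open>The equation\<close>

definition singular_term :: "real \<Rightarrow> real \<Rightarrow> real" where
  "singular_term \<beta> s = (if s > 0 then s powr (- \<beta>) else 0)"

text \<open>The homogeneous Dirichlet condition is encoded by membership in \<open>W1p_0\<close>.\<close>

definition weak_solution ::
  "real \<Rightarrow> real \<Rightarrow> real \<Rightarrow> (real \<Rightarrow> real) \<Rightarrow> (real \<Rightarrow> real) \<Rightarrow> (real \<Rightarrow> real \<Rightarrow> real) \<Rightarrow> bool" where
  "weak_solution \<beta> p l f u\<^sub>0 u \<longleftrightarrow>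
     (let I = {-l<..<l}; Q = I \<times> {0<..} in
        (AE (x, t) in lebesgue_on Q. 0 \<le> u t x) \<and>
        integrable (lebesgue_on Q) (\<lambda>(x, t). f (u t x)) \<and>
        integrable (lebesgue_on Q) (\<lambda>(x, t). singular_term \<beta> (u t x)) \<and>
        u \<in> Lp_loc_Bochner p {0<..} (W1p_0 p I) (W1p_norm p I) \<and>
        (\<lambda>(x, t). u t x) \<in> Linf_loc Q (closure I \<times> {0<..}) \<and>
        u \<in> C_L1 {0..} I \<and>
        (AE x in lebesgue_on I. u 0 x = u\<^sub>0 x) \<and>
        (\<forall>\<phi>. test_function Q \<phi> \<longrightarrow>
           (LINT t|lebesgue_on {0<..}. LINT x|lebesgue_on I.
              - u t x * deriv (\<lambda>s. \<phi> (x, s)) t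
              + \<bar>weak_derivative I (u t) x\<bar> powr (p - 2) * weak_derivative I (u t) x
                  * deriv (\<lambda>y. \<phi> (y, t)) x
              + singular_term \<beta> (u t x) * \<phi> (x, t)
              + f (u t x) * \<phi> (x, t)) = 0))"

end

theory Submission
  imports Defs
begin

text \<open>The proof is an energy argument. Testing the equation with \<open>u\<close> itself gives, for
  \<open>y t = \<integral> u\<^sup>2\<close>, formally
  \<open>y' / 2 \<le> - \<integral> \<bar>u\<^sub>x\<bar> powr p - \<integral> u powr (1 - \<beta>)\<close>, because \<open>f u * u \<ge> 0\<close>. In one space dimension the
  first integral \<open>E\<close> on the right controls the supremum, \<open>sup u \<le> C * E powr (1 / p)\<close>. This has two
  consequences. First, \<open>y\<close> is at most a multiple of \<open>E powr (2 / p)\<close>, so that \<open>y' \<le> - c * y powr (p / 2)\<close>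
  with \<open>p / 2 > 1\<close>: within a time that does not depend on the size of the initial datum, \<open>y\<close> falls
  below one. Second, \<open>u\<^sup>2 = u powr (1 + \<beta>) * u powr (1 - \<beta>)\<close> bounds \<open>y\<close> by a multiple of
  \<open>D powr (1 + (1 + \<beta>) / p)\<close>, where \<open>D\<close> is the sum of the two integrals, so that
  \<open>y' \<le> - c * y powr \<theta>\<close> with \<open>\<theta> < 1\<close>: from one, \<open>y\<close> reaches zero in finite time. The ordinary
  differential inequalities are treated in \<open>extinction_time\<close>, the interpolation in
  \<open>dissipation_lower_bounds\<close>.

  The work lies in the energy inequality, since \<open>u\<close> is not an admissible test function: its time
  derivative is a distribution. Test functions that are products in \<open>x\<close> and \<open>t\<close> show that the integral of
  \<open>u t\<close> against a fixed \<open>\<zeta>\<close> is absolutely continuous in \<open>t\<close> (\<open>increment_test_function\<close>). By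
  approximation in the Sobolev norm, which is uniform (\<open>W1p_0_approximation\<close>), one may take \<open>\<zeta> = u t\<close> on
  a short time interval ending at \<open>t\<close>. Together with
  \<open>((u t)\<^sup>2 - (u s)\<^sup>2) / 2 \<le> u t * (u t - u s)\<close> this is \<open>energy_step\<close>. The flux in it belongs to
  times \<open>r\<close> before \<open>t\<close>, and the gradients at \<open>r\<close> and \<open>t\<close> have to be compared although \<open>u\<close> is only
  measurable in time as a function with values in the Sobolev space. The comparison is
  \<open>Bochner_modulus_of_continuity\<close>: the \<open>p\<close>-th power of the distance of the gradients at close times
  \<open>r\<close> and \<open>t\<close> is at most \<open>\<kappa> r + \<kappa> t\<close> for a function \<open>\<kappa>\<close> with arbitrarily small integral. Finally
  \<open>increment_le_integral\<close> passes from short intervals to long ones by averaging over their right end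
  points.\<close>

section \<open>Smooth functions\<close>

lemma Ck_Suc_has_derivative:
  assumes "\<And>z. (\<phi> has_derivative D z) (at z)" "\<And>b. b \<in> Basis \<Longrightarrow> Ck k (\<lambda>z. D z b)"
  shows "Ck (Suc k) \<phi>"
proof -
  have "\<phi> differentiable_on UNIV"
    using assms(1) by (auto simp: differentiable_on_def differentiable_def)
  moreover have "frechet_derivative \<phi> (at z) = D z" for z
    using frechet_derivative_at[OF assms(1)] by simp
  ultimately show ?thesis using assms(2) by auto
qed

lemma Ck_SucD:
  assumes "Ck (Suc k) \<phi>"
  shows "(\<phi> has_derivative frechet_derivative \<phi> (at z)) (at z)"
    "b \<in> Basis \<Longrightarrow> Ck k (\<lambda>z. frechet_derivative \<phi> (at z) b)"
  using assms by (auto simp: differentiable_on_def frechet_derivative_works)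

lemma Ck_continuous: "Ck k \<phi> \<Longrightarrow> continuous_on UNIV \<phi>"
  by (cases k) (auto intro: differentiable_imp_continuous_on)

lemma Ck_SucD_less: "Ck (Suc k) \<phi> \<Longrightarrow> Ck k \<phi>"
proof (induction k arbitrary: \<phi>)
  case 0
  then show ?case using Ck_continuous[OF 0] by simp
next
  case (Suc k)
  show ?case
    by (rule Ck_Suc_has_derivative[OF Ck_SucD(1)[OF Suc.prems]])
      (rule Suc.IH[OF Ck_SucD(2)[OF Suc.prems]])
qed

lemma Ck_const: "Ck k (\<lambda>z. c)"
proof (induction k arbitrary: c)
  case (Suc k)
  show ?case
    by (rule Ck_Suc_has_derivative[where D="\<lambda>z h. 0"]) (auto intro: Suc)
qed auto

lemma Ck_add: "Ck k f \<Longrightarrow> Ck k g \<Longrightarrow> Ck k (\<lambda>z. f z + g z)"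
proof (induction k arbitrary: f g)
  case 0 then show ?case by (auto intro: continuous_intros)
next
  case (Suc k)
  show ?case
    by (rule Ck_Suc_has_derivative[OF has_derivative_add[OF Ck_SucD(1)[OF Suc.prems(1)] Ck_SucD(1)[OF Suc.prems(2)]]])
      (rule Suc.IH[OF Ck_SucD(2)[OF Suc.prems(1)] Ck_SucD(2)[OF Suc.prems(2)]])
qed

lemma Ck_mult: "Ck k f \<Longrightarrow> Ck k g \<Longrightarrow> Ck k (\<lambda>z. f z * g z)"
proof (induction k arbitrary: f g)
  case 0 then show ?case by (auto intro: continuous_intros)
next
  case (Suc k)
  show ?case
    by (rule Ck_Suc_has_derivative[OF has_derivative_mult[OF Ck_SucD(1)[OF Suc.prems(1)] Ck_SucD(1)[OF Suc.prems(2)]]])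
      (intro Ck_add Suc.IH Ck_SucD(2)[OF Suc.prems(1)] Ck_SucD(2)[OF Suc.prems(2)]
        Ck_SucD_less[OF Suc.prems(1)] Ck_SucD_less[OF Suc.prems(2)])
qed

lemma Ck_diff: "Ck k f \<Longrightarrow> Ck k g \<Longrightarrow> Ck k (\<lambda>z. f z - g z)"
  using Ck_add[OF _ Ck_mult[OF Ck_const[of k "-1"], of g], of f] by simp

lemma Ck_SucI_real:
  assumes "\<And>x. (f has_real_derivative f' x) (at x)" "Ck k f'"
  shows "Ck (Suc k) f"
  by (rule Ck_Suc_has_derivative[OF assms(1)[unfolded has_field_derivative_def]]) (use assms(2) in simp)

lemma Ck_SucD_real:
  assumes "Ck (Suc k) f"
  shows "(f has_real_derivative deriv f x) (at x)" "Ck k (deriv f)"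
proof -
  have *: "(f has_real_derivative frechet_derivative f (at x) 1) (at x)" for x
  proof -
    have D: "(f has_derivative frechet_derivative f (at x)) (at x)" by (rule Ck_SucD(1)[OF assms])
    have "frechet_derivative f (at x) = (*) (frechet_derivative f (at x) 1)"
    proof
      fix h :: real
      have "frechet_derivative f (at x) (h *\<^sub>R 1) = h *\<^sub>R frechet_derivative f (at x) 1"
        using has_derivative_linear[OF D] by (rule linear_scale)
      then show "frechet_derivative f (at x) h = frechet_derivative f (at x) 1 * h"
        by (simp add: mult.commute)
    qed
    with D show ?thesis unfolding has_field_derivative_def by simp
  qed
  have eq: "deriv f x = frechet_derivative f (at x) 1" for x
    by (rule DERIV_imp_deriv[OF *])
  show "(f has_real_derivative deriv f x) (at x)" using * eq by simp
  show "Ck k (deriv f)"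
    using Ck_SucD(2)[OF assms, of 1] by (simp add: eq[abs_def] )
qed

lemma Ck_compose_affine:
  fixes f :: "real \<Rightarrow> real" and L :: "'a::euclidean_space \<Rightarrow> real"
  assumes L: "bounded_linear L"
  shows "Ck k f \<Longrightarrow> Ck k (\<lambda>z. f (L z + d))"
proof (induction k arbitrary: f)
  case 0
  have "continuous_on UNIV (\<lambda>z. L z + d)"
    by (intro continuous_intros linear_continuous_on L)
  with 0 show ?case
    using continuous_on_compose2[of UNIV f UNIV "\<lambda>z. L z + d"] by auto
next
  case (Suc k)
  have "((\<lambda>z. f (L z + d)) has_derivative (\<lambda>h. deriv f (L z + d) * L h)) (at z)" for z
  proof -
    have "((\<lambda>z. L z + d) has_derivative L) (at z)"
      using bounded_linear_imp_has_derivative[OF L] by (auto intro!: derivative_eq_intros)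
    from has_derivative_compose[OF this Ck_SucD_real(1)[OF Suc.prems, unfolded has_field_derivative_def]]
    show ?thesis by simp
  qed
  then show ?case
    by (rule Ck_Suc_has_derivative) (intro Ck_mult Ck_const Suc.IH Ck_SucD_real(2)[OF Suc.prems])
qed

lemma Ck_tensor:
  fixes f g :: "real \<Rightarrow> real"
  assumes "Ck k f" "Ck k g"
  shows "Ck k (\<lambda>z. f (fst z) * g (snd z))"
  using Ck_mult[OF Ck_compose_affine[OF bounded_linear_fst assms(1), of 0]
      Ck_compose_affine[OF bounded_linear_snd assms(2), of 0]] by simp

section \<open>Smooth steps\<close>

text \<open>The negative powers of \<open>x\<close> make this family closed under differentiation.\<close>

definition flat :: "nat \<Rightarrow> real \<Rightarrow> real" where
  "flat n x = (if x > 0 then inverse x ^ n * exp (- inverse x) else 0)"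

lemma flat_tendsto_0: "(flat n \<longlongrightarrow> 0) (at 0)"
proof -
  have "((\<lambda>x. inverse x ^ n / exp (inverse x)) \<longlongrightarrow> (0::real)) (at_right 0)"
    by (rule filterlim_compose[OF tendsto_power_div_exp_0 filterlim_inverse_at_top_right])
  then have "(flat n \<longlongrightarrow> 0) (at_right 0)"
  proof (rule Lim_transform_eventually)
    show "\<forall>\<^sub>F x in at_right 0. inverse x ^ n / exp (inverse x) = flat n x"
      by (rule eventually_at_rightI[of _ 1]) (auto simp: flat_def exp_minus field_simps)
  qed
  moreover have "(flat n \<longlongrightarrow> 0) (at_left 0)"
    by (rule tendsto_eventually, rule eventually_at_leftI[of "-1"]) (auto simp: flat_def)
  ultimately show ?thesis by (simp add: filterlim_split_at)
qed

lemma flat_has_derivative: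
  "(flat n has_real_derivative flat (n + 2) x - real n * flat (n + 1) x) (at x)"
proof (cases "x = 0")
  case False
  show ?thesis
  proof (cases "x > 0")
    case True
    have "((\<lambda>x. inverse x ^ n * exp (- inverse x)) has_real_derivative
        flat (n + 2) x - real n * flat (n + 1) x) (at x)"
      using True by (auto intro!: derivative_eq_intros simp: flat_def field_simps power2_eq_square)
        (cases n; simp add: field_simps)
    moreover have "\<forall>\<^sub>F y in nhds x. inverse y ^ n * exp (- inverse y) = flat n y"
      using eventually_nhds_in_open[of "{0<..}" x] True
      by (auto elim!: eventually_mono simp: flat_def)
    ultimately show ?thesis by (subst DERIV_cong_ev[OF refl _ refl, of _ "\<lambda>x. inverse x ^ n * exp (- inverse x)"]) (auto elim: eventually_mono)
  next
    case False
    with \<open>x \<noteq> 0\<close> have "x < 0" by simp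
    have "\<forall>\<^sub>F y in nhds x. flat n y = 0"
      using eventually_nhds_in_open[of "{..<0}" x] \<open>x < 0\<close>
      by (auto elim!: eventually_mono simp: flat_def)
    then have "(flat n has_real_derivative 0) (at x)"
      by (subst DERIV_cong_ev[OF refl _ refl]) (auto intro: DERIV_const)
    then show ?thesis using \<open>x < 0\<close> by (simp add: flat_def)
  qed
next
  case True
  have "(\<lambda>h. (flat n (0 + h) - flat n 0) / h) = flat (Suc n)"
    by (auto simp: flat_def field_simps)
  then have "((\<lambda>h. (flat n (0 + h) - flat n 0) / h) \<longlongrightarrow> 0) (at 0)"
    using flat_tendsto_0[of "Suc n"] by (simp only:)
  then show ?thesis
    using True by (simp add: DERIV_def flat_def)
qed

lemma Ck_flat: "Ck k (flat n)"
proof (induction k arbitrary: n)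
  case 0
  show ?case
    by (simp add: continuous_at_imp_continuous_on DERIV_isCont[OF flat_has_derivative])
next
  case (Suc k)
  show ?case
    by (rule Ck_SucI_real[OF flat_has_derivative]) (intro Ck_diff Ck_mult Ck_const Suc)
qed

text \<open>The product of \<open>flat 0 x\<close> and \<open>flat 0 (1 - x)\<close> is smooth and positive exactly on the open unit
  interval; a normalized primitive of it has the required properties.\<close>

lemma smooth_step_exists:
  "\<exists>h::real \<Rightarrow> real. (\<forall>k. Ck k h) \<and> (\<forall>x\<le>0. h x = 0) \<and> (\<forall>x\<ge>1. h x = 1) \<and> mono h"
proof -
  define g where "g x = flat 0 x * flat 0 (1 - x)" for x :: real
  have Ckg: "Ck k g" for k
  proof -
    have "Ck k (\<lambda>x. flat 0 (- x + 1))"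
      by (rule Ck_compose_affine[OF bounded_linear_minus[OF bounded_linear_ident] Ck_flat])
    from Ck_mult[OF Ck_flat this] show ?thesis
      unfolding g_def by (simp only: diff_conv_add_uminus add.commute)
  qed
  have g0: "0 \<le> g x" "x \<le> 0 \<Longrightarrow> g x = 0" "x \<ge> 1 \<Longrightarrow> g x = 0" "0 < x \<Longrightarrow> x < 1 \<Longrightarrow> 0 < g x" for x
    by (auto simp: g_def flat_def)
  have "isCont g x" for x
    using Ck_continuous[OF Ckg] by (simp add: continuous_on_eq_continuous_at)
  then obtain F where F: "\<And>x. (F has_real_derivative g x) (at x)"
    using einterval_antiderivative[of "-\<infinity>" "\<infinity>" g]
    by (auto simp: has_real_derivative_iff_has_vector_derivative)
  have mono: "F x \<le> F y" if "x \<le> y" for x y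
    by (rule DERIV_nonneg_imp_nondecreasing[OF that]) (use F g0 in blast)
  have lo: "F x = F 0" if "x \<le> 0" for x
  proof (rule antisym[OF mono[OF that]])
    show "F 0 \<le> F x"
      by (rule DERIV_nonpos_imp_nonincreasing[OF that]) (use F g0(2) in fastforce)
  qed
  have hi: "F x = F 1" if "1 \<le> x" for x
  proof (rule antisym[OF _ mono[OF that]])
    show "F x \<le> F 1"
      by (rule DERIV_nonpos_imp_nonincreasing[OF that]) (use F g0(3) in fastforce)
  qed
  have "F 0 < F 1"
  proof (rule DERIV_pos_imp_increasing_open[of 0 1])
    show "\<exists>y. (F has_real_derivative y) (at x) \<and> 0 < y" if "0 < x" "x < 1" for x
      using F g0(4)[OF that] by blast
    show "continuous_on {0..1} F"
      using F by (meson DERIV_isCont continuous_at_imp_continuous_on)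
  qed simp
  define h where "h x = (F x - F 0) * inverse (F 1 - F 0)" for x
  have "Ck k F" for k
    using Ck_SucD_less[OF Ck_SucI_real[OF F Ckg]] .
  then have "Ck k h" for k
    unfolding h_def by (intro Ck_mult Ck_diff Ck_const)
  moreover have "h x = 0" if "x \<le> 0" for x
    using lo[OF that] by (simp add: h_def)
  moreover have "h x = 1" if "1 \<le> x" for x
    using hi[OF that] \<open>F 0 < F 1\<close> by (simp add: h_def)
  moreover have "mono h"
    using mono \<open>F 0 < F 1\<close> unfolding h_def by (intro monoI mult_right_mono) auto
  ultimately show ?thesis by blast
qed

definition smooth_step :: "real \<Rightarrow> real" where
  "smooth_step = (SOME h. (\<forall>k. Ck k h) \<and> (\<forall>x\<le>0. h x = 0) \<and> (\<forall>x\<ge>1. h x = 1) \<and> mono h)"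

lemma smooth_step_properties:
  shows Ck_smooth_step: "Ck k smooth_step"
    and smooth_step_0: "x \<le> 0 \<Longrightarrow> smooth_step x = 0"
    and smooth_step_1: "1 \<le> x \<Longrightarrow> smooth_step x = 1"
    and mono_smooth_step: "mono smooth_step"
  using someI_ex[OF smooth_step_exists] unfolding smooth_step_def[symmetric] by auto

lemma smooth_step_bounds: "0 \<le> smooth_step x" "smooth_step x \<le> 1"
  using monoD[OF mono_smooth_step, of "min x 0" x] monoD[OF mono_smooth_step, of x "max x 1"]
  by (auto simp: smooth_step_0 smooth_step_1)

lemma DERIV_smooth_step: "(smooth_step has_real_derivative deriv smooth_step x) (at x)"
  using Ck_SucD_real(1)[OF Ck_smooth_step] .

lemma deriv_smooth_step_nonneg: "0 \<le> deriv smooth_step x"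
  using mono_on_imp_deriv_nonneg[OF mono_smooth_step DERIV_smooth_step] by simp

lemma deriv_smooth_step_0:
  assumes "x < 0 \<or> 1 < x" shows "deriv smooth_step x = 0"
proof -
  have "\<exists>c. \<forall>\<^sub>F y in nhds x. smooth_step y = c"
  proof (cases "x < 0")
    case True
    then show ?thesis
      using eventually_nhds_in_open[of "{..<0}" x] by (intro exI[of _ 0]) (auto elim!: eventually_mono simp: smooth_step_0)
  next
    case False
    then show ?thesis using assms
      eventually_nhds_in_open[of "{1<..}" x] by (intro exI[of _ 1]) (auto elim!: eventually_mono simp: smooth_step_1)
  qed
  then obtain c where "\<forall>\<^sub>F y in nhds x. smooth_step y = c" by blast
  then have "(smooth_step has_real_derivative 0) (at x)"
    by (subst DERIV_cong_ev[OF refl _ refl]) (auto intro: DERIV_const)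
  then show ?thesis by (rule DERIV_imp_deriv)
qed

lemma Ck_smooth_step_affine: "Ck k (\<lambda>x::real. smooth_step (c * (x - a)))"
  using Ck_compose_affine[OF bounded_linear_mult_right Ck_smooth_step, of k c "- c * a"]
  by (simp add: algebra_simps)

lemma DERIV_smooth_step_affine:
  "((\<lambda>t. smooth_step (N * (t - c))) has_real_derivative N * deriv smooth_step (N * (t - c))) (at t)"
proof -
  have "((\<lambda>t. N * (t - c)) has_real_derivative N) (at t)" by (auto intro!: derivative_eq_intros)
  from DERIV_chain2[OF DERIV_smooth_step this] show ?thesis by (simp add: mult.commute)
qed

lemma continuous_on_deriv_smooth_step_affine:
  "continuous_on A (\<lambda>t. N * deriv smooth_step (N * (t - c)))"
proof -
  have "continuous_on UNIV (deriv smooth_step)" by (rule Ck_continuous[OF Ck_SucD_real(2)[OF Ck_smooth_step]])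
  then have "continuous_on A (\<lambda>t. deriv smooth_step (N * (t - c)))"
    by (rule continuous_on_compose2) (auto intro!: continuous_intros)
  then show ?thesis by (intro continuous_on_mult continuous_on_const)
qed

section \<open>Test functions\<close>

lemma test_function_Ck: "test_function S \<phi> \<Longrightarrow> Ck k \<phi>"
  by (simp add: test_function_def)

lemma test_functionI:
  assumes "\<And>k. Ck k \<phi>" "compact K" "K \<subseteq> S" "\<And>z. z \<notin> K \<Longrightarrow> \<phi> z = 0"
  shows "test_function S \<phi>"
proof -
  have "closure {z. \<phi> z \<noteq> 0} \<subseteq> K"
    using assms by (intro closure_minimal compact_imp_closed) auto
  moreover from this have "compact (closure {z. \<phi> z \<noteq> 0})"
    using compact_Int_closed[OF assms(2) closed_closure[of "{z. \<phi> z \<noteq> 0}"]] by (simp add: inf_absorb2)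
  ultimately show ?thesis
    using assms(1,3) unfolding test_function_def by blast
qed

lemma test_functionD:
  assumes "test_function S \<phi>"
  shows "\<exists>K. compact K \<and> K \<subseteq> S \<and> (\<forall>z. z \<notin> K \<longrightarrow> \<phi> z = 0)"
  using assms closure_subset[of "{z. \<phi> z \<noteq> 0}"] unfolding test_function_def by blast

lemma test_function_diff:
  assumes "test_function S \<phi>" "test_function S \<psi>"
  shows "test_function S (\<lambda>z. \<phi> z - \<psi> z)"
proof -
  obtain K where "compact K" "K \<subseteq> S" "\<And>z. z \<notin> K \<Longrightarrow> \<phi> z = 0"
    using test_functionD[OF assms(1)] by metis
  moreover obtain L where "compact L" "L \<subseteq> S" "\<And>z. z \<notin> L \<Longrightarrow> \<psi> z = 0"
    using test_functionD[OF assms(2)] by metis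
  ultimately show ?thesis
    by (intro test_functionI[of _ "K \<union> L"] Ck_diff test_function_Ck[OF assms(1)] test_function_Ck[OF assms(2)]) auto
qed

lemma test_function_mult:
  assumes "test_function S \<phi>" "\<And>k. Ck k \<psi>"
  shows "test_function S (\<lambda>z. \<phi> z * \<psi> z)"
proof -
  obtain K where "compact K" "K \<subseteq> S" "\<And>z. z \<notin> K \<Longrightarrow> \<phi> z = 0"
    using test_functionD[OF assms(1)] by metis
  then show ?thesis
    by (intro test_functionI[of _ K] Ck_mult test_function_Ck[OF assms(1)] assms(2)) auto
qed

lemma test_function_tensor:
  fixes \<zeta> \<theta> :: "real \<Rightarrow> real"
  assumes "test_function S \<zeta>" "test_function T \<theta>"
  shows "test_function (S \<times> T) (\<lambda>z. \<zeta> (fst z) * \<theta> (snd z))"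
proof -
  obtain K where "compact K" "K \<subseteq> S" "\<And>z. z \<notin> K \<Longrightarrow> \<zeta> z = 0"
    using test_functionD[OF assms(1)] by metis
  moreover obtain L where "compact L" "L \<subseteq> T" "\<And>z. z \<notin> L \<Longrightarrow> \<theta> z = 0"
    using test_functionD[OF assms(2)] by metis
  ultimately show ?thesis
    by (intro test_functionI[of _ "K \<times> L"] Ck_tensor test_function_Ck[OF assms(1)] test_function_Ck[OF assms(2)] compact_Times) (auto; metis)+
qed

lemma test_function_DERIV:
  fixes \<phi> :: "real \<Rightarrow> real"
  assumes "test_function S \<phi>"
  shows "(\<phi> has_real_derivative deriv \<phi> x) (at x)"
  using Ck_SucD_real(1)[OF test_function_Ck[OF assms]] .

lemma test_function_deriv:
  fixes \<phi> :: "real \<Rightarrow> real"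
  assumes "test_function S \<phi>"
  shows "test_function S (deriv \<phi>)"
proof -
  obtain K where K: "compact K" "K \<subseteq> S" "\<And>z. z \<notin> K \<Longrightarrow> \<phi> z = 0"
    using test_functionD[OF assms] by metis
  have "deriv \<phi> z = 0" if "z \<notin> K" for z
  proof -
    have "\<forall>\<^sub>F y in nhds z. \<phi> y = 0"
      using eventually_nhds_in_open[of "- K" z] K(3) that compact_imp_closed[OF K(1)]
      by (auto simp: open_Compl elim!: eventually_mono)
    then have "(\<phi> has_real_derivative 0) (at z)"
      by (subst DERIV_cong_ev[OF refl _ refl]) (auto intro: DERIV_const)
    then show ?thesis by (rule DERIV_imp_deriv)
  qed
  then show ?thesis
    using K by (intro test_functionI[of _ K] Ck_SucD_real(2)[OF test_function_Ck[OF assms]]) auto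
qed

lemma test_function_continuous: "test_function S \<phi> \<Longrightarrow> continuous_on A \<phi>"
  using Ck_continuous test_function_Ck continuous_on_subset by blast

lemma test_function_0: "test_function S \<phi> \<Longrightarrow> z \<notin> S \<Longrightarrow> \<phi> z = 0"
  using test_functionD[of S \<phi>] by blast

lemma test_function_bounded:
  assumes "test_function S \<phi>"
  obtains B where "\<And>z. \<bar>\<phi> z\<bar> \<le> B" "0 \<le> B"
proof -
  obtain K where K: "compact K" "K \<subseteq> S" "\<And>z. z \<notin> K \<Longrightarrow> \<phi> z = 0"
    using test_functionD[OF assms] by metis
  have "bounded (\<phi> ` K)"
    using K test_function_continuous[OF assms] by (intro compact_imp_bounded compact_continuous_image)
  then obtain B where "\<And>z. z \<in> K \<Longrightarrow> \<bar>\<phi> z\<bar> \<le> B"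
    by (auto simp: bounded_iff)
  then have "\<bar>\<phi> z\<bar> \<le> max B 0" for z
    using K(3)[of z] by (cases "z \<in> K") (auto intro: le_max_iff_disj[THEN iffD2])
  then show ?thesis by (rule that) simp
qed

definition plateau :: "nat \<Rightarrow> real \<Rightarrow> real \<Rightarrow> real \<Rightarrow> real" where
  "plateau n a b x = smooth_step (real n * (x - a)) - smooth_step (real n * (x - b))"

lemma test_function_plateau:
  assumes "{a..b + 1 / real n} \<subseteq> S" "a \<le> b" "0 < n"
  shows "test_function S (plateau n a b)"
proof (rule test_functionI[OF _ _ assms(1)])
  show "Ck k (plateau n a b)" for k
    unfolding plateau_def[abs_def] by (intro Ck_diff Ck_smooth_step_affine)
  show "plateau n a b z = 0" if "z \<notin> {a..b + 1 / real n}" for z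
  proof -
    consider "z < a" | "b + 1 / real n < z" using \<open>z \<notin> _\<close> by fastforce
    then show ?thesis
    proof cases
      case 1
      then show ?thesis using assms by (simp add: plateau_def smooth_step_0 mult_nonneg_nonpos)
    next
      case 2
      then have "1 \<le> real n * (z - b)" using assms by (simp add: field_simps)
      moreover have "1 \<le> real n * (z - a)"
        using calculation assms by (smt (verit) mult_left_mono of_nat_0_le_iff)
      ultimately show ?thesis by (simp add: plateau_def smooth_step_1)
    qed
  qed
qed simp

lemma plateau_bounds:
  assumes "a \<le> b" shows "\<bar>plateau n a b x\<bar> \<le> 1"
  using smooth_step_bounds[of "real n * (x - a)"] smooth_step_bounds[of "real n * (x - b)"]
  unfolding plateau_def by linarith

lemma plateau_tendsto:
  assumes "a \<le> b"
  shows "(\<lambda>n. plateau n a b x) \<longlonglongrightarrow> indicat_real {a<..b} x"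
proof -
  have *: "(\<lambda>n. smooth_step (real n * (x - c))) \<longlonglongrightarrow> (if c < x then 1 else 0)" for c
  proof (cases "c < x")
    case True
    obtain N :: nat where N: "1 < real N * (x - c)" using True by (metis diff_gt_0_iff_gt reals_Archimedean3)
    have "\<forall>\<^sub>F n in sequentially. smooth_step (real n * (x - c)) = 1"
      using eventually_ge_at_top[of N]
    proof eventually_elim
      case (elim n)
      then have "real N * (x - c) \<le> real n * (x - c)" using True by (simp add: mult_right_mono)
      then show ?case using N by (intro smooth_step_1) linarith
    qed
    then show ?thesis using True by (simp add: tendsto_eventually)
  next
    case False
    then show ?thesis by (simp add: smooth_step_0 mult_nonneg_nonpos)
  qed
  have "(\<lambda>n. plateau n a b x) \<longlonglongrightarrow> (if a < x then 1 else 0) - (if b < x then 1 else 0)"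
    unfolding plateau_def by (intro tendsto_diff *)
  then show ?thesis using assms by (auto simp: indicator_def split: if_splits)
qed

section \<open>Measurability and integrability on subsets\<close>

lemma AE_lebesgue_on_iff_negligible:
  assumes "S \<in> sets lebesgue"
  shows "(AE x in lebesgue_on S. P x) \<longleftrightarrow> negligible {x \<in> S. \<not> P x}"
proof -
  have "{x. \<not> (x \<in> S \<longrightarrow> P x)} = {x \<in> S. \<not> P x}" by auto
  then show ?thesis
    using assms completion.AE_iff_null_sets[where P="\<lambda>x. x \<in> S \<longrightarrow> P x" and M=lborel]
    by (simp add: AE_restrict_space_iff negligible_iff_null_sets)
qed

lemma AE_lebesgue_on_subset:
  assumes "AE x in lebesgue_on T. P x" "J \<subseteq> T" "T \<in> sets lebesgue" "J \<in> sets lebesgue"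
  shows "AE x in lebesgue_on J. P x"
  using assms by (auto simp: AE_restrict_space_iff elim!: eventually_mono)

lemma borel_measurable_lebesgue_on_borel:
  assumes "\<psi> \<in> borel_measurable borel"
  shows "\<psi> \<in> borel_measurable (lebesgue_on S)"
  using assms by (simp add: measurable_completion measurable_restrict_space1)

lemmas borel_measurable_lebesgue_on_continuous =
  borel_measurable_lebesgue_on_borel[OF borel_measurable_continuous_onI]

lemma borel_measurable_lebesgue_on_AE_cong:
  fixes f g :: "'a::euclidean_space \<Rightarrow> real"
  assumes "f \<in> borel_measurable (lebesgue_on S)" "AE x in lebesgue_on S. f x = g x" "S \<in> sets lebesgue"
  shows "g \<in> borel_measurable (lebesgue_on S)"
proof -
  have "AE x in lebesgue. (if x \<in> S then f x else 0) = (if x \<in> S then g x else 0)"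
    using assms(2,3) by (auto simp: AE_restrict_space_iff elim!: eventually_mono)
  with borel_measurable_if_I[OF assms(1,3)] have "(\<lambda>x. if x \<in> S then g x else 0) \<in> borel_measurable lebesgue"
    by (rule borel_measurable_AE)
  then show ?thesis by (rule borel_measurable_if_D)
qed

lemma borel_measurable_lebesgue_on_AE_LIMSEQ:
  fixes f :: "nat \<Rightarrow> 'a::euclidean_space \<Rightarrow> real"
  assumes "\<And>n. f n \<in> borel_measurable (lebesgue_on T)" "AE t in lebesgue_on T. (\<lambda>n. f n t) \<longlonglongrightarrow> g t"
    "T \<in> sets lebesgue"
  shows "g \<in> borel_measurable (lebesgue_on T)"
proof (rule borel_measurable_lebesgue_on_AE_cong[OF borel_measurable_lim_metric[OF assms(1)] _ assms(3)])
  show "AE x in lebesgue_on T. lim (\<lambda>i. f i x) = g x"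
    using assms(2) by eventually_elim (rule limI)
qed

lemma integrable_lebesgue_on_AE_cong:
  fixes f g :: "'a::euclidean_space \<Rightarrow> real"
  assumes "integrable (lebesgue_on S) f" "AE x in lebesgue_on S. f x = g x" "S \<in> sets lebesgue"
  shows "integrable (lebesgue_on S) g"
  by (rule integrable_cong_AE_imp[OF assms(1) borel_measurable_lebesgue_on_AE_cong[OF _ assms(2,3)]])
    (use assms in auto)

lemma integrable_lebesgue_on_subset:
  fixes f :: "'a::euclidean_space \<Rightarrow> real"
  assumes "integrable (lebesgue_on T) f" "J \<subseteq> T" "T \<in> sets lebesgue" "J \<in> sets lebesgue"
  shows "integrable (lebesgue_on J) f"
  using set_integrable_subset[of lebesgue T f J] assms
  unfolding set_integrable_def by (simp add: integrable_restrict_space)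

lemma integrable_on_subset_zero_outside:
  fixes h :: "'a::euclidean_space \<Rightarrow> real"
  assumes "integrable (lebesgue_on K) h" "K \<subseteq> S" "K \<in> sets lebesgue" "S \<in> sets lebesgue"
    "\<And>x. x \<in> S \<Longrightarrow> x \<notin> K \<Longrightarrow> h x = 0"
  shows "integrable (lebesgue_on S) h"
proof -
  have "(\<lambda>x. if x \<in> S then h x else 0) = (\<lambda>x. if x \<in> K then h x else 0)"
    using assms by (auto simp: fun_eq_iff)
  then show ?thesis using assms by (metis Lebesgue_Measure.integrable_restrict_UNIV)
qed

lemma integrable_mult_bounded:
  fixes g \<psi> :: "_ \<Rightarrow> real"
  assumes "integrable M g" "\<psi> \<in> borel_measurable M" "AE x in M. \<bar>\<psi> x\<bar> \<le> B"
  shows "integrable M (\<lambda>x. g x * \<psi> x)"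
proof (rule Bochner_Integration.integrable_bound[OF integrable_mult_left[OF assms(1), of B]])
  show "AE x in M. norm (g x * \<psi> x) \<le> norm (g x * B)"
    using assms(3)
  proof eventually_elim
    case (elim x)
    then have "\<bar>g x\<bar> * \<bar>\<psi> x\<bar> \<le> \<bar>g x\<bar> * \<bar>B\<bar>" by (intro mult_left_mono) auto
    then show ?case by (simp add: abs_mult)
  qed
qed (use assms in measurable)

lemma integrable_bounded_lmeasurable:
  fixes \<psi> :: "_ \<Rightarrow> real"
  assumes "S \<in> lmeasurable" "\<psi> \<in> borel_measurable (lebesgue_on S)" "\<And>x. \<bar>\<psi> x\<bar> \<le> B"
  shows "integrable (lebesgue_on S) \<psi>"
  by (rule finite_measure.integrable_const_bound[OF finite_measure_lebesgue_on[OF assms(1)], where B=B])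
    (use assms in auto)

lemma test_function_integrable:
  assumes "test_function S \<phi>" "T \<in> lmeasurable"
  shows "integrable (lebesgue_on T) \<phi>"
proof -
  obtain B where "\<And>z. \<bar>\<phi> z\<bar> \<le> B" using test_function_bounded[OF assms(1)] by metis
  then show ?thesis
    by (intro integrable_bounded_lmeasurable assms borel_measurable_lebesgue_on_continuous
        test_function_continuous[OF assms(1)])
qed

lemma simple_function_lebesgue_on_subset:
  assumes s: "simple_function (lebesgue_on T) s" and J: "J \<subseteq> T" "J \<in> sets lebesgue"
  shows "simple_function (lebesgue_on J) s"
  unfolding simple_function_def
proof
  show "finite (s ` space (lebesgue_on J))"
    using finite_subset[OF image_mono[OF J(1)] simple_functionD(1)[OF s, simplified]] by simp
  show "\<forall>x\<in>s ` space (lebesgue_on J). s -` {x} \<inter> space (lebesgue_on J) \<in> sets (lebesgue_on J)"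
  proof
    fix x
    have "s -` {x} \<inter> T \<in> sets (lebesgue_on T)"
      using simple_functionD(2)[OF s, of "{x}"] by simp
    then obtain A where A: "A \<in> sets lebesgue" "s -` {x} \<inter> T = T \<inter> A" by (auto simp: sets_restrict_space)
    then have "s -` {x} \<inter> J = J \<inter> A" using J by auto
    then show "s -` {x} \<inter> space (lebesgue_on J) \<in> sets (lebesgue_on J)"
      using A by (auto simp: sets_restrict_space)
  qed
qed

text \<open>A null set lies in a Borel null set, to which Fubini's theorem for product measures applies.\<close>

lemma AE_lebesgue_slice:
  fixes P :: "real \<times> real \<Rightarrow> bool"
  assumes "AE z in lebesgue. P z"
  shows "AE t in lebesgue. AE x in lebesgue. P (x, t)"
proof -
  have "AE z in lborel \<Otimes>\<^sub>M lborel. P z"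
    using assms unfolding AE_completion_iff by (subst lborel_prod)
  then obtain N where N: "N \<in> null_sets (lborel \<Otimes>\<^sub>M lborel)" "{z \<in> space (lborel \<Otimes>\<^sub>M lborel). \<not> P z} \<subseteq> N"
    unfolding eventually_ae_filter by blast
  have "AE z in lborel \<Otimes>\<^sub>M lborel. z \<notin> N" by (rule AE_not_in[OF N(1)])
  then have "AE x in lborel. AE t in lborel. (x, t) \<notin> N"
    by (rule lborel_pair.AE_pair)
  moreover have "{z \<in> space (lborel \<Otimes>\<^sub>M lborel). (fst z, snd z) \<notin> N} \<in> sets (lborel \<Otimes>\<^sub>M lborel)"
  proof -
    have "{z \<in> space (lborel \<Otimes>\<^sub>M lborel). (fst z, snd z) \<notin> N} = space (lborel \<Otimes>\<^sub>M lborel) - N" by auto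
    then show ?thesis using sets.Diff[OF sets.top null_setsD2[OF N(1)]] by (simp only:)
  qed
  ultimately have "AE t in lborel. AE x in lborel. (x, t) \<notin> N"
    using lborel_pair.AE_commute[of "\<lambda>x t. (x, t) \<notin> N"] by simp
  then show ?thesis unfolding AE_completion_iff
    by (rule eventually_mono) (use N(2) in \<open>auto simp: space_pair_measure elim!: eventually_mono\<close>)
qed

lemma AE_lebesgue_on_slice:
  fixes P :: "real \<times> real \<Rightarrow> bool"
  assumes "AE z in lebesgue_on (S \<times> T). P z" "S \<in> sets borel" "T \<in> sets borel"
  shows "AE t in lebesgue_on T. AE x in lebesgue_on S. P (x, t)"
proof -
  have m: "S \<times> T \<in> sets lebesgue" "S \<in> sets lebesgue" "T \<in> sets lebesgue"
    using assms(2,3) by (auto simp: borel_Times)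
  have "AE t in lebesgue. AE x in lebesgue. (x, t) \<in> S \<times> T \<longrightarrow> P (x, t)"
    using assms(1) m by (intro AE_lebesgue_slice) (simp add: AE_restrict_space_iff)
  then show ?thesis
    using m by (auto simp: AE_restrict_space_iff elim!: eventually_mono)
qed

text \<open>The function is only Lebesgue measurable, which does not pass to slices. It agrees almost everywhere
  with a Borel function, and by the previous lemmas almost all slices of the two agree almost
  everywhere.\<close>

lemma integrable_lebesgue_on_slice:
  fixes g :: "real \<Rightarrow> real \<Rightarrow> real"
  assumes int: "integrable (lebesgue_on (S \<times> T)) (\<lambda>(x, t). g t x)"
    and ST: "S \<in> sets borel" "T \<in> sets borel"
  shows "AE t in lebesgue_on T. integrable (lebesgue_on S) (g t)"
    and "integrable (lebesgue_on T) (\<lambda>t. LINT x|lebesgue_on S. g t x)"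
proof -
  have m: "S \<times> T \<in> sets lebesgue" "S \<in> sets lebesgue" "T \<in> sets lebesgue"
    using ST by (auto simp: borel_Times)
  define G where "G z = (if z \<in> S \<times> T then g (snd z) (fst z) else 0)" for z
  have G: "integrable lebesgue G"
    using int m by (simp add: G_def[abs_def] Lebesgue_Measure.integrable_restrict_UNIV case_prod_unfold)
  then obtain G' where G': "G' \<in> borel_measurable lborel" "AE z in lborel. G z = G' z"
    using completion_ex_borel_measurable_real[of G lborel] by auto
  have AEG: "AE z in lebesgue. G z = G' z" using G'(2) by (rule AE_completion)
  have "integrable lebesgue G'"
    using G G'(1) AEG by (intro integrable_cong_AE_imp[OF G]) (auto simp: measurable_completion)
  then have intG': "integrable (lborel \<Otimes>\<^sub>M lborel) (case_prod (\<lambda>x t. G' (x, t)))"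
    using integrable_completion[OF G'(1)] by (simp add: lborel_prod)
  have slice: "AE t in lebesgue. AE x in lebesgue. G (x, t) = G' (x, t)"
    by (rule AE_lebesgue_slice[OF AEG])
  have sec: "AE t in lebesgue. integrable lborel (\<lambda>x. G' (x, t))"
    using lborel_pair.AE_integrable_snd[OF intG'] by (rule AE_completion)
  have good: "AE t in lebesgue. t \<in> T \<longrightarrow> integrable (lebesgue_on S) (g t) \<and>
      (LINT x|lborel. G' (x, t)) = (LINT x|lebesgue_on S. g t x)"
    using slice sec
  proof eventually_elim
    case (elim t)
    have m': "(\<lambda>x. G' (x, t)) \<in> borel_measurable lborel" using elim(2) by simp
    have i: "integrable lebesgue (\<lambda>x. G' (x, t))"
      using elim(2) integrable_completion[OF m'] by simp
    show ?case
    proof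
      assume t: "t \<in> T"
      have eq: "(\<lambda>x. G (x, t)) = (\<lambda>x. if x \<in> S then g t x else 0)"
        using t by (auto simp: G_def)
      have AE': "AE x in lebesgue. G' (x, t) = G (x, t)" using elim(1) by eventually_elim simp
      have Gi: "integrable lebesgue (\<lambda>x. G (x, t))"
        by (rule integrable_cong_AE_imp[OF i borel_measurable_AE[OF borel_measurable_integrable[OF i] AE'] AE'])
      have "(LINT x|lborel. G' (x, t)) = (LINT x|lebesgue. G' (x, t))"
        using integral_completion[OF m'] by simp
      also have "\<dots> = (LINT x|lebesgue. G (x, t))"
        by (rule integral_cong_AE) (use i Gi elim(1) in \<open>auto elim: eventually_mono\<close>)
      finally show "integrable (lebesgue_on S) (g t) \<and>
          (LINT x|lborel. G' (x, t)) = (LINT x|lebesgue_on S. g t x)"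
        using Gi m unfolding eq by (simp add: Lebesgue_Measure.integrable_restrict_UNIV Lebesgue_Measure.integral_restrict_UNIV)
    qed
  qed
  then show "AE t in lebesgue_on T. integrable (lebesgue_on S) (g t)"
    using m by (auto simp: AE_restrict_space_iff elim!: eventually_mono)
  have H: "integrable lborel (\<lambda>t. LINT x|lborel. G' (x, t))"
    using lborel_pair.integrable_snd[OF intG'] by simp
  then have "integrable lebesgue (\<lambda>t. LINT x|lborel. G' (x, t))"
    using integrable_completion[of "\<lambda>t. LINT x|lborel. G' (x, t)" lborel] by auto
  then have "integrable lebesgue (\<lambda>t. indicator T t *\<^sub>R (LINT x|lborel. G' (x, t)))"
    using m by (intro integrable_mult_indicator) auto
  then have "integrable (lebesgue_on T) (\<lambda>t. LINT x|lborel. G' (x, t))"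
    using m by (simp add: integrable_restrict_space)
  then show "integrable (lebesgue_on T) (\<lambda>t. LINT x|lebesgue_on S. g t x)"
    by (rule integrable_lebesgue_on_AE_cong)
      (use good m in \<open>auto simp: AE_restrict_space_iff elim!: eventually_mono\<close>)
qed

section \<open>Functions with integrable powers\<close>

lemma powr_abs_diff_le:
  fixes a b p :: real
  assumes "0 \<le> p" shows "\<bar>a - b\<bar> powr p \<le> 2 powr p * (\<bar>a\<bar> powr p + \<bar>b\<bar> powr p)"
proof -
  have "\<bar>a - b\<bar> powr p \<le> (2 * max \<bar>a\<bar> \<bar>b\<bar>) powr p"
    by (rule powr_mono2) (use assms in auto)
  also have "\<dots> = 2 powr p * (max \<bar>a\<bar> \<bar>b\<bar>) powr p" by (simp add: powr_mult)
  also have "\<dots> \<le> 2 powr p * (\<bar>a\<bar> powr p + \<bar>b\<bar> powr p)"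
    by (intro mult_left_mono) (auto simp: max_def)
  finally show ?thesis .
qed

lemma powr_abs_add_le:
  fixes a b p :: real
  assumes "0 \<le> p" shows "\<bar>a + b\<bar> powr p \<le> 2 powr p * (\<bar>a\<bar> powr p + \<bar>b\<bar> powr p)"
  using powr_abs_diff_le[OF assms, of a "- b"] by simp

lemma abs_le_one_plus_powr:
  fixes a p :: real assumes "1 \<le> p" shows "\<bar>a\<bar> \<le> 1 + \<bar>a\<bar> powr p"
proof (cases "\<bar>a\<bar> \<le> 1")
  case False
  then have "\<bar>a\<bar> powr 1 \<le> \<bar>a\<bar> powr p" using assms by (intro powr_mono) auto
  then show ?thesis using False by simp
qed (use powr_ge_zero[of "\<bar>a\<bar>" p] in linarith)

text \<open>The two terms dominate according to whether \<open>\<bar>y\<bar>\<close> is at most \<open>\<rho>\<close> or not. After integration and a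
  suitable choice of \<open>\<rho>\<close>, this has the same effect as Hoelder's inequality.\<close>

lemma abs_le_powr_split:
  fixes y p \<rho> :: real
  assumes "0 < \<rho>" "1 \<le> p" shows "\<bar>y\<bar> \<le> \<rho> + \<rho> powr (1 - p) * \<bar>y\<bar> powr p"
proof -
  have "\<bar>y / \<rho>\<bar> \<le> 1 + \<bar>y / \<rho>\<bar> powr p" by (rule abs_le_one_plus_powr[OF assms(2)])
  then have "\<bar>y\<bar> / \<rho> \<le> 1 + \<bar>y\<bar> powr p / \<rho> powr p"
    using assms by (simp add: powr_divide)
  then have "\<bar>y\<bar> \<le> \<rho> * (1 + \<bar>y\<bar> powr p / \<rho> powr p)"
    using assms by (simp add: pos_divide_le_eq mult.commute)
  also have "\<dots> = \<rho> + \<rho> powr (1 - p) * \<bar>y\<bar> powr p"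
    using assms by (simp add: powr_diff algebra_simps)
  finally show ?thesis .
qed

lemma borel_measurable_abs_powr:
  "g \<in> borel_measurable M \<Longrightarrow> (\<lambda>x. \<bar>g x\<bar> powr p :: real) \<in> borel_measurable M"
  by measurable

lemma bounded_Lp_space:
  fixes g :: "'a::euclidean_space \<Rightarrow> real"
  assumes m: "g \<in> borel_measurable (lebesgue_on S)" and B: "\<And>x. \<bar>g x\<bar> \<le> B"
    and S: "S \<in> lmeasurable" and p: "0 \<le> p"
  shows "g \<in> Lp_space p S"
proof -
  have "\<bar>\<bar>g x\<bar> powr p\<bar> \<le> B powr p" for x
    using powr_mono2[OF p _ B] by simp
  from integrable_bounded_lmeasurable[OF S borel_measurable_abs_powr[OF m] this]
  show ?thesis using m by (simp add: Lp_space_def)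
qed

lemma bounded_Lp_space_divide:
  fixes g :: "'a::euclidean_space \<Rightarrow> real"
  assumes g: "g \<in> borel_measurable (lebesgue_on S)" "\<And>x. \<bar>g x\<bar> \<le> B"
    and S: "S \<in> lmeasurable" and p: "0 \<le> p"
  shows "(\<lambda>x. - g x / real (Suc n)) \<in> Lp_space p S"
proof (rule bounded_Lp_space[OF _ _ S p])
  show "(\<lambda>x. - g x / real (Suc n)) \<in> borel_measurable (lebesgue_on S)" using g(1) by measurable
  show "\<bar>- g x / real (Suc n)\<bar> \<le> B" for x
  proof -
    have "\<bar>g x\<bar> / real (Suc n) \<le> \<bar>g x\<bar> / 1" by (intro divide_left_mono) auto
    then show ?thesis using g(2)[of x] by simp
  qed
qed

lemma test_function_Lp_space:
  fixes \<phi> :: "real \<Rightarrow> real"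
  assumes "test_function S \<phi>" "S \<in> lmeasurable" "0 \<le> p"
  shows "\<phi> \<in> Lp_space p S"
proof -
  obtain B where "\<And>z. \<bar>\<phi> z\<bar> \<le> B" using test_function_bounded[OF assms(1)] by metis
  then show ?thesis
    by (intro bounded_Lp_space[OF _ _ assms(2,3)] borel_measurable_lebesgue_on_continuous
        test_function_continuous[OF assms(1)])
qed

lemma Lp_zero: "0 < p \<Longrightarrow> (\<lambda>x. 0) \<in> Lp_space p S"
  by (simp add: Lp_space_def)

lemma Lp_space_diff:
  assumes "g \<in> Lp_space p S" "h \<in> Lp_space p S" "0 \<le> p"
  shows "(\<lambda>x. g x - h x) \<in> Lp_space p S"
proof -
  have "integrable (lebesgue_on S) (\<lambda>x. \<bar>g x - h x\<bar> powr p)"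
  proof (rule Bochner_Integration.integrable_bound)
    show "integrable (lebesgue_on S) (\<lambda>x. 2 powr p * (\<bar>g x\<bar> powr p + \<bar>h x\<bar> powr p))"
      using assms by (auto simp: Lp_space_def)
    show "(\<lambda>x. \<bar>g x - h x\<bar> powr p) \<in> borel_measurable (lebesgue_on S)"
      using assms by (intro borel_measurable_abs_powr) (auto simp: Lp_space_def)
  qed (use powr_abs_diff_le[OF assms(3)] in auto)
  then show ?thesis using assms by (auto simp: Lp_space_def)
qed

lemma Lp_space_AE_cong:
  assumes "g \<in> Lp_space p S" "h \<in> borel_measurable (lebesgue_on S)" "AE x in lebesgue_on S. g x = h x"
  shows "h \<in> Lp_space p S"
proof -
  have "integrable (lebesgue_on S) (\<lambda>x. \<bar>h x\<bar> powr p)"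
  proof (rule integrable_cong_AE_imp)
    show "integrable (lebesgue_on S) (\<lambda>x. \<bar>g x\<bar> powr p)" using assms by (simp add: Lp_space_def)
    show "AE x in lebesgue_on S. \<bar>g x\<bar> powr p = \<bar>h x\<bar> powr p"
      using assms(3) by eventually_elim simp
  qed (intro borel_measurable_abs_powr assms)
  then show ?thesis using assms by (simp add: Lp_space_def)
qed

lemma Lp_integral_nonneg: "0 \<le> (LINT x|M. \<bar>g x\<bar> powr p)" for g :: "_ \<Rightarrow> real"
  by (intro Bochner_Integration.integral_nonneg) simp

lemma Lp_diff_integral_le:
  assumes "g \<in> Lp_space p S" "h \<in> Lp_space p S" "k \<in> Lp_space p S" "0 \<le> p"
  shows "(LINT x|lebesgue_on S. \<bar>g x - h x\<bar> powr p)
    \<le> 2 powr p * ((LINT x|lebesgue_on S. \<bar>g x - k x\<bar> powr p) + (LINT x|lebesgue_on S. \<bar>h x - k x\<bar> powr p))"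
proof -
  have i: "integrable (lebesgue_on S) (\<lambda>x. \<bar>f x - f' x\<bar> powr p)"
    if "f \<in> Lp_space p S" "f' \<in> Lp_space p S" for f f'
    using Lp_space_diff[OF that assms(4)] by (simp add: Lp_space_def)
  have "(LINT x|lebesgue_on S. \<bar>g x - h x\<bar> powr p)
      \<le> (LINT x|lebesgue_on S. 2 powr p * (\<bar>g x - k x\<bar> powr p + \<bar>h x - k x\<bar> powr p))"
  proof (intro Bochner_Integration.integral_mono integrable_mult_right Bochner_Integration.integrable_add i assms)
    fix x
    show "\<bar>g x - h x\<bar> powr p \<le> 2 powr p * (\<bar>g x - k x\<bar> powr p + \<bar>h x - k x\<bar> powr p)"
      using powr_abs_diff_le[OF assms(4), of "g x - k x" "h x - k x"] by simp
  qed
  then show ?thesis using i[OF assms(1,3)] i[OF assms(2,3)] by simp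
qed

text \<open>The distinction is whether \<open>a - b\<close> is small relative to \<open>b\<close>. With a factor close to one in front of
  \<open>\<bar>b\<bar> powr p\<close>, this inequality does the work of Minkowski's in the proof that convergence in the mean
  implies convergence of the integrals of \<open>p\<close>-th powers.\<close>

lemma powr_quasi_triangle:
  fixes p \<eta> :: real
  assumes "0 < p" "0 < \<eta>"
  shows "\<exists>C\<ge>0. \<forall>a b. \<bar>a\<bar> powr p \<le> (1 + \<eta>) * \<bar>b\<bar> powr p + C * \<bar>a - b\<bar> powr p"
proof -
  define \<theta> where "\<theta> = (1 + \<eta>) powr (1 / p) - 1"
  have \<theta>: "0 < \<theta>" "(1 + \<theta>) powr p = 1 + \<eta>"
    using assms gr_one_powr[of "1 + \<eta>" "1 / p"] by (auto simp: \<theta>_def powr_powr)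
  have "\<bar>a\<bar> powr p \<le> (1 + \<eta>) * \<bar>b\<bar> powr p + (1 + 1 / \<theta>) powr p * \<bar>a - b\<bar> powr p" for a b
  proof (cases "\<bar>a - b\<bar> \<le> \<theta> * \<bar>b\<bar>")
    case True
    then have "\<bar>a\<bar> \<le> (1 + \<theta>) * \<bar>b\<bar>" by (simp add: algebra_simps)
    then have "\<bar>a\<bar> powr p \<le> ((1 + \<theta>) * \<bar>b\<bar>) powr p" using assms by (intro powr_mono2) auto
    also have "\<dots> = (1 + \<eta>) * \<bar>b\<bar> powr p" using \<theta> by (simp add: powr_mult)
    finally show ?thesis by (smt (verit) powr_ge_zero mult_nonneg_nonneg)
  next
    case False
    then have "\<bar>b\<bar> \<le> \<bar>a - b\<bar> / \<theta>" using \<theta> by (simp add: pos_le_divide_eq mult.commute)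
    then have "\<bar>a\<bar> \<le> (1 + 1 / \<theta>) * \<bar>a - b\<bar>" by (simp add: algebra_simps)
    then have "\<bar>a\<bar> powr p \<le> ((1 + 1 / \<theta>) * \<bar>a - b\<bar>) powr p" using assms by (intro powr_mono2) auto
    also have "\<dots> = (1 + 1 / \<theta>) powr p * \<bar>a - b\<bar> powr p" using \<theta> by (simp add: powr_mult)
    finally show ?thesis using assms by (smt (verit) powr_ge_zero mult_nonneg_nonneg)
  qed
  then show ?thesis by (intro exI[of _ "(1 + 1 / \<theta>) powr p"]) auto
qed

lemma Lp_integral_quasi_triangle:
  assumes C: "\<And>a b. \<bar>a\<bar> powr p \<le> (1 + \<eta>) * \<bar>b\<bar> powr p + C * \<bar>a - b\<bar> powr p"
    and gh: "g \<in> Lp_space p S" "h \<in> Lp_space p S" and p: "0 \<le> p"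
  shows "(LINT x|lebesgue_on S. \<bar>g x\<bar> powr p)
    \<le> (1 + \<eta>) * (LINT x|lebesgue_on S. \<bar>h x\<bar> powr p) + C * (LINT x|lebesgue_on S. \<bar>g x - h x\<bar> powr p)"
proof -
  have i: "integrable (lebesgue_on S) (\<lambda>x. \<bar>g x\<bar> powr p)" "integrable (lebesgue_on S) (\<lambda>x. \<bar>h x\<bar> powr p)"
    "integrable (lebesgue_on S) (\<lambda>x. \<bar>g x - h x\<bar> powr p)"
    using gh Lp_space_diff[OF gh p] by (auto simp: Lp_space_def)
  have "(LINT x|lebesgue_on S. \<bar>g x\<bar> powr p)
      \<le> (LINT x|lebesgue_on S. (1 + \<eta>) * \<bar>h x\<bar> powr p + C * \<bar>g x - h x\<bar> powr p)"
    by (intro Bochner_Integration.integral_mono i Bochner_Integration.integrable_add integrable_mult_right C)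
  then show ?thesis using i by simp
qed

lemma Lp_integral_tendsto:
  assumes g: "\<And>n::nat. g n \<in> Lp_space p S" and h: "h \<in> Lp_space p S" and p: "0 < p"
    and lim: "(\<lambda>n. LINT x|lebesgue_on S. \<bar>g n x - h x\<bar> powr p) \<longlonglongrightarrow> 0"
  shows "(\<lambda>n. LINT x|lebesgue_on S. \<bar>g n x\<bar> powr p) \<longlonglongrightarrow> (LINT x|lebesgue_on S. \<bar>h x\<bar> powr p)"
proof -
  define G where "G n = (LINT x|lebesgue_on S. \<bar>g n x\<bar> powr p)" for n
  define H where "H = (LINT x|lebesgue_on S. \<bar>h x\<bar> powr p)"
  define d where "d n = (LINT x|lebesgue_on S. \<bar>g n x - h x\<bar> powr p)" for n
  have nn: "0 \<le> G n" "0 \<le> H" "0 \<le> d n" for n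
    unfolding G_def H_def d_def by (rule Lp_integral_nonneg)+
  have "\<exists>N. \<forall>n\<ge>N. norm (G n - H) < e" if e: "0 < e" for e
  proof -
    \<comment> \<open>The sequence will first be bounded by \<open>H + e\<close>, so that \<open>\<eta>\<close> times either integral is at most \<open>e / 4\<close>.\<close>
    define \<eta> where "\<eta> = min 1 (e / (4 * (H + e + 1)))"
    have \<eta>: "0 < \<eta>" "\<eta> \<le> 1" using e nn(2) by (auto simp: \<eta>_def)
    have "\<eta> * (H + e + 1) \<le> e / (4 * (H + e + 1)) * (H + e + 1)"
      using nn(2) e by (intro mult_right_mono) (auto simp: \<eta>_def)
    also have "\<dots> = e / 4" using nn(2) e by (simp add: field_simps)
    finally have \<eta>H: "\<eta> * (H + e + 1) \<le> e / 4" .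
    obtain C where C: "0 \<le> C" "\<And>a b. \<bar>a\<bar> powr p \<le> (1 + \<eta>) * \<bar>b\<bar> powr p + C * \<bar>a - b\<bar> powr p"
      using powr_quasi_triangle[OF p \<eta>(1)] by blast
    have "(\<lambda>n. C * d n) \<longlonglongrightarrow> C * 0" using lim unfolding d_def by (intro tendsto_intros)
    then have "\<forall>\<^sub>F n in sequentially. C * d n < e / 4"
      using e by (intro order_tendstoD(2)) auto
    then obtain N where N: "\<And>n. n \<ge> N \<Longrightarrow> C * d n < e / 4" by (auto simp: eventually_sequentially)
    have "norm (G n - H) < e" if n: "n \<ge> N" for n
    proof -
      have 1: "G n \<le> (1 + \<eta>) * H + C * d n"
        unfolding G_def H_def d_def using p by (intro Lp_integral_quasi_triangle C g h) auto
      have 2: "H \<le> (1 + \<eta>) * G n + C * d n"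
        using Lp_integral_quasi_triangle[OF C(2) h g[of n]] p unfolding G_def H_def d_def
        by (simp add: abs_minus_commute)
      have "\<eta> * H \<le> e / 4" "\<eta> * (H + e) \<le> e / 4"
        by (rule order_trans[OF mult_left_mono \<eta>H]; use \<eta> e in simp)+
      moreover have "\<eta> * G n \<le> \<eta> * (H + e)"
        using 1 N[OF n] \<open>\<eta> * H \<le> e / 4\<close> \<eta> e by (intro mult_left_mono) (auto simp: algebra_simps)
      ultimately show ?thesis using 1 2 N[OF n] e by (auto simp: algebra_simps abs_if)
    qed
    then show ?thesis by blast
  qed
  then show ?thesis using LIMSEQ_iff unfolding G_def H_def by blast
qed

section \<open>Weak derivatives\<close>

lemma L1_locD: "h \<in> L1_loc S \<Longrightarrow> compact K \<Longrightarrow> K \<subseteq> S \<Longrightarrow> integrable (lebesgue_on K) h"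
  by (simp add: L1_loc_def)

lemma L1_loc_diff:
  assumes "g \<in> L1_loc S" "h \<in> L1_loc S" shows "(\<lambda>x. g x - h x) \<in> L1_loc S"
  using assms by (auto simp: L1_loc_def)

lemma integrable_L1_loc_mult_test_function:
  assumes h: "h \<in> L1_loc S" and \<phi>: "test_function S \<phi>" and S: "S \<in> sets lebesgue"
  shows "integrable (lebesgue_on S) (\<lambda>x. h x * \<phi> x)"
proof -
  obtain K where K: "compact K" "K \<subseteq> S" "\<And>z. z \<notin> K \<Longrightarrow> \<phi> z = 0"
    using test_functionD[OF \<phi>] by metis
  obtain B where "\<And>z. \<bar>\<phi> z\<bar> \<le> B" using test_function_bounded[OF \<phi>] by metis
  then have "integrable (lebesgue_on K) (\<lambda>x. h x * \<phi> x)"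
    by (intro integrable_mult_bounded[where B=B] L1_locD[OF h K(1,2)] AE_I2
        borel_measurable_lebesgue_on_continuous[OF test_function_continuous[OF \<phi>]])
  moreover have "K \<in> sets lebesgue" by (rule fmeasurableD[OF lmeasurable_compact[OF K(1)]])
  ultimately show ?thesis
    by (rule integrable_on_subset_zero_outside[OF _ K(2) _ S]) (simp add: K(3))
qed

text \<open>Almost every value of an integrable function is the limit of its mean values over small intervals.\<close>

lemma AE_zero_if_interval_integrals_zero:
  fixes f :: "real \<Rightarrow> real"
  assumes int: "f integrable_on {c..d}"
    and zero: "\<And>x y. c \<le> x \<Longrightarrow> x \<le> y \<Longrightarrow> y \<le> d \<Longrightarrow> integral {x..y} f = 0"
  shows "negligible {x \<in> {c<..<d}. f x \<noteq> 0}"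
proof -
  define F where "F x = (if x \<in> {c..d} then f x else 0)" for x
  have "F integrable_on cbox a b" for a b
  proof (rule integrable_on_subcbox)
    show "F integrable_on UNIV"
      using int unfolding F_def by (simp only: integrable_restrict_UNIV)
  qed simp
  then obtain N where N: "negligible N"
    "\<And>x e. \<lbrakk>x \<notin> N; 0 < e\<rbrakk> \<Longrightarrow> \<exists>r>0. \<forall>h. 0 < h \<and> h < r \<longrightarrow>
       norm (integral (cbox x (x + h *\<^sub>R One)) F /\<^sub>R h ^ DIM(real) - F x) < e"
    using integrable_ccontinuous_explicit[of F] by metis
  have "f x = 0" if xc: "x \<in> {c<..<d}" and xN: "x \<notin> N" for x
  proof (rule ccontr)
    assume "f x \<noteq> 0"
    then obtain r where r: "r > 0" "\<And>h. 0 < h \<Longrightarrow> h < r \<Longrightarrow> \<bar>integral {x..x + h} F / h - F x\<bar> < \<bar>f x\<bar>"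
      using N(2)[OF xN, of "\<bar>f x\<bar>"] by (auto simp: divide_inverse mult.commute)
    define h where "h = min (r / 2) (d - x)"
    have h: "0 < h" "h < r" "x + h \<le> d" using r xc by (auto simp: h_def)
    have "integral {x..x + h} F = integral {x..x + h} f"
      by (rule integral_cong) (use xc h in \<open>auto simp: F_def\<close>)
    also have "\<dots> = 0" using zero[of x "x + h"] xc h by auto
    finally show False using r(2)[OF h(1,2)] xc by (simp add: F_def)
  qed
  then show ?thesis by (intro negligible_subset[OF N(1)]) auto
qed

text \<open>Plateau functions converge boundedly to the indicators of intervals, so the integrals of \<open>h\<close> over
  all compact subintervals vanish as well.\<close>

lemma AE_zero_if_test_integrals_zero:
  fixes h :: "real \<Rightarrow> real"
  assumes h: "h \<in> L1_loc {a<..<b}"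
    and zero: "\<And>\<phi>. test_function {a<..<b} \<phi> \<Longrightarrow> (LINT x|lebesgue_on {a<..<b}. h x * \<phi> x) = 0"
  shows "AE x in lebesgue_on {a<..<b}. h x = 0"
proof -
  let ?S = "{a<..<b}"
  have intz: "integral {c..d} h = 0" if "a < c" and cd: "c \<le> d" and "d < b" for c d
  proof -
    define e where "e = (b - d) / 2"
    have e: "0 < e" "d + e < b" using that by (auto simp: e_def field_simps)
    obtain N0 :: nat where "inverse (real (Suc N0)) < e"
      using reals_Archimedean[OF e(1)] by blast
    then obtain N :: nat where N: "0 < N" "1 / real N < e"
      by (intro that[of "Suc N0"]) (simp_all add: inverse_eq_divide)
    have sub: "{c..d + 1 / real n} \<subseteq> {c..d + e}" if "n \<ge> N" for n
    proof -
      have "1 / real n \<le> 1 / real N" using that N by (intro divide_left_mono) auto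
      then show ?thesis using N by auto
    qed
    have int_ce: "integrable (lebesgue_on {c..d + e}) h"
      using that e by (intro L1_locD[OF h]) auto
    have "integrable (lebesgue_on {c..d + e}) (\<lambda>x. if x \<in> {c..d + e} then \<bar>h x\<bar> else 0)
        \<longleftrightarrow> integrable (lebesgue_on {c..d + e}) (\<lambda>x. \<bar>h x\<bar>)"
      by (rule Bochner_Integration.integrable_cong) simp_all
    with integrable_abs[OF int_ce] have "integrable (lebesgue_on {c..d + e}) (\<lambda>x. if x \<in> {c..d + e} then \<bar>h x\<bar> else 0)"
      by blast
    moreover have "{c..d + e} \<subseteq> ?S" using that(1) e by (simp add: subset_iff)
    ultimately have dom: "integrable (lebesgue_on ?S) (\<lambda>x. if x \<in> {c..d + e} then \<bar>h x\<bar> else 0)"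
      by (rule integrable_on_subset_zero_outside) auto
    have hm: "h \<in> borel_measurable (lebesgue_on ?S)" using h by (simp add: L1_loc_def)
    have AE_neq: "AE x in lebesgue_on ?S. x \<noteq> c"
      by (subst AE_lebesgue_on_iff_negligible) (auto intro: negligible_subset[of "{c}"])
    have lim: "(\<lambda>n. LINT x|lebesgue_on ?S. h x * plateau (n + N) c d x)
        \<longlonglongrightarrow> (LINT x|lebesgue_on ?S. h x * indicat_real {c..d} x)"
    proof (rule integral_dominated_convergence[OF _ _ dom])
      show "(\<lambda>x. h x * indicat_real {c..d} x) \<in> borel_measurable (lebesgue_on ?S)"
        by (intro borel_measurable_times hm borel_measurable_lebesgue_on_borel) simp
      show "(\<lambda>x. h x * plateau (n + N) c d x) \<in> borel_measurable (lebesgue_on ?S)" for n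
        unfolding plateau_def
        by (intro borel_measurable_times hm borel_measurable_diff borel_measurable_lebesgue_on_continuous
            Ck_continuous[OF Ck_smooth_step_affine])
      show "AE x in lebesgue_on ?S. (\<lambda>n. h x * plateau (n + N) c d x) \<longlonglongrightarrow> h x * indicat_real {c..d} x"
        using AE_neq
      proof eventually_elim
        case (elim x)
        then have "indicat_real {c..d} x = indicat_real {c<..d} x" by (auto simp: indicator_def)
        then show ?case
          by (simp only:) (intro tendsto_mult tendsto_const LIMSEQ_ignore_initial_segment plateau_tendsto cd)
      qed
      show "AE x in lebesgue_on ?S. norm (h x * plateau (n + N) c d x) \<le> (if x \<in> {c..d + e} then \<bar>h x\<bar> else 0)" for n
      proof (rule AE_I2)
        fix x
        have "test_function {c..d + e} (plateau (n + N) c d)"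
          by (rule test_function_plateau[OF sub[OF le_add2] cd]) (use N in simp)
        then have "plateau (n + N) c d x = 0" if "x \<notin> {c..d + e}"
          using test_function_0 that by blast
        then show "norm (h x * plateau (n + N) c d x) \<le> (if x \<in> {c..d + e} then \<bar>h x\<bar> else 0)"
          using plateau_bounds[OF cd, of "n + N" x]
          by (cases "x \<in> {c..d + e}") (simp_all add: abs_mult mult_left_le)
      qed
    qed
    have "(LINT x|lebesgue_on ?S. h x * plateau (n + N) c d x) = 0" for n
    proof (rule zero[OF test_function_plateau])
      show "{c..d + 1 / real (n + N)} \<subseteq> ?S"
        by (rule order_trans[OF sub[OF le_add2] \<open>{c..d + e} \<subseteq> ?S\<close>])
    qed (use cd N in simp_all)
    with lim have "(LINT x|lebesgue_on ?S. h x * indicat_real {c..d} x) = 0"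
      by (simp add: LIMSEQ_const_iff)
    also have "(LINT x|lebesgue_on ?S. h x * indicat_real {c..d} x)
        = (LINT x|lebesgue_on ?S. (if x \<in> {c..d} then h x else 0))"
      by (intro Bochner_Integration.integral_cong) (auto simp: indicator_def)
    also have "\<dots> = (LINT x|lebesgue_on {c..d}. h x)"
      using \<open>{c..d + e} \<subseteq> ?S\<close> e by (intro Lebesgue_Measure.integral_restrict) auto
    also have "\<dots> = integral {c..d} h"
      using \<open>{c..d + e} \<subseteq> ?S\<close> e by (intro lebesgue_integral_eq_integral L1_locD[OF h]) auto
    finally show ?thesis by simp
  qed
  define c d where "c n = a + 1 / real (Suc n)" and "d n = b - 1 / real (Suc n)" for n
  have "negligible {x \<in> {c n<..<d n}. h x \<noteq> 0}" for n
  proof (rule AE_zero_if_interval_integrals_zero)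
    have "0 < 1 / real (Suc n)" by simp
    then have "a < c n" "d n < b" unfolding c_def d_def by linarith+
    then have "{c n..d n} \<subseteq> {a<..<b}" by auto
    then show "h integrable_on {c n..d n}"
      by (intro integrable_on_lebesgue_on L1_locD[OF h]) auto
    show "integral {x..y} h = 0" if "c n \<le> x" "x \<le> y" "y \<le> d n" for x y
    proof (rule intz[OF _ that(2)])
      have "0 < 1 / real (Suc n)" by simp
      then show "a < x" "y < b" using that unfolding c_def d_def by linarith+
    qed
  qed
  then have "negligible (\<Union>n. {x \<in> {c n<..<d n}. h x \<noteq> 0})"
    by (auto simp: negligible_iff_null_sets)
  moreover have "{x \<in> ?S. h x \<noteq> 0} \<subseteq> (\<Union>n. {x \<in> {c n<..<d n}. h x \<noteq> 0})"
  proof clarsimp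
    fix x assume x: "a < x" "x < b" "h x \<noteq> 0"
    obtain n where "inverse (real (Suc n)) < min (x - a) (b - x)"
      using reals_Archimedean[of "min (x - a) (b - x)"] x by auto
    then show "\<exists>n. c n < x \<and> x < d n" unfolding c_def d_def
      by (intro exI[of _ n]) (auto simp: inverse_eq_divide)
  qed
  ultimately show ?thesis
    by (auto simp: AE_lebesgue_on_iff_negligible intro: negligible_subset)
qed

lemma has_weak_derivative_unique:
  assumes "has_weak_derivative {a<..<b} g h" "has_weak_derivative {a<..<b} g h'"
  shows "AE x in lebesgue_on {a<..<b}. h x = h' x"
proof -
  let ?S = "{a<..<b}"
  have h: "h \<in> L1_loc ?S" "h' \<in> L1_loc ?S"
    using assms by (auto simp: has_weak_derivative_def)
  have "AE x in lebesgue_on ?S. h x - h' x = 0"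
  proof (rule AE_zero_if_test_integrals_zero[OF L1_loc_diff[OF h]])
    fix \<phi> :: "real \<Rightarrow> real" assume \<phi>: "test_function ?S \<phi>"
    have int: "integrable (lebesgue_on ?S) (\<lambda>x. h x * \<phi> x)" "integrable (lebesgue_on ?S) (\<lambda>x. h' x * \<phi> x)"
      by (intro integrable_L1_loc_mult_test_function h \<phi>; simp)+
    have "(LINT x|lebesgue_on ?S. h x * \<phi> x) = (LINT x|lebesgue_on ?S. h' x * \<phi> x)"
      using assms(1)[unfolded has_weak_derivative_def, THEN conjunct2, THEN conjunct2, rule_format, OF \<phi>]
        assms(2)[unfolded has_weak_derivative_def, THEN conjunct2, THEN conjunct2, rule_format, OF \<phi>] by linarith
    then show "(LINT x|lebesgue_on ?S. (h x - h' x) * \<phi> x) = 0"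
      using int by (simp add: left_diff_distrib)
  qed
  then show ?thesis by eventually_elim simp
qed

lemma has_weak_derivative_diff:
  assumes "has_weak_derivative S g h" "has_weak_derivative S g' h'" "S \<in> sets lebesgue"
  shows "has_weak_derivative S (\<lambda>x. g x - g' x) (\<lambda>x. h x - h' x)"
proof -
  have L: "g \<in> L1_loc S" "g' \<in> L1_loc S" "h \<in> L1_loc S" "h' \<in> L1_loc S"
    using assms by (auto simp: has_weak_derivative_def)
  have "(LINT x|lebesgue_on S. (g x - g' x) * deriv \<phi> x) = - (LINT x|lebesgue_on S. (h x - h' x) * \<phi> x)"
    if \<phi>: "test_function S \<phi>" for \<phi>
  proof -
    have "integrable (lebesgue_on S) (\<lambda>x. k x * \<phi> x)" "integrable (lebesgue_on S) (\<lambda>x. k x * deriv \<phi> x)"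
      if "k \<in> L1_loc S" for k
      by (intro integrable_L1_loc_mult_test_function that test_function_deriv \<phi> assms(3))+
    with L assms \<phi> show ?thesis by (simp add: left_diff_distrib has_weak_derivative_def)
  qed
  with L show ?thesis by (auto simp: has_weak_derivative_def L1_loc_diff)
qed

lemma has_weak_derivativeD: "has_weak_derivative S g h \<Longrightarrow> h \<in> borel_measurable (lebesgue_on S)"
  by (simp add: has_weak_derivative_def L1_loc_def)

lemma has_weak_derivative_weak_derivative:
  "has_weak_derivative S g h \<Longrightarrow> has_weak_derivative S g (weak_derivative S g)"
  unfolding weak_derivative_def by (rule someI[where P="has_weak_derivative S g"])

lemma weak_derivative_AE_eq:
  "has_weak_derivative {a<..<b} g h \<Longrightarrow> AE x in lebesgue_on {a<..<b}. weak_derivative {a<..<b} g x = h x"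
  using has_weak_derivative_unique has_weak_derivative_weak_derivative by blast

lemma W1p_weak_derivative:
  assumes "g \<in> W1p p {a<..<b}"
  shows "has_weak_derivative {a<..<b} g (weak_derivative {a<..<b} g)"
    and "weak_derivative {a<..<b} g \<in> Lp_space p {a<..<b}"
    and "g \<in> Lp_space p {a<..<b}"
proof -
  obtain h where h: "h \<in> Lp_space p {a<..<b}" "has_weak_derivative {a<..<b} g h"
    using assms by (auto simp: W1p_def)
  show w: "has_weak_derivative {a<..<b} g (weak_derivative {a<..<b} g)"
    using has_weak_derivative_weak_derivative[OF h(2)] .
  show "weak_derivative {a<..<b} g \<in> Lp_space p {a<..<b}"
    using weak_derivative_AE_eq[OF h(2)]
    by (intro Lp_space_AE_cong[OF h(1) has_weak_derivativeD[OF w]]) (auto elim: eventually_mono)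
  show "g \<in> Lp_space p {a<..<b}" using assms by (simp add: W1p_def)
qed

lemma weak_derivative_diff:
  assumes "g \<in> W1p p {a<..<b}" "h \<in> W1p p {a<..<b}"
  shows "AE x in lebesgue_on {a<..<b}. weak_derivative {a<..<b} (\<lambda>x. g x - h x) x
      = weak_derivative {a<..<b} g x - weak_derivative {a<..<b} h x"
  by (intro weak_derivative_AE_eq has_weak_derivative_diff W1p_weak_derivative[OF assms(1)]
      W1p_weak_derivative[OF assms(2)]) simp

lemma test_function_primitive:
  assumes \<psi>: "test_function {a<..<b} \<psi>"
  shows "x \<in> {a..b} \<Longrightarrow> (deriv \<psi> has_integral \<psi> x) {a..x}"
    and "(LINT x|lebesgue_on {a<..<b}. deriv \<psi> x) = 0"
    and "integrable (lebesgue_on {a<..<b}) (deriv \<psi>)"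
proof -
  have \<psi>0: "\<psi> a = 0" "\<psi> b = 0" using test_function_0[OF \<psi>] by auto
  show 1: "(deriv \<psi> has_integral \<psi> x) {a..x}" if "x \<in> {a..b}" for x
    using fundamental_theorem_of_calculus[of a x \<psi> "deriv \<psi>"] that \<psi>0 test_function_DERIV[OF \<psi>]
    by (auto simp: has_real_derivative_iff_has_vector_derivative intro: has_vector_derivative_at_within)
  show int: "integrable (lebesgue_on {a<..<b}) (deriv \<psi>)"
    by (rule test_function_integrable[OF test_function_deriv[OF \<psi>]]) simp
  show "(LINT x|lebesgue_on {a<..<b}. deriv \<psi> x) = 0"
  proof (cases "a \<le> b")
    case True
    have "(LINT x|lebesgue_on {a<..<b}. deriv \<psi> x) = integral {a<..<b} (deriv \<psi>)"
      by (rule lebesgue_integral_eq_integral[OF int]) simp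
    also have "\<dots> = integral {a..b} (deriv \<psi>)" by (simp add: integral_open_interval_real)
    also have "\<dots> = 0" using 1[of b] True \<psi>0 by (simp add: integral_unique)
    finally show ?thesis .
  qed simp
qed

lemma test_function_has_weak_derivative:
  assumes \<phi>: "test_function {a<..<b} \<phi>"
  shows "has_weak_derivative {a<..<b} \<phi> (deriv \<phi>)"
proof -
  have L: "\<psi> \<in> L1_loc {a<..<b}" if "test_function {a<..<b} \<psi>" for \<psi>
    unfolding L1_loc_def
    using test_function_integrable[OF that lmeasurable_compact]
      borel_measurable_lebesgue_on_continuous[OF test_function_continuous[OF that]] by simp
  have "(LINT x|lebesgue_on {a<..<b}. \<phi> x * deriv \<psi> x) = - (LINT x|lebesgue_on {a<..<b}. deriv \<phi> x * \<psi> x)"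
    if \<psi>: "test_function {a<..<b} \<psi>" for \<psi>
  proof -
    have *: "test_function {a<..<b} (\<lambda>x. \<phi> x * \<psi> x)"
      by (rule test_function_mult[OF \<phi> test_function_Ck[OF \<psi>]])
    have D: "deriv (\<lambda>x. \<phi> x * \<psi> x) x = deriv \<phi> x * \<psi> x + \<phi> x * deriv \<psi> x" for x
      by (rule DERIV_imp_deriv) (use DERIV_mult[OF test_function_DERIV[OF \<phi>] test_function_DERIV[OF \<psi>]]
        in \<open>simp add: algebra_simps\<close>)
    have "integrable (lebesgue_on {a<..<b}) (\<lambda>x. deriv \<phi> x * \<psi> x)"
      "integrable (lebesgue_on {a<..<b}) (\<lambda>x. \<phi> x * deriv \<psi> x)"
      by (intro integrable_L1_loc_mult_test_function L test_function_deriv \<phi> \<psi>; simp)+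
    with test_function_primitive(2)[OF *] show ?thesis
      by (simp add: D)
  qed
  then show ?thesis unfolding has_weak_derivative_def using L[OF \<phi>] L[OF test_function_deriv[OF \<phi>]] by blast
qed

section \<open>Sobolev functions with zero boundary values\<close>

text \<open>A test function vanishes at the left end point, so that its values are integrals of its
  derivative.\<close>

lemma test_function_sup_le:
  assumes \<psi>: "test_function {-l<..<l} \<psi>" and "0 < \<rho>" "1 \<le> p" "0 < l"
  shows "\<bar>\<psi> x\<bar> \<le> 2 * l * \<rho> + \<rho> powr (1 - p) * (LINT y|lebesgue_on {-l<..<l}. \<bar>deriv \<psi> y\<bar> powr p)"
    (is "_ \<le> _ + _ * ?q")
proof (cases "x \<in> {-l<..<l}")
  case False
  have "0 \<le> ?q" by (intro Bochner_Integration.integral_nonneg) simp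
  then show ?thesis using test_function_0[OF \<psi> False] assms by (simp add: zero_le_mult_iff)
next
  case True
  let ?I = "{-l<..<l}"
  have int: "integrable (lebesgue_on ?I) (deriv \<psi>)" by (rule test_function_primitive(3)[OF \<psi>])
  have intp: "integrable (lebesgue_on ?I) (\<lambda>y. \<bar>deriv \<psi> y\<bar> powr p)"
    using test_function_Lp_space[OF test_function_deriv[OF \<psi>], of p] assms by (auto simp: Lp_space_def)
  have abs_int: "(\<lambda>y. \<bar>deriv \<psi> y\<bar>) integrable_on ?I"
    by (rule integrable_on_lebesgue_on[OF integrable_abs[OF int]]) simp
  have der: "(deriv \<psi> has_integral \<psi> x) {-l..x}"
    by (rule test_function_primitive(1)[OF \<psi>]) (use True in auto)
  then have der': "(deriv \<psi> has_integral \<psi> x) {-l<..<x}"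
    using has_integral_Icc_iff_Ioo by blast
  have sub: "(\<lambda>y. \<bar>deriv \<psi> y\<bar>) integrable_on {-l<..<x}"
    by (intro integrable_on_lebesgue_on integrable_abs test_function_integrable[OF test_function_deriv[OF \<psi>]]) auto
  have "\<bar>\<psi> x\<bar> = norm (integral {-l<..<x} (deriv \<psi>))" using integral_unique[OF der'] by simp
  also have "\<dots> \<le> integral {-l<..<x} (\<lambda>y. \<bar>deriv \<psi> y\<bar>)"
    by (rule integral_norm_bound_integral[OF has_integral_integrable[OF der'] sub]) simp
  also have "\<dots> \<le> integral ?I (\<lambda>y. \<bar>deriv \<psi> y\<bar>)"
    by (rule integral_subset_le[OF _ sub abs_int]) (use True in auto)
  also have "\<dots> = (LINT y|lebesgue_on ?I. \<bar>deriv \<psi> y\<bar>)"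
    by (rule lebesgue_integral_eq_integral[symmetric, OF integrable_abs[OF int]]) simp
  also have "\<dots> \<le> (LINT y|lebesgue_on ?I. \<rho> + \<rho> powr (1 - p) * \<bar>deriv \<psi> y\<bar> powr p)"
    using finite_measure.integrable_const[OF finite_measure_lebesgue_on, of ?I] intp
    by (intro Bochner_Integration.integral_mono integrable_abs int abs_le_powr_split assms
        Bochner_Integration.integrable_add integrable_mult_right) auto
  also have "\<dots> = 2 * l * \<rho> + \<rho> powr (1 - p) * ?q"
    using finite_measure.integrable_const[OF finite_measure_lebesgue_on, of ?I] intp assms
    by (subst Bochner_Integration.integral_add) (auto simp: measure_restrict_space)
  finally show ?thesis .
qed

text \<open>Test functions that converge in the Sobolev norm converge uniformly, because the integral of the
  derivative controls the supremum; the uniform limit agrees almost everywhere with \<open>g\<close>.\<close>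

lemma W1p_0_approximation:
  assumes g: "g \<in> W1p_0 p {-l<..<l}" and p: "1 < p" and l: "0 < l"
  shows "\<exists>\<phi>. (\<forall>n::nat. test_function {-l<..<l} (\<phi> n)) \<and>
    (\<lambda>n. LINT x|lebesgue_on {-l<..<l}. \<bar>deriv (\<phi> n) x - weak_derivative {-l<..<l} g x\<bar> powr p) \<longlonglongrightarrow> 0 \<and>
    (\<forall>e>0. \<forall>\<^sub>F n in sequentially. AE x in lebesgue_on {-l<..<l}. \<bar>\<phi> n x - g x\<bar> \<le> e)"
proof -
  let ?I = "{-l<..<l}" and ?wd = "weak_derivative {-l<..<l}"
  have gW: "g \<in> W1p p ?I" using g by (simp add: W1p_0_def)
  obtain \<phi> where \<phi>: "\<And>n::nat. test_function ?I (\<phi> n)"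
    and N0: "(\<lambda>n. W1p_norm p ?I (\<lambda>x. \<phi> n x - g x)) \<longlonglongrightarrow> 0"
    using g by (auto simp: W1p_0_def)
  note \<phi>' = test_function_deriv[OF \<phi>]
  define A where "A n = (LINT x|lebesgue_on ?I. \<bar>\<phi> n x - g x\<bar> powr p)" for n
  define B where "B n = (LINT x|lebesgue_on ?I. \<bar>deriv (\<phi> n) x - ?wd g x\<bar> powr p)" for n
  have "?wd g \<in> Lp_space p ?I" "g \<in> Lp_space p ?I" using W1p_weak_derivative[OF gW] by auto
  note gLp = this
  have \<phi>Lp: "\<phi> n \<in> Lp_space p ?I" "deriv (\<phi> n) \<in> Lp_space p ?I" for n
    using p by (intro test_function_Lp_space[OF \<phi>] test_function_Lp_space[OF \<phi>']; simp)+
  have wd: "AE x in lebesgue_on ?I. ?wd (\<lambda>x. \<phi> n x - g x) x = deriv (\<phi> n) x - ?wd g x" for n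
    by (intro weak_derivative_AE_eq has_weak_derivative_diff test_function_has_weak_derivative \<phi>
        W1p_weak_derivative[OF gW]) simp
  have "(LINT x|lebesgue_on ?I. \<bar>?wd (\<lambda>x. \<phi> n x - g x) x\<bar> powr p) = B n" for n
  proof -
    have m: "?wd (\<lambda>x. \<phi> n x - g x) \<in> borel_measurable (lebesgue_on ?I)"
      "(\<lambda>x. deriv (\<phi> n) x - ?wd g x) \<in> borel_measurable (lebesgue_on ?I)"
      using has_weak_derivativeD[OF has_weak_derivative_weak_derivative[OF has_weak_derivative_diff[OF
          test_function_has_weak_derivative[OF \<phi>] W1p_weak_derivative(1)[OF gW]]]]
        Lp_space_diff[OF \<phi>Lp(2) gLp(1)] p by (auto simp: Lp_space_def)
    show ?thesis unfolding B_def
      by (intro integral_cong_AE borel_measurable_abs_powr m) (use wd[of n] in \<open>eventually_elim, simp\<close>)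
  qed
  then have N: "W1p_norm p ?I (\<lambda>x. \<phi> n x - g x) = (A n + B n) powr (1 / p)" for n
    by (simp add: W1p_norm_def A_def)
  have nn: "0 \<le> A n" "0 \<le> B n" for n
    unfolding A_def B_def by (simp_all add: Bochner_Integration.integral_nonneg)
  have "(\<lambda>n. ((A n + B n) powr (1 / p)) powr p) \<longlonglongrightarrow> 0 powr p"
    using N0 p unfolding N by (intro tendsto_powr2 tendsto_const) (auto simp: eventually_sequentially)
  then have AB: "(\<lambda>n. A n + B n) \<longlonglongrightarrow> 0" using nn p by (simp add: powr_powr)
  have A0: "A \<longlonglongrightarrow> 0"
    by (rule tendsto_sandwich[OF _ _ tendsto_const AB]) (use nn in auto)
  have B0: "B \<longlonglongrightarrow> 0"
    by (rule tendsto_sandwich[OF _ _ tendsto_const AB]) (use nn in auto)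
  have int: "integrable (lebesgue_on ?I) (\<lambda>x. \<bar>\<phi> n x - g x\<bar> powr p)" for n
    using Lp_space_diff[OF \<phi>Lp(1) gLp(2), of n] p by (simp add: Lp_space_def)
  have "(\<lambda>n. LINT x|lebesgue_on ?I. norm (\<bar>\<phi> n x - g x\<bar> powr p)) \<longlonglongrightarrow> 0"
    using A0 unfolding A_def by simp
  from tendsto_L1_AE_subseq[OF int this] obtain r :: "nat \<Rightarrow> nat" where r: "strict_mono r"
    and lim: "AE x in lebesgue_on ?I. (\<lambda>n. \<bar>\<phi> (r n) x - g x\<bar> powr p) \<longlonglongrightarrow> 0"
    by blast
  have cauchy: "\<bar>\<phi> n x - \<phi> m x\<bar> \<le> 2 * l * \<rho> + \<rho> powr (1 - p) * (2 powr p * (B n + B m))"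
    if "0 < \<rho>" for n m x \<rho>
  proof -
    have "deriv (\<lambda>x. \<phi> n x - \<phi> m x) x = deriv (\<phi> n) x - deriv (\<phi> m) x" for x
      by (rule DERIV_imp_deriv) (intro DERIV_diff test_function_DERIV[OF \<phi>])
    then have "\<bar>\<phi> n x - \<phi> m x\<bar> \<le> 2 * l * \<rho> + \<rho> powr (1 - p) *
        (LINT y|lebesgue_on ?I. \<bar>deriv (\<phi> n) y - deriv (\<phi> m) y\<bar> powr p)"
      using test_function_sup_le[OF test_function_diff[OF \<phi>[of n] \<phi>[of m]], where \<rho>=\<rho> and p=p and x=x] that p l by simp
    also have "\<dots> \<le> 2 * l * \<rho> + \<rho> powr (1 - p) * (2 powr p * (B n + B m))"
      unfolding B_def
      using p by (intro add_left_mono mult_left_mono Lp_diff_integral_le \<phi>Lp gLp) auto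
    finally show ?thesis .
  qed
  have unif: "\<forall>\<^sub>F n in sequentially. AE x in lebesgue_on ?I. \<bar>\<phi> n x - g x\<bar> \<le> e" if "0 < e" for e
  proof -
    \<comment> \<open>Both terms of \<open>cauchy\<close> are to be at most \<open>e / 2\<close>.\<close>
    define \<rho> where "\<rho> = e / (4 * l)"
    define \<eta> where "\<eta> = e / (4 * \<rho> powr (1 - p) * 2 powr p)"
    have pos: "0 < \<rho>" "0 < \<eta>" using that l by (auto simp: \<rho>_def \<eta>_def)
    have small: "\<forall>\<^sub>F n in sequentially. B n < \<eta>" using order_tendstoD(2)[OF B0 pos(2)] .
    then obtain M where M: "\<And>n. n \<ge> M \<Longrightarrow> B n < \<eta>" by (auto simp: eventually_sequentially)
    have c: "\<bar>\<phi> n x - \<phi> m x\<bar> \<le> e" if nm: "n \<ge> M" "m \<ge> M" for n m x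
    proof -
      have "\<rho> powr (1 - p) * (2 powr p * (B n + B m)) \<le> \<rho> powr (1 - p) * (2 powr p * (\<eta> + \<eta>))"
        using M[OF nm(1)] M[OF nm(2)] by (intro mult_left_mono add_mono) auto
      also have "\<dots> = e / 2" using pos by (simp add: \<eta>_def field_simps)
      finally show ?thesis using cauchy[OF pos(1), of n x m] l by (simp add: \<rho>_def field_simps)
    qed
    have "AE x in lebesgue_on ?I. \<bar>\<phi> n x - g x\<bar> \<le> e" if n: "n \<ge> M" for n
      using lim
    proof eventually_elim
      case (elim x)
      then have "(\<lambda>k. (\<bar>\<phi> (r k) x - g x\<bar> powr p) powr (1 / p)) \<longlonglongrightarrow> 0 powr (1 / p)"
        using p by (intro tendsto_powr2 tendsto_const) auto
      then have "(\<lambda>k. \<phi> (r k) x - g x) \<longlonglongrightarrow> 0"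
        using p by (simp add: powr_powr tendsto_rabs_zero_iff)
      then have "(\<lambda>k. \<phi> (r k) x) \<longlonglongrightarrow> g x" by (simp add: LIM_zero_iff)
      then have "(\<lambda>k. \<bar>\<phi> n x - \<phi> (r k) x\<bar>) \<longlonglongrightarrow> \<bar>\<phi> n x - g x\<bar>"
        by (intro tendsto_intros)
      moreover have "\<forall>\<^sub>F k in sequentially. \<bar>\<phi> n x - \<phi> (r k) x\<bar> \<le> e"
        using eventually_ge_at_top[of M]
      proof eventually_elim
        case (elim k)
        then have "r k \<ge> M" using seq_suble[OF r, of k] by simp
        then show ?case by (rule c[OF n])
      qed
      ultimately show ?case by (rule tendsto_upperbound) simp
    qed
    then show ?thesis by (auto simp: eventually_sequentially)
  qed
  show ?thesis
  proof (intro exI[of _ \<phi>] conjI allI impI)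
    show "test_function ?I (\<phi> n)" for n by (rule \<phi>)
    show "(\<lambda>n. LINT x|lebesgue_on ?I. \<bar>deriv (\<phi> n) x - ?wd g x\<bar> powr p) \<longlonglongrightarrow> 0"
      using B0 unfolding B_def[abs_def] .
    show "\<forall>\<^sub>F n in sequentially. AE x in lebesgue_on ?I. \<bar>\<phi> n x - g x\<bar> \<le> e" if "0 < e" for e
      by (rule unif[OF that])
  qed
qed

lemma W1p_0_sup_le:
  assumes g: "g \<in> W1p_0 p {-l<..<l}" and p: "1 < p" and l: "0 < l" and \<rho>: "0 < \<rho>"
  shows "AE x in lebesgue_on {-l<..<l}. \<bar>g x\<bar> \<le> (2 * l + 2) * \<rho> +
    \<rho> powr (1 - p) * 2 powr p * (LINT y|lebesgue_on {-l<..<l}. \<bar>weak_derivative {-l<..<l} g y\<bar> powr p)"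
proof -
  let ?I = "{-l<..<l}" and ?w = "weak_derivative {-l<..<l} g"
  obtain \<phi> where \<phi>: "\<And>n::nat. test_function ?I (\<phi> n)"
    and B0: "(\<lambda>n. LINT x|lebesgue_on ?I. \<bar>deriv (\<phi> n) x - ?w x\<bar> powr p) \<longlonglongrightarrow> 0"
    and unif: "\<And>e. 0 < e \<Longrightarrow> \<forall>\<^sub>F n in sequentially. AE x in lebesgue_on ?I. \<bar>\<phi> n x - g x\<bar> \<le> e"
    using W1p_0_approximation[OF g p l] by blast
  have gLp: "?w \<in> Lp_space p ?I" using W1p_weak_derivative(2) g by (simp add: W1p_0_def)
  \<comment> \<open>The approximation of the gradient may contribute at most \<open>\<rho>\<close>, as may the uniform one.\<close>
  have "0 < \<rho> / (\<rho> powr (1 - p) * 2 powr p)" using \<rho> by simp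
  from eventually_conj[OF order_tendstoD(2)[OF B0 this] unif[OF \<rho>]]
  obtain n where n: "(LINT x|lebesgue_on ?I. \<bar>deriv (\<phi> n) x - ?w x\<bar> powr p) < \<rho> / (\<rho> powr (1 - p) * 2 powr p)"
    "AE x in lebesgue_on ?I. \<bar>\<phi> n x - g x\<bar> \<le> \<rho>"
    by (auto simp: eventually_sequentially)
  let ?B = "LINT x|lebesgue_on ?I. \<bar>deriv (\<phi> n) x - ?w x\<bar> powr p"
  let ?q = "LINT x|lebesgue_on ?I. \<bar>?w x\<bar> powr p"
  have "(LINT x|lebesgue_on ?I. \<bar>deriv (\<phi> n) x - 0\<bar> powr p) \<le> 2 powr p * (?B + (LINT x|lebesgue_on ?I. \<bar>0 - ?w x\<bar> powr p))"
    using p by (intro Lp_diff_integral_le test_function_Lp_space[OF test_function_deriv[OF \<phi>]] gLp Lp_zero) auto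
  then have le: "(LINT x|lebesgue_on ?I. \<bar>deriv (\<phi> n) x\<bar> powr p) \<le> 2 powr p * (?B + ?q)" by simp
  have "\<bar>\<phi> n x\<bar> \<le> 2 * l * \<rho> + \<rho> + \<rho> powr (1 - p) * 2 powr p * ?q" for x
  proof -
    have "\<bar>\<phi> n x\<bar> \<le> 2 * l * \<rho> + \<rho> powr (1 - p) * (2 powr p * (?B + ?q))"
      by (rule order_trans[OF test_function_sup_le[OF \<phi> \<rho>] add_left_mono[OF mult_left_mono[OF le]]])
        (use p l in auto)
    moreover have "\<rho> powr (1 - p) * 2 powr p * ?B \<le> \<rho>"
      using n(1) \<rho> by (simp add: pos_less_divide_eq mult.commute)
    ultimately show ?thesis by (simp add: algebra_simps)
  qed
  note bound = this
  show ?thesis using n(2)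
  proof eventually_elim
    case (elim x)
    then show ?case using bound[of x] by (simp add: algebra_simps)
  qed
qed

section \<open>Continuity in time up to small sets\<close>

text \<open>The distance from \<open>c\<close> is continuous in the mean of order \<open>p\<close>, so it is a limit of the corresponding
  real-valued simple functions.\<close>

lemma borel_measurable_Lp_distance:
  assumes simple: "\<And>n::nat. simple_function (lebesgue_on T) (\<sigma> n)"
    and \<sigma>: "\<And>n t. t \<in> T \<Longrightarrow> \<sigma> n t \<in> Lp_space p S"
    and w: "AE t in lebesgue_on T. w t \<in> Lp_space p S"
    and lim: "AE t in lebesgue_on T. (\<lambda>n. LINT x|lebesgue_on S. \<bar>\<sigma> n t x - w t x\<bar> powr p) \<longlonglongrightarrow> 0"
    and c: "c \<in> Lp_space p S" and p: "0 < p" and T: "T \<in> sets lebesgue"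
  shows "(\<lambda>t. LINT x|lebesgue_on S. \<bar>w t x - c x\<bar> powr p) \<in> borel_measurable (lebesgue_on T)"
proof (rule borel_measurable_lebesgue_on_AE_LIMSEQ[OF _ _ T])
  show "(\<lambda>t. LINT x|lebesgue_on S. \<bar>\<sigma> n t x - c x\<bar> powr p) \<in> borel_measurable (lebesgue_on T)" for n
    using simple_function_compose[OF simple, of "\<lambda>g. LINT x|lebesgue_on S. \<bar>g x - c x\<bar> powr p" n]
    by (intro borel_measurable_simple_function) (simp add: o_def)
  show "AE t in lebesgue_on T. (\<lambda>n. LINT x|lebesgue_on S. \<bar>\<sigma> n t x - c x\<bar> powr p)
      \<longlonglongrightarrow> (LINT x|lebesgue_on S. \<bar>w t x - c x\<bar> powr p)"
    using w lim AE_space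
  proof eventually_elim
    case (elim t)
    have "\<sigma> n t \<in> Lp_space p S" for n using elim(3) by (intro \<sigma>) simp
    then show ?case
      using Lp_integral_tendsto[of "\<lambda>n x. \<sigma> n t x - c x" p S "\<lambda>x. w t x - c x"] elim(1,2) c p
      by (simp add: Lp_space_diff)
  qed
qed

text \<open>Squeeze \<open>E\<close> between a compact set and an open set whose difference \<open>D\<close> has small measure. The compact
  set has positive distance from the complement of the open set, so a short step out of \<open>E\<close> starts or
  ends in \<open>D\<close>.\<close>

lemma measurable_set_modulus:
  fixes E :: "real set"
  assumes E: "E \<in> sets lebesgue" "bounded E" and \<epsilon>: "0 < \<epsilon>"
  shows "\<exists>D \<delta>. D \<in> lmeasurable \<and> measure lebesgue D \<le> \<epsilon> \<and> 0 < \<delta> \<and>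
    (\<forall>b\<in>E. \<forall>r. r \<notin> E \<longrightarrow> \<bar>r - b\<bar> < \<delta> \<longrightarrow> b \<in> D \<or> r \<in> D)"
proof -
  obtain U where U: "open U" "E \<subseteq> U" "U - E \<in> lmeasurable" "emeasure lebesgue (U - E) < ennreal (\<epsilon> / 2)"
    using sets_lebesgue_outer_open[OF E(1), of "\<epsilon> / 2"] \<epsilon> by (metis half_gt_zero)
  obtain K where K: "closed K" "K \<subseteq> E" "E - K \<in> lmeasurable" "emeasure lebesgue (E - K) < ennreal (\<epsilon> / 2)"
    using sets_lebesgue_inner_closed[OF E(1), of "\<epsilon> / 2"] \<epsilon> by (metis half_gt_zero)
  have "compact K" using K E(2) bounded_subset compact_eq_bounded_closed by blast
  moreover have "closed (- U)" "K \<inter> - U = {}" using U K by auto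
  ultimately obtain \<delta> where \<delta>: "0 < \<delta>" "\<And>x y. x \<in> K \<Longrightarrow> y \<in> - U \<Longrightarrow> \<delta> \<le> dist x y"
    using separate_compact_closed[of K "- U"] by blast
  have D: "(U - E) \<union> (E - K) \<in> lmeasurable" using U(3) K(3) by (rule fmeasurable.Un)
  have "measure lebesgue ((U - E) \<union> (E - K)) \<le> measure lebesgue (U - E) + measure lebesgue (E - K)"
    using U(3) K(3) by (intro measure_Un_le) auto
  also have "\<dots> \<le> \<epsilon> / 2 + \<epsilon> / 2"
    using U(3,4) K(3,4) \<epsilon> by (intro add_mono) (auto simp: emeasure_eq_measure2 ennreal_less_iff)
  finally have m: "measure lebesgue ((U - E) \<union> (E - K)) \<le> \<epsilon>" by simp
  have "b \<in> (U - E) \<union> (E - K) \<or> r \<in> (U - E) \<union> (E - K)" if "b \<in> E" "r \<notin> E" "\<bar>r - b\<bar> < \<delta>" for b r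
    using \<delta>(2)[of b r] that by (force simp: dist_real_def)
  then show ?thesis using D m \<delta>(1) by blast
qed

text \<open>A short step out of a level set of \<open>\<tau>\<close> meets a set of small measure; \<open>\<nu>\<close> counts the sets of
  this kind, one for each of the finitely many values, to which a time belongs.\<close>

lemma simple_function_modulus:
  fixes \<tau> :: "real \<Rightarrow> 'b" and \<epsilon> :: real
  assumes \<tau>: "simple_function (lebesgue_on {a..b}) \<tau>" and \<epsilon>: "0 < \<epsilon>"
  shows "\<exists>\<nu> \<delta>. integrable (lebesgue_on {a..b}) \<nu> \<and> (\<forall>t. 0 \<le> \<nu> t) \<and> (LINT t|lebesgue_on {a..b}. \<nu> t) \<le> \<epsilon> \<and>
    0 < \<delta> \<and> (\<forall>r\<in>{a..b}. \<forall>t\<in>{a..b}. \<bar>r - t\<bar> < \<delta> \<longrightarrow> \<tau> r \<noteq> \<tau> t \<longrightarrow> 1 \<le> \<nu> r + \<nu> t)"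
proof -
  let ?J = "lebesgue_on {a..b}"
  interpret J: finite_measure ?J by (rule finite_measure_lebesgue_on) simp
  define F where "F = insert undefined (\<tau> ` {a..b})"
  have F: "finite F" "F \<noteq> {}" "\<And>t. t \<in> {a..b} \<Longrightarrow> \<tau> t \<in> F"
    using simple_functionD(1)[OF \<tau>] by (auto simp: F_def)
  define L where "L c = {t \<in> {a..b}. \<tau> t = c}" for c
  have Lm: "L c \<in> sets lebesgue" for c
  proof -
    have "L c \<in> sets ?J"
      using simple_functionD(2)[OF \<tau>, of "{c}"] by (simp add: L_def vimage_def Int_def conj_commute)
    then show ?thesis by (auto simp: sets_restrict_space intro!: sets.Int)
  qed
  define e where "e = \<epsilon> / real (card F)"
  have e: "0 < e" "real (card F) * e = \<epsilon>" using \<epsilon> F(1,2) by (auto simp: e_def card_gt_0_iff)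
  have "\<forall>c. \<exists>D \<delta>. D \<in> lmeasurable \<and> measure lebesgue D \<le> e \<and> 0 < \<delta> \<and>
    (\<forall>t\<in>L c. \<forall>r. r \<notin> L c \<longrightarrow> \<bar>r - t\<bar> < \<delta> \<longrightarrow> t \<in> D \<or> r \<in> D)"
  proof
    fix c
    have "bounded (L c)" by (rule bounded_subset[of "{a..b}"]) (auto simp: L_def)
    then show "\<exists>D \<delta>. D \<in> lmeasurable \<and> measure lebesgue D \<le> e \<and> 0 < \<delta> \<and>
        (\<forall>t\<in>L c. \<forall>r. r \<notin> L c \<longrightarrow> \<bar>r - t\<bar> < \<delta> \<longrightarrow> t \<in> D \<or> r \<in> D)"
      by (rule measurable_set_modulus[OF Lm _ e(1)])
  qed
  then obtain D \<Delta> where D: "\<And>c. D c \<in> lmeasurable" "\<And>c. measure lebesgue (D c) \<le> e" "\<And>c. 0 < \<Delta> c"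
    "\<And>c t r. t \<in> L c \<Longrightarrow> r \<notin> L c \<Longrightarrow> \<bar>r - t\<bar> < \<Delta> c \<Longrightarrow> t \<in> D c \<or> r \<in> D c"
    by metis
  define \<delta> where "\<delta> = Min (\<Delta> ` F)"
  have \<delta>: "0 < \<delta>" "\<And>c. c \<in> F \<Longrightarrow> \<delta> \<le> \<Delta> c" using F D(3) by (auto simp: \<delta>_def)
  define \<nu> where "\<nu> t = (\<Sum>c\<in>F. indicat_real (D c) t)" for t
  have Di: "integrable ?J (indicat_real (D c))" for c
    using D(1)[of c] by (intro J.integrable_const_bound[where B=1]) (auto simp: indicator_def measurable_restrict_space1)
  have Dm: "(LINT t|?J. indicat_real (D c) t) \<le> e" for c
  proof -
    have "(LINT t|?J. indicat_real (D c) t) \<le> (LINT t|lebesgue_on UNIV. indicat_real (D c) t)"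
      by (rule integral_mono_lebesgue_on_AE) (use D(1)[of c] in \<open>auto simp: lebesgue_on_UNIV_eq lmeasurable_iff_integrable\<close>)
    also have "\<dots> = measure lebesgue (D c)" by (simp add: lebesgue_on_UNIV_eq)
    finally show ?thesis using D(2)[of c] by simp
  qed
  have \<nu>i: "integrable ?J \<nu>" unfolding \<nu>_def[abs_def] by (intro Bochner_Integration.integrable_sum Di)
  have "(LINT t|?J. \<nu> t) = (\<Sum>c\<in>F. LINT t|?J. indicat_real (D c) t)"
    unfolding \<nu>_def by (rule Bochner_Integration.integral_sum) (rule Di)
  also have "\<dots> \<le> real (card F) * e" by (rule sum_bounded_above) (rule Dm)
  finally have \<nu>\<epsilon>: "(LINT t|?J. \<nu> t) \<le> \<epsilon>" unfolding e(2) .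
  have jump: "1 \<le> \<nu> r + \<nu> t" if rt: "r \<in> {a..b}" "t \<in> {a..b}" "\<bar>r - t\<bar> < \<delta>" "\<tau> r \<noteq> \<tau> t" for r t
  proof -
    have c: "\<tau> t \<in> F" by (rule F(3)[OF rt(2)])
    have "t \<in> D (\<tau> t) \<or> r \<in> D (\<tau> t)"
      using D(4)[of t "\<tau> t" r] rt \<delta>(2)[OF c] by (auto simp: L_def)
    then have "1 \<le> indicat_real (D (\<tau> t)) r + indicat_real (D (\<tau> t)) t" by (auto simp: indicator_def)
    also have "\<dots> \<le> \<nu> r + \<nu> t"
      unfolding \<nu>_def using c F(1) by (intro add_mono member_le_sum) auto
    finally show ?thesis .
  qed
  have "0 \<le> \<nu> t" for t unfolding \<nu>_def by (intro sum_nonneg) simp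
  with \<nu>i \<nu>\<epsilon> \<delta>(1) jump show ?thesis by blast
qed

text \<open>Take \<open>\<sigma> n\<close> where it is close to \<open>w\<close> and zero elsewhere. For large \<open>n\<close> the exceptional set is so
  small that \<open>w\<close> itself has a small integral over it.\<close>

lemma Bochner_simple_approximation:
  fixes w :: "real \<Rightarrow> real \<Rightarrow> real"
  assumes simple: "\<And>n::nat. simple_function (lebesgue_on {a..b}) (\<sigma> n)"
    and \<sigma>: "\<And>n t. t \<in> {a..b} \<Longrightarrow> \<sigma> n t \<in> Lp_space p S"
    and w: "AE t in lebesgue_on {a..b}. w t \<in> Lp_space p S"
    and lim: "AE t in lebesgue_on {a..b}. (\<lambda>n. LINT x|lebesgue_on S. \<bar>\<sigma> n t x - w t x\<bar> powr p) \<longlonglongrightarrow> 0"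
    and int: "integrable (lebesgue_on {a..b}) (\<lambda>t. LINT x|lebesgue_on S. \<bar>w t x\<bar> powr p)"
    and p: "0 < p" and \<epsilon>: "0 < \<epsilon>"
  shows "\<exists>\<tau> \<kappa>. simple_function (lebesgue_on {a..b}) \<tau> \<and> (\<forall>t\<in>{a..b}. \<tau> t \<in> Lp_space p S) \<and>
    integrable (lebesgue_on {a..b}) \<kappa> \<and> (LINT t|lebesgue_on {a..b}. \<kappa> t) \<le> \<epsilon> \<and>
    (\<forall>t\<in>{a..b}. (LINT x|lebesgue_on S. \<bar>w t x - \<tau> t x\<bar> powr p) \<le> \<kappa> t)"
proof -
  let ?J = "lebesgue_on {a..b}"
  interpret J: finite_measure ?J by (rule finite_measure_lebesgue_on) simp
  define d where "d g h = (LINT x|lebesgue_on S. \<bar>g x - h x\<bar> powr p)" for g h :: "real \<Rightarrow> real"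
  define q where "q t = (LINT x|lebesgue_on S. \<bar>w t x\<bar> powr p)" for t
  have qnn: "0 \<le> q t" for t unfolding q_def by (rule Lp_integral_nonneg)
  have fm: "(\<lambda>t. d (\<sigma> n t) (w t)) \<in> borel_measurable ?J" for n
  proof (rule borel_measurable_lebesgue_on_AE_LIMSEQ)
    show "(\<lambda>t. d (\<sigma> n t) (\<sigma> m t)) \<in> borel_measurable ?J" for m
      using simple_function_compose2[OF simple[of n] simple[of m], of d]
      by (intro borel_measurable_simple_function) simp
    show "AE t in ?J. (\<lambda>m. d (\<sigma> n t) (\<sigma> m t)) \<longlonglongrightarrow> d (\<sigma> n t) (w t)"
      using w lim AE_space
    proof eventually_elim
      case (elim t)
      have \<sigma>t: "\<sigma> n t \<in> Lp_space p S" for n using elim(3) by (intro \<sigma>) simp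
      have "(\<lambda>m. LINT x|lebesgue_on S. \<bar>(\<sigma> n t x - \<sigma> m t x) - (\<sigma> n t x - w t x)\<bar> powr p) \<longlonglongrightarrow> 0"
        using elim(2) by (simp add: abs_minus_commute)
      then show ?case unfolding d_def
        using \<sigma>t elim(1) p by (intro Lp_integral_tendsto Lp_space_diff) auto
    qed
  qed simp
  define \<eta> where "\<eta> = \<epsilon> / (\<bar>b - a\<bar> + 1)"
  have \<eta>: "0 < \<eta>" "\<eta> * (\<bar>b - a\<bar> + 1) = \<epsilon>" using \<epsilon> by (auto simp: \<eta>_def)
  define A where "A n = {t \<in> {a..b}. d (\<sigma> n t) (w t) \<le> \<eta>}" for n
  have Am: "A n \<in> sets ?J" for n
  proof -
    have "{t \<in> space ?J. d (\<sigma> n t) (w t) \<le> \<eta>} \<in> sets ?J"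
      using fm[of n] by measurable
    then show ?thesis by (simp add: A_def)
  qed
  have "(\<lambda>n. LINT t|?J. q t * (1 - indicat_real (A n) t)) \<longlonglongrightarrow> (LINT t|?J. 0)"
  proof (rule integral_dominated_convergence[where w=q])
    show "integrable ?J q" using int unfolding q_def[abs_def] .
    then show "(\<lambda>t. q t * (1 - indicat_real (A n) t)) \<in> borel_measurable ?J" for n
      using Am[of n] by measurable
    show "AE t in ?J. norm (q t * (1 - indicat_real (A n) t)) \<le> q t" for n
      using qnn by (auto simp: indicator_def)
    show "AE t in ?J. (\<lambda>n. q t * (1 - indicat_real (A n) t)) \<longlonglongrightarrow> 0"
      using lim AE_space
    proof eventually_elim
      case (elim t)
      have "\<forall>\<^sub>F n in sequentially. d (\<sigma> n t) (w t) < \<eta>"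
        using order_tendstoD(2)[OF elim(1) \<eta>(1)] unfolding d_def .
      then have "\<forall>\<^sub>F n in sequentially. q t * (1 - indicat_real (A n) t) = 0"
        by eventually_elim (use elim(2) in \<open>auto simp: A_def indicator_def\<close>)
      then show ?case by (rule tendsto_eventually)
    qed
  qed simp
  then have "\<forall>\<^sub>F n in sequentially. (LINT t|?J. q t * (1 - indicat_real (A n) t)) < \<eta>"
    using \<eta>(1) by (intro order_tendstoD(2)) auto
  then obtain n where n: "(LINT t|?J. q t * (1 - indicat_real (A n) t)) < \<eta>"
    by (auto simp: eventually_sequentially)
  define \<kappa> where "\<kappa> t = \<eta> + q t * (1 - indicat_real (A n) t)" for t
  have qAi: "integrable ?J (\<lambda>t. q t * (1 - indicat_real (A n) t))"
    using int Am[of n] unfolding q_def[abs_def, symmetric]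
    by (intro integrable_mult_bounded[where B=1]) (auto simp: indicator_def)
  have \<kappa>i: "integrable ?J \<kappa>" unfolding \<kappa>_def[abs_def] using qAi by auto
  have "(LINT t|?J. \<kappa> t) = (LINT t|?J. \<eta>) + (LINT t|?J. q t * (1 - indicat_real (A n) t))"
    unfolding \<kappa>_def using qAi by (intro Bochner_Integration.integral_add) auto
  also have "\<dots> \<le> \<eta> * \<bar>b - a\<bar> + \<eta>"
    using n \<eta>(1) by (intro add_mono) (auto simp: measure_restrict_space mult.commute abs_if)
  also have "\<dots> = \<epsilon>" using \<eta>(2) by (simp add: algebra_simps)
  finally have \<kappa>\<epsilon>: "(LINT t|?J. \<kappa> t) \<le> \<epsilon>" .
  define \<tau> where "\<tau> t = (if t \<in> A n then \<sigma> n t else (\<lambda>x. 0))" for t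
  have \<tau>: "simple_function ?J \<tau>"
    unfolding \<tau>_def[abs_def] using Am[of n] sets.sets_into_space[OF Am[of n]]
    by (intro simple_function_If_set simple) (auto simp: Int_absorb2 Int_absorb1)
  have \<tau>Lp: "\<tau> t \<in> Lp_space p S" if "t \<in> {a..b}" for t
    unfolding \<tau>_def using \<sigma>[OF that] Lp_zero[OF p, of S] by (cases "t \<in> A n") simp_all
  have "d (w t) (\<tau> t) \<le> \<kappa> t" for t
  proof (cases "t \<in> A n")
    case True
    then have "d (\<sigma> n t) (w t) \<le> \<eta>" by (simp add: A_def)
    then show ?thesis using True by (simp add: \<tau>_def \<kappa>_def d_def abs_minus_commute)
  next
    case False
    then show ?thesis using \<eta>(1) by (simp add: \<tau>_def \<kappa>_def d_def q_def)
  qed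
  then show ?thesis using \<tau> \<tau>Lp \<kappa>i \<kappa>\<epsilon> unfolding d_def by blast
qed

text \<open>Values at close times are close unless the approximating simple function jumps in between, and jumps
  are charged to \<open>simple_function_modulus\<close>. The function \<open>\<kappa>\<close> collects this error and that of the
  approximation.\<close>

lemma Bochner_modulus_of_continuity:
  fixes w :: "real \<Rightarrow> real \<Rightarrow> real"
  assumes simple: "\<And>n::nat. simple_function (lebesgue_on {a..b}) (\<sigma> n)"
    and \<sigma>: "\<And>n t. t \<in> {a..b} \<Longrightarrow> \<sigma> n t \<in> Lp_space p S"
    and w: "AE t in lebesgue_on {a..b}. w t \<in> Lp_space p S"
    and lim: "AE t in lebesgue_on {a..b}. (\<lambda>n. LINT x|lebesgue_on S. \<bar>\<sigma> n t x - w t x\<bar> powr p) \<longlonglongrightarrow> 0"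
    and int: "integrable (lebesgue_on {a..b}) (\<lambda>t. LINT x|lebesgue_on S. \<bar>w t x\<bar> powr p)"
    and p: "0 < p" and \<epsilon>: "0 < \<epsilon>"
  shows "\<exists>\<kappa> \<delta> Z. integrable (lebesgue_on {a..b}) \<kappa> \<and> (\<forall>t. 0 \<le> \<kappa> t) \<and> (LINT t|lebesgue_on {a..b}. \<kappa> t) \<le> \<epsilon> \<and>
    0 < \<delta> \<and> negligible Z \<and>
    (\<forall>r\<in>{a..b} - Z. \<forall>t\<in>{a..b} - Z. \<bar>r - t\<bar> < \<delta> \<longrightarrow>
      (LINT x|lebesgue_on S. \<bar>w t x - w r x\<bar> powr p) \<le> \<kappa> r + \<kappa> t)"
proof -
  let ?J = "lebesgue_on {a..b}"
  define d where "d g h = (LINT x|lebesgue_on S. \<bar>g x - h x\<bar> powr p)" for g h :: "real \<Rightarrow> real"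
  have dnn: "0 \<le> d g h" for g h unfolding d_def by (rule Lp_integral_nonneg)
  have tri: "d g h \<le> 2 powr p * (d g k + d h k)"
    if "g \<in> Lp_space p S" "h \<in> Lp_space p S" "k \<in> Lp_space p S" for g h k
    unfolding d_def using that p by (intro Lp_diff_integral_le) auto
  define P where "P = (2::real) powr p"
  have P: "1 \<le> P" using p ge_one_powr_ge_zero[of 2 p] by (simp add: P_def)
  \<comment> \<open>The final bound has the factor \<open>P * P\<close> in front of the two errors, which receive
    half of \<open>\<epsilon>\<close> each.\<close>
  have "0 < \<epsilon> / (2 * (P * P))" using \<epsilon> P by simp
  from Bochner_simple_approximation[OF simple \<sigma> w lim int p this]
  obtain \<tau> \<kappa>\<^sub>0 where \<tau>: "simple_function ?J \<tau>" "\<And>t. t \<in> {a..b} \<Longrightarrow> \<tau> t \<in> Lp_space p S"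
    and \<kappa>\<^sub>0: "integrable ?J \<kappa>\<^sub>0" "(LINT t|?J. \<kappa>\<^sub>0 t) \<le> \<epsilon> / (2 * (P * P))"
    and close0: "\<And>t. t \<in> {a..b} \<Longrightarrow> d (w t) (\<tau> t) \<le> \<kappa>\<^sub>0 t"
    unfolding d_def by blast
  define M where "M = (\<Sum>c\<in>\<tau> ` {a..b}. \<Sum>c'\<in>\<tau> ` {a..b}. d c c')"
  have fin: "finite (\<tau> ` {a..b})" using simple_functionD(1)[OF \<tau>(1)] by simp
  have M: "d c c' \<le> M" if "c \<in> \<tau> ` {a..b}" "c' \<in> \<tau> ` {a..b}" for c c'
  proof -
    have "d c c' \<le> (\<Sum>c'\<in>\<tau> ` {a..b}. d c c')" using that fin dnn by (intro member_le_sum) auto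
    also have "\<dots> \<le> M" unfolding M_def using that fin dnn by (intro member_le_sum) (auto intro: sum_nonneg)
    finally show ?thesis .
  qed
  have Mnn: "0 \<le> M" unfolding M_def by (intro sum_nonneg dnn)
  have "0 < \<epsilon> / (2 * (P * P) * (M + 1))" using \<epsilon> P Mnn by simp
  from simple_function_modulus[OF \<tau>(1) this]
  obtain \<nu> \<delta> where \<nu>: "integrable ?J \<nu>" "\<And>t. 0 \<le> \<nu> t" "(LINT t|?J. \<nu> t) \<le> \<epsilon> / (2 * (P * P) * (M + 1))"
    and \<delta>: "0 < \<delta>"
    and jump: "\<And>r t. r \<in> {a..b} \<Longrightarrow> t \<in> {a..b} \<Longrightarrow> \<bar>r - t\<bar> < \<delta> \<Longrightarrow> \<tau> r \<noteq> \<tau> t \<Longrightarrow> 1 \<le> \<nu> r + \<nu> t"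
    by blast
  define \<kappa> where "\<kappa> t = P * P * (max 0 (\<kappa>\<^sub>0 t) + (M + 1) * \<nu> t)" for t
  have \<kappa>\<^sub>0nn: "0 \<le> \<kappa>\<^sub>0 t" if "t \<in> {a..b}" for t using close0[OF that] dnn order_trans by blast
  have "(LINT t|?J. max 0 (\<kappa>\<^sub>0 t)) = (LINT t|?J. \<kappa>\<^sub>0 t)"
    using \<kappa>\<^sub>0nn by (intro Bochner_Integration.integral_cong) auto
  then have "(LINT t|?J. \<kappa> t) = P * P * (LINT t|?J. \<kappa>\<^sub>0 t) + P * P * (M + 1) * (LINT t|?J. \<nu> t)"
    unfolding \<kappa>_def using \<kappa>\<^sub>0(1) \<nu>(1) by (simp add: algebra_simps)
  also have "\<dots> \<le> P * P * (\<epsilon> / (2 * (P * P))) + P * P * (M + 1) * (\<epsilon> / (2 * (P * P) * (M + 1)))"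
    using P Mnn by (intro add_mono mult_left_mono \<kappa>\<^sub>0(2) \<nu>(3)) auto
  also have "\<dots> = \<epsilon>"
  proof -
    have "R * (\<epsilon> / (2 * R)) + R * N * (\<epsilon> / (2 * R * N)) = \<epsilon>" if "R \<noteq> 0" "N \<noteq> 0" for R N :: real
      using that by (simp add: field_simps)
    from this[of "P * P" "M + 1"] show ?thesis using P Mnn by simp
  qed
  finally have \<kappa>\<epsilon>: "(LINT t|?J. \<kappa> t) \<le> \<epsilon>" .
  have \<kappa>i: "integrable ?J \<kappa>"
    unfolding \<kappa>_def[abs_def] using \<kappa>\<^sub>0(1) \<nu>(1) by auto
  have \<kappa>nn: "0 \<le> \<kappa> t" for t
    unfolding \<kappa>_def using P Mnn \<nu>(2) by (intro mult_nonneg_nonneg add_nonneg_nonneg) auto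
  define Z where "Z = {t \<in> {a..b}. w t \<notin> Lp_space p S}"
  have Z: "negligible Z" using w by (simp add: Z_def AE_lebesgue_on_iff_negligible)
  have est: "d (w t) (w r) \<le> \<kappa> r + \<kappa> t" if r: "r \<in> {a..b} - Z" and t: "t \<in> {a..b} - Z" and rt: "\<bar>r - t\<bar> < \<delta>" for r t
  proof -
    have rab: "r \<in> {a..b}" and tab: "t \<in> {a..b}" using r t by auto
    have Lp: "w r \<in> Lp_space p S" "w t \<in> Lp_space p S" "\<tau> r \<in> Lp_space p S" "\<tau> t \<in> Lp_space p S"
      using r t \<tau>(2) by (auto simp: Z_def)
    have \<tau>\<tau>: "d (\<tau> t) (\<tau> r) \<le> (M + 1) * (\<nu> r + \<nu> t)"
    proof (cases "\<tau> r = \<tau> t")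
      case True
      then have "d (\<tau> t) (\<tau> r) = 0" by (simp add: d_def)
      then show ?thesis using Mnn \<nu>(2)[of r] \<nu>(2)[of t] by simp
    next
      case False
      have "(M + 1) * 1 \<le> (M + 1) * (\<nu> r + \<nu> t)"
        using Mnn by (intro mult_left_mono jump rab tab rt False) simp
      moreover have "d (\<tau> t) (\<tau> r) \<le> M" using M rab tab by auto
      ultimately show ?thesis by simp
    qed
    have 1: "d (w r) (\<tau> t) \<le> P * (\<kappa>\<^sub>0 r + (M + 1) * (\<nu> r + \<nu> t))"
      unfolding P_def
      by (rule order_trans[OF tri[OF Lp(1,4,3)] mult_left_mono[OF add_mono[OF close0[OF rab] \<tau>\<tau>]]]) simp
    have "d (w t) (w r) \<le> P * (\<kappa>\<^sub>0 t + P * (\<kappa>\<^sub>0 r + (M + 1) * (\<nu> r + \<nu> t)))"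
      unfolding P_def
      by (rule order_trans[OF tri[OF Lp(2,1,4)] mult_left_mono[OF add_mono[OF close0[OF tab] 1[unfolded P_def]]]]) simp
    also have "\<dots> = P * \<kappa>\<^sub>0 t + P * P * (\<kappa>\<^sub>0 r + (M + 1) * (\<nu> r + \<nu> t))"
      by (simp add: algebra_simps)
    also have "\<dots> \<le> P * P * \<kappa>\<^sub>0 t + P * P * (\<kappa>\<^sub>0 r + (M + 1) * (\<nu> r + \<nu> t))"
      using P \<kappa>\<^sub>0nn[OF tab] by (intro add_right_mono mult_right_mono) auto
    also have "\<dots> = \<kappa> r + \<kappa> t" using \<kappa>\<^sub>0nn[OF rab] \<kappa>\<^sub>0nn[OF tab] by (simp add: \<kappa>_def algebra_simps)
    finally show ?thesis .
  qed
  show ?thesis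
    using \<kappa>i \<kappa>nn \<kappa>\<epsilon> \<delta> Z est unfolding d_def by blast
qed

text \<open>Every time is a limit of times at which the constraint holds, and along a subsequence of them
  convergence in the mean becomes convergence almost everywhere.\<close>

lemma closed_constraint_all_times:
  fixes u :: "real \<Rightarrow> real \<Rightarrow> real"
  assumes int: "\<And>t. t \<in> {a<..<b} \<Longrightarrow> integrable (lebesgue_on S) (u t)"
    and cont: "\<And>t. t \<in> {a<..<b} \<Longrightarrow> ((\<lambda>r. LINT x|lebesgue_on S. \<bar>u r x - u t x\<bar>) \<longlongrightarrow> 0) (at t)"
    and AE: "AE t in lebesgue_on {a<..<b}. AE x in lebesgue_on S. u t x \<in> K" and K: "closed K"
    and t: "t \<in> {a<..<b}"
  shows "AE x in lebesgue_on S. u t x \<in> K"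
proof -
  let ?P = "\<lambda>t. AE x in lebesgue_on S. u t x \<in> K"
  define d where "d n = min (1 / real (Suc n)) (b - t)" for n
  have "\<exists>r. t < r \<and> r < t + d n \<and> ?P r" for n
  proof (rule ccontr)
    assume "\<not> ?thesis"
    then have "{t<..<t + d n} \<subseteq> {r \<in> {a<..<b}. \<not> ?P r}" using t by (auto simp: d_def)
    moreover have "negligible {r \<in> {a<..<b}. \<not> ?P r}"
      using AE by (simp add: AE_lebesgue_on_iff_negligible)
    ultimately have "negligible {t<..<t + d n}" by (rule negligible_subset[rotated])
    moreover have "0 < d n" using t by (auto simp: d_def)
    ultimately show False using open_not_negligible[of "{t<..<t + d n}"] by auto
  qed
  then obtain r where r: "\<And>n. t < r n" "\<And>n. r n < t + d n" "\<And>n. ?P (r n)" by metis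
  have rI: "r n \<in> {a<..<b}" for n using r(1,2)[of n] t by (auto simp: d_def)
  have "r \<longlonglongrightarrow> t"
  proof (rule tendsto_sandwich[of "\<lambda>n. t" _ _ "\<lambda>n. t + 1 / real (Suc n)"])
    show "\<forall>\<^sub>F n in sequentially. t \<le> r n" using r(1) by (simp add: less_imp_le)
    show "\<forall>\<^sub>F n in sequentially. r n \<le> t + 1 / real (Suc n)"
    proof (rule always_eventually, rule allI)
      fix n show "r n \<le> t + 1 / real (Suc n)" using r(2)[of n] unfolding d_def by linarith
    qed
    have "(\<lambda>n. t + inverse (real (Suc n))) \<longlonglongrightarrow> t + 0"
      by (intro tendsto_add tendsto_const LIMSEQ_inverse_real_of_nat)
    then show "(\<lambda>n. t + 1 / real (Suc n)) \<longlonglongrightarrow> t" by (simp add: inverse_eq_divide)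
  qed simp
  moreover have "r n \<noteq> t" for n using r(1)[of n] by simp
  ultimately have "filterlim r (at t) sequentially"
    unfolding filterlim_at by (intro conjI always_eventually) simp_all
  from filterlim_compose[OF cont[OF t] this]
  have L: "(\<lambda>n. LINT x|lebesgue_on S. norm (u (r n) x - u t x)) \<longlonglongrightarrow> 0" by simp
  have "integrable (lebesgue_on S) (\<lambda>x. u (r n) x - u t x)" for n using int[OF rI] int[OF t] by simp
  from tendsto_L1_AE_subseq[OF this L] obtain s :: "nat \<Rightarrow> nat"
    where s: "AE x in lebesgue_on S. (\<lambda>n. u (r (s n)) x - u t x) \<longlonglongrightarrow> 0" by blast
  have "AE x in lebesgue_on S. \<forall>n. u (r n) x \<in> K"
    using r(3) by (simp add: AE_all_countable)
  with s show ?thesis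
  proof eventually_elim
    case (elim x)
    have "(\<lambda>n. u (r (s n)) x) \<longlonglongrightarrow> u t x" using elim(1) by (rule LIM_zero_cancel)
    then show ?case by (rule closed_sequentially[OF K, rotated]) (simp add: elim(2))
  qed
qed

section \<open>From difference quotients to integral inequalities\<close>

lemma left_difference_quotient_integral:
  fixes Y :: "real \<Rightarrow> real"
  assumes "continuous_on {a..b} Y" "a < x" "x \<le> b"
  shows "((\<lambda>k. (integral {a..x} Y - integral {a..x - k} Y) / k) \<longlongrightarrow> Y x) (at_right 0)"
proof -
  have "((\<lambda>x. integral {a..x} Y) has_real_derivative Y x) (at x within {a..b})"
    using integral_has_real_derivative[OF assms(1), of x] assms by auto
  then have "((\<lambda>y. (integral {a..y} Y - integral {a..x} Y) / (y - x)) \<longlongrightarrow> Y x) (at x within {a..b})"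
    by (simp add: has_field_derivative_iff)
  moreover have "filterlim (\<lambda>k. x - k) (at x within {a..b}) (at_right 0)"
    unfolding filterlim_at
  proof
    show "\<forall>\<^sub>F k in at_right 0. x - k \<in> {a..b} \<and> x - k \<noteq> x"
      by (rule eventually_at_rightI[of 0 "x - a"]) (use assms in auto)
    show "((\<lambda>k. x - k) \<longlongrightarrow> x) (at_right 0)"
      by (auto intro!: tendsto_eq_intros)
  qed
  ultimately have "((\<lambda>k. (integral {a..x - k} Y - integral {a..x} Y) / (x - k - x)) \<longlongrightarrow> Y x) (at_right 0)"
    by (rule filterlim_compose)
  moreover have "(u - v) / (x - k - x) = (v - u) / k" for u v k :: real
  proof -
    have "x - k - x = - k" by simp
    then show ?thesis by (metis minus_diff_eq minus_divide_divide minus_minus)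
  qed
  ultimately show ?thesis by simp
qed

text \<open>A bound on difference quotients at almost every point does not bound increments, as Cantor's
  function shows. It does when the step size \<open>\<delta>\<close> is uniform: averaging the difference quotients over \<open>t\<close>
  recovers the increment of the continuous function \<open>Y\<close> in the limit.\<close>

lemma increment_le_integral:
  fixes Y g :: "real \<Rightarrow> real"
  assumes cont: "continuous_on {a..b} Y" and ord: "a < s" "s \<le> b"
    and g: "g integrable_on {s..b}" and \<delta>: "0 < \<delta>" and N: "negligible N"
    and le: "\<And>t k. t \<in> {s..b} \<Longrightarrow> t \<notin> N \<Longrightarrow> 0 < k \<Longrightarrow> k < \<delta> \<Longrightarrow> a \<le> t - k \<Longrightarrow> Y t - Y (t - k) \<le> k * g t"
  shows "Y b - Y s \<le> integral {s..b} g"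
proof -
  define \<Phi> where "\<Phi> x = integral {a..x} Y" for x
  have int: "Y integrable_on {c..d}" if "a \<le> c" "d \<le> b" for c d
    using that by (intro integrable_continuous_real continuous_on_subset[OF cont]) auto
  have diff: "integral {c..d} Y = \<Phi> d - \<Phi> c" if "a \<le> c" "c \<le> d" "d \<le> b" for c d
    using Henstock_Kurzweil_Integration.integral_combine[OF that(1,2) int] that by (simp add: \<Phi>_def)
  have "((\<lambda>k. (\<Phi> b - \<Phi> (b - k)) / k - (\<Phi> s - \<Phi> (s - k)) / k) \<longlongrightarrow> Y b - Y s) (at_right 0)"
    unfolding \<Phi>_def using ord by (intro tendsto_diff left_difference_quotient_integral[OF cont]) auto
  moreover have "\<forall>\<^sub>F k in at_right 0. (\<Phi> b - \<Phi> (b - k)) / k - (\<Phi> s - \<Phi> (s - k)) / k \<le> integral {s..b} g"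
  proof (rule eventually_at_rightI)
    show "0 < min \<delta> (s - a)" using \<delta> ord by simp
    fix k assume k: "k \<in> {0<..<min \<delta> (s - a)}"
    have shift: "((\<lambda>t. Y (t - k)) has_integral integral {s - k..b - k} Y) {s..b}"
      using has_integral_shift_Icc_real[of Y "-k" "integral {s - k..b - k} Y" s b]
        integrable_integral[OF int[of "s - k" "b - k"]] k by (simp add: o_def)
    have "integral {s..b} Y - integral {s - k..b - k} Y = integral {s..b} (\<lambda>t. Y t - Y (t - k))"
      using shift int[of s b] ord k
      by (subst Henstock_Kurzweil_Integration.integral_diff) (auto simp: has_integral_iff)
    also have "\<dots> \<le> integral {s..b} (\<lambda>t. if t \<in> N then Y t - Y (t - k) else k * g t)"
    proof (rule integral_le)
      show "(\<lambda>t. Y t - Y (t - k)) integrable_on {s..b}"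
        using shift int[of s b] ord k by (intro Henstock_Kurzweil_Integration.integrable_diff) (auto simp: has_integral_iff)
      have "(\<lambda>t. k * g t) integrable_on {s..b}" using g by (rule integrable_on_mult_right)
      then show "(\<lambda>t. if t \<in> N then Y t - Y (t - k) else k * g t) integrable_on {s..b}"
        by (rule integrable_spike[OF _ N]) simp
      show "Y t - Y (t - k) \<le> (if t \<in> N then Y t - Y (t - k) else k * g t)" if "t \<in> {s..b}" for t
        using le[OF that, of k] k that by auto
    qed
    also have "\<dots> = integral {s..b} (\<lambda>t. k * g t)"
      by (rule integral_spike[OF N]) simp
    also have "\<dots> = k * integral {s..b} g" by simp
    finally have "(\<Phi> b - \<Phi> s) - (\<Phi> (b - k) - \<Phi> (s - k)) \<le> k * integral {s..b} g"
      using diff[of s b] diff[of "s - k" "b - k"] ord k by simp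
    then have "((\<Phi> b - \<Phi> s) - (\<Phi> (b - k) - \<Phi> (s - k))) / k \<le> integral {s..b} g"
      using k by (simp add: pos_divide_le_eq mult.commute)
    then show "(\<Phi> b - \<Phi> (b - k)) / k - (\<Phi> s - \<Phi> (s - k)) / k \<le> integral {s..b} g"
      by (simp add: diff_divide_distrib)
  qed
  ultimately show ?thesis by (rule tendsto_upperbound) simp
qed

section \<open>Weak derivatives in time\<close>

text \<open>The derivatives of steepening smooth steps form an approximate identity.\<close>

lemma integral_mult_deriv_smooth_step_tendsto:
  fixes U :: "real \<Rightarrow> real"
  assumes U: "continuous_on {a..b + 1} U" and c: "a \<le> c" "c \<le> b"
  shows "(\<lambda>n. integral {a..b + 1} (\<lambda>t. U t * (real (Suc n) * deriv smooth_step (real (Suc n) * (t - c))))) \<longlonglongrightarrow> U c"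
proof (rule LIMSEQ_I)
  fix e :: real assume "0 < e"
  define k where "k n t = real (Suc n) * deriv smooth_step (real (Suc n) * (t - c))" for n t
  have kc: "continuous_on A (k n)" for A n
    unfolding k_def[abs_def] by (rule continuous_on_deriv_smooth_step_affine)
  have knn: "0 \<le> k n t" for n t unfolding k_def by (intro mult_nonneg_nonneg deriv_smooth_step_nonneg) simp
  have k1: "(k n has_integral 1) {a..b + 1}" for n
  proof -
    have "(k n has_integral (smooth_step (real (Suc n) * (b + 1 - c)) - smooth_step (real (Suc n) * (a - c)))) {a..b + 1}"
      unfolding k_def[abs_def] using c DERIV_smooth_step_affine
      by (intro fundamental_theorem_of_calculus)
        (auto simp: has_real_derivative_iff_has_vector_derivative intro: has_vector_derivative_at_within)
    moreover have "1 * 1 \<le> real (Suc n) * (b + 1 - c)" using c by (intro mult_mono) auto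
    moreover have "real (Suc n) * (a - c) \<le> 0" using c by (intro mult_nonneg_nonpos) auto
    ultimately show ?thesis by (simp add: smooth_step_0 smooth_step_1 del: of_nat_Suc)
  qed
  obtain d where d: "0 < d" "\<And>t. t \<in> {a..b + 1} \<Longrightarrow> \<bar>t - c\<bar> < d \<Longrightarrow> \<bar>U t - U c\<bar> < e / 2"
    using U c \<open>0 < e\<close> unfolding continuous_on_iff dist_real_def
    by (metis add_increasing2 atLeastAtMost_iff half_gt_zero zero_le_one)
  obtain M where M: "inverse (real (Suc M)) < d" using reals_Archimedean[OF d(1)] by blast
  have "norm (integral {a..b + 1} (\<lambda>t. U t * k n t) - U c) < e" if n: "n \<ge> M" for n
  proof -
    have int: "(\<lambda>t. (U t - U c) * k n t) integrable_on {a..b + 1}" "(\<lambda>t. U t * k n t) integrable_on {a..b + 1}"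
      by (intro integrable_continuous_real continuous_intros U kc)+
    have i0: "integral {a..b + 1} (\<lambda>t. U t * k n t) - integral {a..b + 1} (\<lambda>t. U c * k n t)
        = integral {a..b + 1} (\<lambda>t. (U t - U c) * k n t)"
      using int(2) k1[of n]
      by (subst Henstock_Kurzweil_Integration.integral_diff[symmetric])
        (auto simp: algebra_simps has_integral_iff intro!: integrable_on_mult_right)
    have i1: "integral {a..b + 1} (\<lambda>t. U c * k n t) = U c"
      using k1[of n] by (simp add: has_integral_iff)
    have "norm (integral {a..b + 1} (\<lambda>t. (U t - U c) * k n t)) \<le> integral {a..b + 1} (\<lambda>t. e / 2 * k n t)"
    proof (rule integral_norm_bound_integral[OF int(1)])
      show "(\<lambda>t. e / 2 * k n t) integrable_on {a..b + 1}"
        by (intro integrable_continuous_real continuous_intros kc)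
      fix t assume t: "t \<in> {a..b + 1}"
      show "norm ((U t - U c) * k n t) \<le> e / 2 * k n t"
      proof (cases "k n t = 0")
        case False
        then have "0 \<le> real (Suc n) * (t - c)" "real (Suc n) * (t - c) \<le> 1"
          using deriv_smooth_step_0 unfolding k_def by (metis mult_zero_right not_le)+
        then have "0 \<le> t - c" "t - c \<le> inverse (real (Suc n))"
          by (simp_all add: zero_le_mult_iff field_simps del: of_nat_Suc)
        moreover have "inverse (real (Suc n)) \<le> inverse (real (Suc M))" using n by (intro le_imp_inverse_le) auto
        ultimately have "\<bar>t - c\<bar> < d" using M by linarith
        then have "\<bar>U t - U c\<bar> < e / 2" by (rule d(2)[OF t])
        then show ?thesis using knn[of n t] by (simp add: abs_mult mult_right_mono del: times_divide_eq_left)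
      qed simp
    qed
    also have "\<dots> = e / 2" using k1[of n] by (simp add: has_integral_iff)
    finally show ?thesis using i0 unfolding i1 using \<open>0 < e\<close> by simp
  qed
  then show "\<exists>M. \<forall>n\<ge>M. norm (integral {a..b + 1} (\<lambda>t. U t * (real (Suc n) * deriv smooth_step (real (Suc n) * (t - c)))) - U c) < e"
    unfolding k_def by blast
qed

text \<open>Plateau functions over \<open>{a..b}\<close> serve as \<open>\<theta>\<close>: they converge to the indicator of the interval, and
  their derivatives to the difference of the evaluations at \<open>a\<close> and at \<open>b\<close>.\<close>

lemma increment_of_weak_derivative_in_time:
  fixes U h :: "real \<Rightarrow> real"
  assumes U: "continuous_on {0<..} U"
    and h: "\<And>a b. 0 < a \<Longrightarrow> integrable (lebesgue_on {a..b}) h"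
    and weak: "\<And>\<theta>. test_function {0<..} \<theta> \<Longrightarrow> (LINT t|lebesgue_on {0<..}. - U t * deriv \<theta> t + h t * \<theta> t) = 0"
    and ab: "0 < a" "a \<le> b"
  shows "U b - U a = - integral {a..b} h"
proof -
  let ?J = "{a..b + 1}"
  define \<theta> where "\<theta> n = plateau (Suc n) a b" for n
  define k where "k n c t = real (Suc n) * deriv smooth_step (real (Suc n) * (t - c))" for n c t
  have sub: "{a..b + 1 / real (Suc n)} \<subseteq> ?J" for n by auto
  have JT: "?J \<subseteq> {0<..}" using ab by auto
  have \<theta>J: "test_function ?J (\<theta> n)" for n
    unfolding \<theta>_def by (rule test_function_plateau[OF sub ab(2)]) simp
  have \<theta>T: "test_function {0<..} (\<theta> n)" for n
    unfolding \<theta>_def by (rule test_function_plateau[OF order_trans[OF sub JT] ab(2)]) simp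
  have d\<theta>: "deriv (\<theta> n) t = k n a t - k n b t" for n t
    unfolding \<theta>_def k_def plateau_def[abs_def]
    by (rule DERIV_imp_deriv) (intro DERIV_diff DERIV_smooth_step_affine)
  have UJ: "continuous_on ?J U" by (rule continuous_on_subset[OF U JT])
  have kc: "continuous_on A (k n c)" for A n c
    unfolding k_def[abs_def] by (rule continuous_on_deriv_smooth_step_affine)
  have Uki: "integrable (lebesgue_on ?J) (\<lambda>t. U t * k n c t)" for n c
    by (intro continuous_imp_integrable_real continuous_intros UJ kc)
  have hJ: "integrable (lebesgue_on ?J) h" by (rule h[OF ab(1)])
  have \<theta>b: "\<bar>\<theta> n t\<bar> \<le> 1" for n t unfolding \<theta>_def by (rule plateau_bounds[OF ab(2)])
  have \<theta>m: "\<theta> n \<in> borel_measurable (lebesgue_on A)" for n A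
    by (rule borel_measurable_lebesgue_on_continuous[OF test_function_continuous[OF \<theta>J]])
  have h\<theta>: "integrable (lebesgue_on ?J) (\<lambda>t. h t * \<theta> n t)" for n
    by (rule integrable_mult_bounded[OF hJ \<theta>m AE_I2[OF \<theta>b]])
  have eq: "integral ?J (\<lambda>t. U t * k n a t) - integral ?J (\<lambda>t. U t * k n b t) = (LINT t|lebesgue_on ?J. h t * \<theta> n t)" for n
  proof -
    have "(LINT t|lebesgue_on ?J. - U t * deriv (\<theta> n) t + h t * \<theta> n t)
        = (LINT t|lebesgue_on {0<..}. (if t \<in> ?J then - U t * deriv (\<theta> n) t + h t * \<theta> n t else 0))"
      by (rule Lebesgue_Measure.integral_restrict[OF JT, symmetric]) auto
    also have "\<dots> = (LINT t|lebesgue_on {0<..}. - U t * deriv (\<theta> n) t + h t * \<theta> n t)"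
      using test_function_0[OF \<theta>J] test_function_0[OF test_function_deriv[OF \<theta>J]]
      by (intro Bochner_Integration.integral_cong) auto
    also have "\<dots> = 0" by (rule weak[OF \<theta>T])
    finally have "(LINT t|lebesgue_on ?J. (U t * k n b t - U t * k n a t) + h t * \<theta> n t) = 0"
      by (simp add: d\<theta> algebra_simps)
    then have "(LINT t|lebesgue_on ?J. U t * k n b t) - (LINT t|lebesgue_on ?J. U t * k n a t) + (LINT t|lebesgue_on ?J. h t * \<theta> n t) = 0"
      using Uki h\<theta> by simp
    then show ?thesis using lebesgue_integral_eq_integral[OF Uki] by simp
  qed
  have lim1: "(\<lambda>n. integral ?J (\<lambda>t. U t * k n a t) - integral ?J (\<lambda>t. U t * k n b t)) \<longlonglongrightarrow> U a - U b"
    unfolding k_def using ab by (intro tendsto_diff integral_mult_deriv_smooth_step_tendsto UJ) auto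
  have "(\<lambda>n. LINT t|lebesgue_on ?J. h t * \<theta> n t) \<longlonglongrightarrow> (LINT t|lebesgue_on ?J. (if t \<in> {a..b} then h t else 0))"
  proof (rule integral_dominated_convergence[OF _ _ integrable_abs[OF hJ]])
    show "(\<lambda>t. if t \<in> {a..b} then h t else 0) \<in> borel_measurable (lebesgue_on ?J)"
      using borel_measurable_integrable[OF h[OF ab(1), of b]] by (subst borel_measurable_if_lebesgue_on) auto
    show "(\<lambda>t. h t * \<theta> n t) \<in> borel_measurable (lebesgue_on ?J)" for n
      using h\<theta> by (rule borel_measurable_integrable)
    show "AE t in lebesgue_on ?J. norm (h t * \<theta> n t) \<le> \<bar>h t\<bar>" for n
      using \<theta>b by (intro AE_I2) (simp add: abs_mult mult_left_le)
    have "AE t in lebesgue_on ?J. t \<noteq> a"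
      by (subst AE_lebesgue_on_iff_negligible) (auto intro: negligible_subset[of "{a}"])
    then show "AE t in lebesgue_on ?J. (\<lambda>n. h t * \<theta> n t) \<longlonglongrightarrow> (if t \<in> {a..b} then h t else 0)"
    proof eventually_elim
      case (elim t)
      then have "(if t \<in> {a..b} then h t else 0) = h t * indicat_real {a<..b} t" by (auto simp: indicator_def)
      then show ?case unfolding \<theta>_def
        by (simp only:) (intro tendsto_mult tendsto_const LIMSEQ_Suc plateau_tendsto ab)
    qed
  qed
  moreover have "(LINT t|lebesgue_on ?J. (if t \<in> {a..b} then h t else 0)) = integral {a..b} h"
    using h[OF ab(1), of b] by (subst Lebesgue_Measure.integral_restrict) (auto simp: lebesgue_integral_eq_integral)
  ultimately have "(\<lambda>n. integral ?J (\<lambda>t. U t * k n a t) - integral ?J (\<lambda>t. U t * k n b t)) \<longlonglongrightarrow> integral {a..b} h"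
    unfolding eq by simp
  from LIMSEQ_unique[OF lim1 this] show ?thesis by simp
qed

section \<open>Extinction from superlinear and sublinear dissipation\<close>

text \<open>As long as \<open>y\<close> exceeds \<open>A\<close> it decreases at least at the rate \<open>c * A powr e\<close>, which uses up the
  amount \<open>A\<close> within the time \<open>A powr (1 - e) / c\<close>.\<close>

lemma halving_step:
  fixes y :: "real \<Rightarrow> real"
  assumes H: "\<And>s t. a \<le> s \<Longrightarrow> s \<le> t \<Longrightarrow> y t + (t - s) * (c * y t powr e) \<le> y s"
    and nonneg: "0 \<le> e" and c: "0 < c" and A: "0 < A" and s: "a \<le> s" "y s \<le> 2 * A"
  shows "y (s + A powr (1 - e) / c) \<le> A"
proof (rule ccontr)
  let ?t = "s + A powr (1 - e) / c"
  assume "\<not> y ?t \<le> A"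
  then have gt: "A < y ?t" by simp
  have "A = (?t - s) * (c * A powr e)"
    using c A by (simp add: flip: powr_add)
  also have "\<dots> \<le> (?t - s) * (c * y ?t powr e)"
    using c A gt nonneg by (intro mult_left_mono powr_mono2) auto
  finally have "2 * A < y ?t + (?t - s) * (c * y ?t powr e)" using gt by simp
  also have "\<dots> \<le> y s" using s c by (intro H) auto
  finally show False using s by simp
qed

lemma geometric_sum_le:
  fixes q :: real assumes "0 \<le> q" "q < 1" shows "(\<Sum>j<n. q ^ j) \<le> 1 / (1 - q)"
  using assms by (subst sum_gp_strict) (auto simp: divide_right_mono)

text \<open>The superlinear rate brings \<open>y\<close> below one within a time that does not depend on its initial
  size, since the times needed for halving form a geometric series; the sublinear rate then does the
  same for the way from one to zero.\<close>

lemma extinction_time: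
  fixes y :: "real \<Rightarrow> real"
  assumes r: "\<And>s t. a \<le> s \<Longrightarrow> s \<le> t \<Longrightarrow> y t + (t - s) * (c * y t powr r) \<le> y s" "1 < r"
    and \<theta>: "\<And>s t. a \<le> s \<Longrightarrow> s \<le> t \<Longrightarrow> y t + (t - s) * (c * y t powr \<theta>) \<le> y s" "0 \<le> \<theta>" "\<theta> < 1"
    and c: "0 < c" and nonneg: "\<And>t. a \<le> t \<Longrightarrow> 0 \<le> y t"
    and t: "a + 1 / (c * (1 - 2 powr (1 - r))) + 1 / (c * (1 - 2 powr (\<theta> - 1))) \<le> t"
  shows "y t = 0"
proof -
  define q where "q = (2::real) powr (1 - r)"
  define q' where "q' = (2::real) powr (\<theta> - 1)"
  have q: "0 < q" "q < 1" "0 < q'" "q' < 1"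
    using r(2) \<theta>(3) powr_less_mono[of "1 - r" 0 2] powr_less_mono[of "\<theta> - 1" 0 2] by (auto simp: q_def q'_def)
  have anti: "y t \<le> y s" if "a \<le> s" "s \<le> t" for s t
  proof -
    have "0 \<le> (t - s) * (c * y t powr r)" using that c by simp
    then show ?thesis using r(1)[OF that] by simp
  qed
  have pw: "(2 ^ n) powr (1 - r) = q ^ n" "((1/2) ^ Suc n) powr (1 - \<theta>) = q' ^ Suc n" for n
  proof -
    show "(2 ^ n) powr (1 - r) = q ^ n" unfolding q_def
      by (simp add: powr_powr mult.commute flip: powr_realpow)
    have "((1/2) ^ Suc n) = (2::real) powr (- real (Suc n))"
      by (simp add: powr_minus powr_realpow power_one_over inverse_eq_divide del: of_nat_Suc)
    then have "((1/2) ^ Suc n) powr (1 - \<theta>) = 2 powr (- real (Suc n) * (1 - \<theta>))"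
      by (simp only: powr_powr)
    also have "- real (Suc n) * (1 - \<theta>) = (\<theta> - 1) * real (Suc n)" by (simp only: algebra_simps)
    also have "2 powr ((\<theta> - 1) * real (Suc n)) = q' ^ Suc n"
      unfolding q'_def by (simp only: powr_powr[symmetric]) (simp add: powr_realpow del: of_nat_Suc)
    finally show "((1/2) ^ Suc n) powr (1 - \<theta>) = q' ^ Suc n" .
  qed
  have phase1: "a \<le> s \<Longrightarrow> y s \<le> 2 ^ n \<Longrightarrow> y (s + (\<Sum>j<n. q ^ j) / c) \<le> 1" for n s
  proof (induction n arbitrary: s)
    case (Suc n)
    have "y (s + (2 ^ n) powr (1 - r) / c) \<le> 2 ^ n"
      using Suc.prems r(2) by (intro halving_step[OF r(1)] c) auto
    then have "y (s + q ^ n / c + (\<Sum>j<n. q ^ j) / c) \<le> 1"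
      using Suc.prems q c unfolding pw by (intro Suc.IH) (auto intro: order_trans[of a s])
    moreover have "s + (\<Sum>j<Suc n. q ^ j) / c = s + q ^ n / c + (\<Sum>j<n. q ^ j) / c"
      by (simp add: add_divide_distrib)
    ultimately show ?case by (simp only:)
  qed simp
  have phase2: "a \<le> s \<Longrightarrow> y s \<le> 1 \<Longrightarrow> y (s + (\<Sum>j<n. q' ^ Suc j) / c) \<le> (1/2) ^ n" for n s
  proof (induction n)
    case (Suc n)
    have "y (s + (\<Sum>j<n. q' ^ Suc j) / c + ((1/2) ^ Suc n) powr (1 - \<theta>) / c) \<le> (1/2) ^ Suc n"
      using Suc q c \<theta> by (intro halving_step[OF \<theta>(1)]) (auto simp: sum_nonneg intro!: add_increasing2)
    then show ?case unfolding pw by (simp add: add_divide_distrib add.assoc)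
  qed simp
  have geo: "(\<Sum>j<n. q ^ j) / c \<le> 1 / (c * (1 - q))" "(\<Sum>j<n. q' ^ Suc j) / c \<le> 1 / (c * (1 - q'))" for n
  proof -
    have "(\<Sum>j<n. q ^ j) / c \<le> (1 / (1 - q)) / c"
      using geometric_sum_le[of q n] q c by (intro divide_right_mono) auto
    then show "(\<Sum>j<n. q ^ j) / c \<le> 1 / (c * (1 - q))" by (simp add: mult.commute)
    have "(\<Sum>j<n. q' ^ Suc j) \<le> (\<Sum>j<n. q' ^ j)"
      using q by (intro sum_mono) (simp add: mult_left_le_one_le)
    then have "(\<Sum>j<n. q' ^ Suc j) / c \<le> (1 / (1 - q')) / c"
      using geometric_sum_le[of q' n] q c by (intro divide_right_mono) auto
    then show "(\<Sum>j<n. q' ^ Suc j) / c \<le> 1 / (c * (1 - q'))" by (simp add: mult.commute)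
  qed
  define s where "s = a + 1 / (c * (1 - q))"
  have as: "a \<le> s" using q c by (simp add: s_def)
  obtain n where "y a < 2 ^ n" using real_arch_pow[of 2 "y a"] by auto
  then have "y (a + (\<Sum>j<n. q ^ j) / c) \<le> 1" by (intro phase1) auto
  moreover have "y s \<le> y (a + (\<Sum>j<n. q ^ j) / c)"
    using geo(1)[of n] q c by (intro anti) (auto simp: s_def sum_nonneg)
  ultimately have s1: "y s \<le> 1" by simp
  have "y t \<le> (1/2) ^ n" for n
  proof -
    have "y t \<le> y (s + (\<Sum>j<n. q' ^ Suc j) / c)"
    proof (rule anti)
      show "a \<le> s + (\<Sum>j<n. q' ^ Suc j) / c" using as q c by (simp add: sum_nonneg add_increasing2)
      show "s + (\<Sum>j<n. q' ^ Suc j) / c \<le> t" using t geo(2)[of n] by (simp add: s_def q_def q'_def)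
    qed
    also have "\<dots> \<le> (1/2) ^ n" by (rule phase2[OF as s1])
    finally show ?thesis .
  qed
  then have "y t \<le> 0"
    by (intro LIMSEQ_le_const[OF LIMSEQ_power_zero[of "1/2"]]) auto
  moreover have "a \<le> t"
  proof -
    have "0 \<le> 1 / (c * (1 - q))" "0 \<le> 1 / (c * (1 - q'))" using q c by auto
    then show ?thesis using t unfolding q_def q'_def by linarith
  qed
  ultimately show ?thesis using nonneg[of t] by simp
qed

section \<open>The flux of the p-Laplacian\<close>

lemma DERIV_abs_powr:
  fixes p x :: real assumes p: "1 < p"
  shows "((\<lambda>x. \<bar>x\<bar> powr p) has_real_derivative p * (\<bar>x\<bar> powr (p - 2) * x)) (at x)"
proof -
  consider "x > 0" | "x < 0" | "x = 0" by linarith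
  then show ?thesis
  proof cases
    case 1
    have D: "((\<lambda>x. x powr p) has_real_derivative p * x powr (p - 1)) (at x)"
      using 1 by (rule has_real_derivative_powr)
    have ev: "\<forall>\<^sub>F y in nhds x. y powr p = \<bar>y\<bar> powr p"
      using eventually_nhds_in_open[of "{0<..}" x] 1 by (auto elim!: eventually_mono)
    have eq: "p * x powr (p - 1) = p * (\<bar>x\<bar> powr (p - 2) * x)"
      using 1 powr_add[of x "p - 2" 1] by simp
    show ?thesis by (rule DERIV_cong_ev[OF refl ev eq, THEN iffD1, OF D])
  next
    case 2
    have D: "((\<lambda>x. (- x) powr p) has_real_derivative p * (\<bar>x\<bar> powr (p - 2) * x)) (at x)"
      using 2 powr_add[of "- x" "p - 2" 1] by (auto intro!: derivative_eq_intros)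
    have ev: "\<forall>\<^sub>F y in nhds x. (- y) powr p = \<bar>y\<bar> powr p"
      using eventually_nhds_in_open[of "{..<0}" x] 2 by (auto elim!: eventually_mono)
    show ?thesis by (rule DERIV_cong_ev[OF refl ev refl, THEN iffD1, OF D])
  next
    case 3
    have "((\<lambda>h. \<bar>h\<bar> powr (p - 1)) \<longlongrightarrow> \<bar>0\<bar> powr (p - 1)) (at (0::real))"
      using p by (intro tendsto_powr2 tendsto_intros) auto
    then have "((\<lambda>h. norm (\<bar>h\<bar> powr p / h)) \<longlongrightarrow> 0) (at (0::real))"
      using p by (simp add: abs_divide powr_diff)
    then have "((\<lambda>h. \<bar>h\<bar> powr p / h) \<longlongrightarrow> 0) (at (0::real))"
      by (simp only: tendsto_norm_zero_iff)
    then show ?thesis using 3 p by (simp add: DERIV_def)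
  qed
qed

lemma abs_powr_increment_le:
  fixes a h z Z p :: real
  assumes p: "1 < p" and h: "0 < h" "h \<le> 1" and z: "\<bar>z\<bar> \<le> Z"
  shows "\<bar>(\<bar>a + h * z\<bar> powr p - \<bar>a\<bar> powr p) / h\<bar> \<le> p * Z * (1 + 2 powr p * (\<bar>a\<bar> powr p + Z powr p))"
proof -
  have "\<exists>\<xi>. \<bar>\<xi>\<bar> \<le> \<bar>a\<bar> + Z \<and> \<bar>a + h * z\<bar> powr p - \<bar>a\<bar> powr p = h * z * (p * (\<bar>\<xi>\<bar> powr (p - 2) * \<xi>))"
  proof -
    have hz: "\<bar>h * z\<bar> \<le> Z" using h z mult_mono[of h 1 "\<bar>z\<bar>" Z] by (simp add: abs_mult)
    define P where "P x = \<bar>x\<bar> powr p" for x :: real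
    have D: "(P has_real_derivative p * (\<bar>x\<bar> powr (p - 2) * x)) (at x)" for x
      unfolding P_def[abs_def] by (rule DERIV_abs_powr[OF p])
    consider "h * z = 0" | "a < a + h * z" | "a + h * z < a" by linarith
    then show ?thesis
    proof cases
      case 1
      then show ?thesis using z by (intro exI[of _ a]) auto
    next
      case 2
      obtain \<xi> where "a < \<xi>" "\<xi> < a + h * z" "P (a + h * z) - P a = (a + h * z - a) * (p * (\<bar>\<xi>\<bar> powr (p - 2) * \<xi>))"
        using MVT2[OF 2 D] by blast
      then show ?thesis using hz by (intro exI[of _ \<xi>]) (auto simp: P_def)
    next
      case 3
      obtain \<xi> where "a + h * z < \<xi>" "\<xi> < a" "P a - P (a + h * z) = (a - (a + h * z)) * (p * (\<bar>\<xi>\<bar> powr (p - 2) * \<xi>))"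
        using MVT2[OF 3 D] by blast
      then show ?thesis using hz by (intro exI[of _ \<xi>]) (auto simp: P_def algebra_simps)
    qed
  qed
  then obtain \<xi> where \<xi>: "\<bar>\<xi>\<bar> \<le> \<bar>a\<bar> + Z" and eq: "\<bar>a + h * z\<bar> powr p - \<bar>a\<bar> powr p = h * z * (p * (\<bar>\<xi>\<bar> powr (p - 2) * \<xi>))"
    by blast
  have "\<bar>\<bar>\<xi>\<bar> powr (p - 2) * \<xi>\<bar> = \<bar>\<xi>\<bar> powr (p - 1)"
    using powr_add[of "\<bar>\<xi>\<bar>" "p - 2" 1] by (simp add: abs_mult)
  also have "\<dots> \<le> 1 + \<bar>\<xi>\<bar> powr p"
    using powr_mono2[of "p - 1" "\<bar>\<xi>\<bar>" 1] powr_mono[of "p - 1" p "\<bar>\<xi>\<bar>"] p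
    by (cases "\<bar>\<xi>\<bar> \<le> 1") (auto intro: add_increasing2 add_increasing)
  also have "\<bar>\<xi>\<bar> powr p \<le> (\<bar>a\<bar> + Z) powr p"
    using p \<xi> by (intro powr_mono2) auto
  also have "(\<bar>a\<bar> + Z) powr p \<le> 2 powr p * (\<bar>a\<bar> powr p + Z powr p)"
    using powr_abs_add_le[of p "\<bar>a\<bar>" Z] p z by simp
  finally have F: "\<bar>\<bar>\<xi>\<bar> powr (p - 2) * \<xi>\<bar> \<le> 1 + 2 powr p * (\<bar>a\<bar> powr p + Z powr p)" by simp
  have "\<bar>(\<bar>a + h * z\<bar> powr p - \<bar>a\<bar> powr p) / h\<bar> = p * \<bar>z\<bar> * \<bar>\<bar>\<xi>\<bar> powr (p - 2) * \<xi>\<bar>"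
    using eq h p by (simp add: abs_mult)
  also have "\<dots> \<le> p * Z * (1 + 2 powr p * (\<bar>a\<bar> powr p + Z powr p))"
    using z p F by (intro mult_mono) auto
  finally show ?thesis .
qed

lemma flux_measurable:
  "w \<in> borel_measurable M \<Longrightarrow> (\<lambda>x. \<bar>w x\<bar> powr (p - 2) * w x :: real) \<in> borel_measurable M"
  by measurable

text \<open>The integral of the flux against \<open>z\<close> is, up to the factor \<open>p\<close>, a directional derivative of the
  integral of \<open>\<bar>w\<bar> powr p\<close>, hence a limit of difference quotients of distances. This is how its
  dependence on time will be seen to be measurable.\<close>

lemma flux_pairing_limit:
  fixes w z :: "real \<Rightarrow> real"
  assumes w: "w \<in> Lp_space p S" and z: "z \<in> borel_measurable (lebesgue_on S)" "\<And>x. \<bar>z x\<bar> \<le> Z"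
    and S: "S \<in> lmeasurable" and p: "1 < p"
  shows "(\<lambda>n. real (Suc n) * ((LINT x|lebesgue_on S. \<bar>w x - (- z x / real (Suc n))\<bar> powr p) - (LINT x|lebesgue_on S. \<bar>w x\<bar> powr p)))
      \<longlonglongrightarrow> p * (LINT x|lebesgue_on S. \<bar>w x\<bar> powr (p - 2) * w x * z x)"
    and "integrable (lebesgue_on S) (\<lambda>x. \<bar>w x\<bar> powr (p - 2) * w x * z x)"
    and "\<bar>LINT x|lebesgue_on S. \<bar>w x\<bar> powr (p - 2) * w x * z x\<bar>
      \<le> Z * (measure lebesgue S + (LINT x|lebesgue_on S. \<bar>w x\<bar> powr p))"
proof -
  let ?L = "lebesgue_on S"
  interpret finite_measure ?L by (rule finite_measure_lebesgue_on[OF S])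
  have wm: "w \<in> borel_measurable ?L" and wi: "integrable ?L (\<lambda>x. \<bar>w x\<bar> powr p)"
    using w by (auto simp: Lp_space_def)
  have Znn: "0 \<le> Z" using z(2)[of undefined] by linarith
  have fl: "\<bar>\<bar>a\<bar> powr (p - 2) * a * b\<bar> \<le> Z * (1 + \<bar>a\<bar> powr p)" if "\<bar>b\<bar> \<le> Z" for a b :: real
  proof -
    have "\<bar>\<bar>a\<bar> powr (p - 2) * a\<bar> = \<bar>a\<bar> powr (p - 1)"
      using powr_add[of "\<bar>a\<bar>" "p - 2" 1] by (simp add: abs_mult)
    also have "\<dots> \<le> 1 + \<bar>a\<bar> powr p"
      using powr_mono2[of "p - 1" "\<bar>a\<bar>" 1] powr_mono[of "p - 1" p "\<bar>a\<bar>"] p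
      by (cases "\<bar>a\<bar> \<le> 1") (auto intro: add_increasing2 add_increasing)
    finally have "\<bar>\<bar>a\<bar> powr (p - 2) * a\<bar> * \<bar>b\<bar> \<le> (1 + \<bar>a\<bar> powr p) * Z"
      using that by (intro mult_mono) auto
    then show ?thesis by (simp add: abs_mult mult.commute)
  qed
  have bi: "integrable ?L (\<lambda>x. Z * (1 + \<bar>w x\<bar> powr p))" using wi by auto
  show int: "integrable ?L (\<lambda>x. \<bar>w x\<bar> powr (p - 2) * w x * z x)"
  proof (rule Bochner_Integration.integrable_bound[OF bi])
    show "(\<lambda>x. \<bar>w x\<bar> powr (p - 2) * w x * z x) \<in> borel_measurable ?L"
      by (intro borel_measurable_times flux_measurable wm z borel_measurable_abs_powr)
    show "AE x in ?L. norm (\<bar>w x\<bar> powr (p - 2) * w x * z x) \<le> norm (Z * (1 + \<bar>w x\<bar> powr p))"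
      using fl[OF z(2)] by (intro AE_I2) (auto intro: order_trans[OF _ abs_ge_self])
  qed
  have "\<bar>LINT x|?L. \<bar>w x\<bar> powr (p - 2) * w x * z x\<bar> \<le> (LINT x|?L. \<bar>\<bar>w x\<bar> powr (p - 2) * w x * z x\<bar>)"
    by (rule integral_abs_bound)
  also have "\<dots> \<le> (LINT x|?L. Z * (1 + \<bar>w x\<bar> powr p))"
    by (intro Bochner_Integration.integral_mono integrable_abs int bi fl z)
  also have "\<dots> = Z * (measure lebesgue S + (LINT x|?L. \<bar>w x\<bar> powr p))"
    using wi S by (simp add: measure_restrict_space fmeasurableD)
  finally show "\<bar>LINT x|?L. \<bar>w x\<bar> powr (p - 2) * w x * z x\<bar> \<le> Z * (measure lebesgue S + (LINT x|?L. \<bar>w x\<bar> powr p))" .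
  let ?q = "\<lambda>n x. real (Suc n) * (\<bar>w x - (- z x / real (Suc n))\<bar> powr p - \<bar>w x\<bar> powr p)"
  have zi: "integrable ?L (\<lambda>x. \<bar>w x - (- z x / real (Suc n))\<bar> powr p)" for n
  proof -
    have "(\<lambda>x. - z x / real (Suc n)) \<in> Lp_space p S"
      by (rule bounded_Lp_space_divide[OF z S]) (use p in simp)
    then show ?thesis using Lp_space_diff[OF w, of "\<lambda>x. - z x / real (Suc n)"] p by (simp add: Lp_space_def)
  qed
  have "(\<lambda>n. LINT x|?L. ?q n x) \<longlonglongrightarrow> (LINT x|?L. p * (\<bar>w x\<bar> powr (p - 2) * w x * z x))"
  proof (rule integral_dominated_convergence[where w="\<lambda>x. p * Z * (1 + 2 powr p * (\<bar>w x\<bar> powr p + Z powr p))"])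
    show "(\<lambda>x. p * (\<bar>w x\<bar> powr (p - 2) * w x * z x)) \<in> borel_measurable ?L" using int by measurable
    show "?q n \<in> borel_measurable ?L" for n
      using zi[of n] wi by measurable
    show "integrable ?L (\<lambda>x. p * Z * (1 + 2 powr p * (\<bar>w x\<bar> powr p + Z powr p)))" using wi by auto
    show "AE x in ?L. norm (?q n x) \<le> p * Z * (1 + 2 powr p * (\<bar>w x\<bar> powr p + Z powr p))" for n
      using abs_powr_increment_le[OF p, of "1 / real (Suc n)" "z _" Z "w _"] z(2)
      by (intro AE_I2) (simp add: mult.commute)
    show "AE x in ?L. (\<lambda>n. ?q n x) \<longlonglongrightarrow> p * (\<bar>w x\<bar> powr (p - 2) * w x * z x)"
    proof (rule AE_I2)
      fix x
      have D: "((\<lambda>h. \<bar>w x + h * z x\<bar> powr p) has_real_derivative p * (\<bar>w x\<bar> powr (p - 2) * w x) * z x) (at 0)"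
      proof (rule DERIV_chain2[of "\<lambda>y. \<bar>y\<bar> powr p"])
        show "((\<lambda>y. \<bar>y\<bar> powr p) has_real_derivative p * (\<bar>w x\<bar> powr (p - 2) * w x)) (at (w x + 0 * z x))"
          using DERIV_abs_powr[OF p, of "w x"] by simp
        show "((\<lambda>h. w x + h * z x) has_real_derivative z x) (at 0)"
          by (auto intro!: derivative_eq_intros)
      qed
      have "filterlim (\<lambda>n. 1 / real (Suc n)) (at 0) sequentially"
        unfolding filterlim_at using LIMSEQ_inverse_real_of_nat by (auto simp: inverse_eq_divide)
      from filterlim_compose[OF D[unfolded DERIV_def] this]
      show "(\<lambda>n. ?q n x) \<longlonglongrightarrow> p * (\<bar>w x\<bar> powr (p - 2) * w x * z x)"
        by (simp add: mult_ac del: of_nat_Suc)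
    qed
  qed
  then show "(\<lambda>n. real (Suc n) * ((LINT x|?L. \<bar>w x - (- z x / real (Suc n))\<bar> powr p) - (LINT x|?L. \<bar>w x\<bar> powr p)))
      \<longlonglongrightarrow> p * (LINT x|?L. \<bar>w x\<bar> powr (p - 2) * w x * z x)"
    using zi wi by simp
qed

text \<open>In the energy estimate \<open>a\<close> is the gradient at one time and \<open>b\<close> approximates the gradient at a close
  time. Half of the diffusion term is given up, so that the error contains only the \<open>p\<close>-th power of
  the distance.\<close>

lemma flux_coercive:
  fixes a b p :: real assumes p: "1 \<le> p"
  shows "\<bar>a\<bar> powr p / 2 - 2 powr (p - 1) * \<bar>b - a\<bar> powr p \<le> \<bar>a\<bar> powr (p - 2) * a * b"
proof -
  have "\<bar>a\<bar> powr (p - 1) * \<bar>b - a\<bar> \<le> \<bar>a\<bar> powr p / 2 + 2 powr (p - 1) * \<bar>b - a\<bar> powr p"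
  proof (cases "2 * \<bar>b - a\<bar> \<le> \<bar>a\<bar>")
    case True
    then have "\<bar>a\<bar> powr (p - 1) * \<bar>b - a\<bar> \<le> \<bar>a\<bar> powr (p - 1) * (\<bar>a\<bar> / 2)" by (intro mult_left_mono) auto
    also have "\<dots> = \<bar>a\<bar> powr p / 2" using powr_add[of "\<bar>a\<bar>" "p - 1" 1] by simp
    finally show ?thesis by (smt (verit) powr_ge_zero mult_nonneg_nonneg)
  next
    case False
    then have "\<bar>a\<bar> powr (p - 1) \<le> (2 * \<bar>b - a\<bar>) powr (p - 1)" using p by (intro powr_mono2) auto
    then have "\<bar>a\<bar> powr (p - 1) * \<bar>b - a\<bar> \<le> (2 * \<bar>b - a\<bar>) powr (p - 1) * \<bar>b - a\<bar>" by (intro mult_right_mono) auto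
    also have "\<dots> = 2 powr (p - 1) * \<bar>b - a\<bar> powr p"
      using powr_add[of "\<bar>b - a\<bar>" "p - 1" 1] by (simp add: powr_mult)
    finally show ?thesis by (smt (verit) powr_ge_zero divide_nonneg_nonneg)
  qed
  moreover have "\<bar>a\<bar> powr (p - 2) * a * b = \<bar>a\<bar> powr p + \<bar>a\<bar> powr (p - 2) * a * (b - a)"
  proof -
    have "\<bar>a\<bar> powr (p - 2) * (a * a) = \<bar>a\<bar> powr p"
      using powr_add[of "\<bar>a\<bar>" "p - 2" 2] by (cases "a = 0") (simp_all add: power2_eq_square)
    then show ?thesis by (simp add: algebra_simps)
  qed
  moreover have "- (\<bar>a\<bar> powr (p - 1) * \<bar>b - a\<bar>) \<le> \<bar>a\<bar> powr (p - 2) * a * (b - a)"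
  proof -
    have "\<bar>\<bar>a\<bar> powr (p - 2) * a * (b - a)\<bar> = \<bar>a\<bar> powr (p - 1) * \<bar>b - a\<bar>"
      using powr_add[of "\<bar>a\<bar>" "p - 2" 1] by (simp add: abs_mult)
    then show ?thesis by linarith
  qed
  ultimately show ?thesis by linarith
qed

section \<open>The singular absorption\<close>

text \<open>In the energy estimate \<open>A\<close> and \<open>B\<close> are values of the solution at two close times. The singular term
  is not continuous, but the error becomes small if first \<open>\<delta>\<close> and then \<open>\<bar>A - B\<bar>\<close> is taken small.\<close>

lemma singular_term_coercive:
  assumes \<beta>: "0 < \<beta>" "\<beta> < 1" and AB: "0 \<le> A" "0 \<le> B" and \<delta>: "0 < \<delta>"
  shows "B powr (1 - \<beta>) - \<delta> powr (1 - \<beta>) - \<delta> powr (- \<beta>) * \<bar>A - B\<bar> \<le> singular_term \<beta> A * B"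
proof -
  have split: "s powr (1 - \<beta>) \<le> \<delta> powr (1 - \<beta>) + \<delta> powr (- \<beta>) * s" if "0 \<le> s" for s
  proof (cases "s \<le> \<delta>")
    case True
    then have "s powr (1 - \<beta>) \<le> \<delta> powr (1 - \<beta>)" using that \<beta> by (intro powr_mono2) auto
    then show ?thesis using that by (simp add: add_increasing2)
  next
    case False
    then have "s powr (- \<beta>) * s \<le> \<delta> powr (- \<beta>) * s" using \<delta> \<beta> that by (intro mult_right_mono powr_mono2') auto
    moreover have "s powr (1 - \<beta>) = s powr (- \<beta>) * s" using False \<delta> powr_add[of s "- \<beta>" 1] by simp
    ultimately show ?thesis by (smt (verit) powr_ge_zero)
  qed
  have bnn: "0 \<le> \<delta> powr (1 - \<beta>)" "0 \<le> \<delta> powr (- \<beta>) * \<bar>A - B\<bar>" by auto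
  have Beq: "B powr (1 - \<beta>) = B powr (- \<beta>) * B" if "0 < B" using that powr_add[of B "- \<beta>" 1] by simp
  consider "B = 0" | "0 < B" "A = 0" | "0 < B" "0 < A" "A \<le> B" | "0 < B" "B < A" using AB by linarith
  then show ?thesis
  proof cases
    case 1
    then have "B powr (1 - \<beta>) = 0" "singular_term \<beta> A * B = 0" by auto
    then show ?thesis using bnn by linarith
  next
    case 2
    then show ?thesis using split[of B] by (simp add: singular_term_def)
  next
    case 3
    then have "B powr (- \<beta>) \<le> A powr (- \<beta>)" using \<beta> by (intro powr_mono2') auto
    then have "B powr (- \<beta>) * B \<le> A powr (- \<beta>) * B" using 3 by (intro mult_right_mono) auto
    moreover have "singular_term \<beta> A = A powr (- \<beta>)" using 3 by (simp add: singular_term_def)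
    ultimately show ?thesis using bnn Beq[OF 3(1)] by (simp only:)
  next
    case 4
    show ?thesis
    proof (cases "B \<le> \<delta>")
      case True
      then have "B powr (1 - \<beta>) \<le> \<delta> powr (1 - \<beta>)" using 4 \<beta> by (intro powr_mono2) auto
      moreover have "0 \<le> singular_term \<beta> A * B" using 4 by (simp add: singular_term_def)
      ultimately show ?thesis using bnn by linarith
    next
      case False
      have le: "A powr (1 - \<beta>) \<ge> B powr (1 - \<beta>)" using 4 \<beta> by (intro powr_mono2) auto
      have "A powr (1 - \<beta>) = A powr (- \<beta>) * A" using 4 powr_add[of A "- \<beta>" 1] by simp
      then have "B powr (1 - \<beta>) - A powr (- \<beta>) * B \<le> A powr (- \<beta>) * (A - B)"
        using le by (simp add: algebra_simps)
      also have "\<dots> \<le> \<delta> powr (- \<beta>) * (A - B)"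
        using 4 False \<delta> \<beta> by (intro mult_right_mono powr_mono2') auto
      finally have "B powr (1 - \<beta>) - A powr (- \<beta>) * B \<le> \<delta> powr (- \<beta>) * \<bar>A - B\<bar>" using 4 by simp
      moreover have "singular_term \<beta> A = A powr (- \<beta>)" using 4 by (simp add: singular_term_def)
      ultimately show ?thesis using bnn(1) by (simp only:)
    qed
  qed
qed

lemma powr_diff_le:
  fixes A B \<beta> \<delta> :: real
  assumes \<beta>: "0 < \<beta>" "\<beta> < 1" and AB: "0 \<le> A" "0 \<le> B" and \<delta>: "0 < \<delta>"
  shows "\<bar>A powr (1 - \<beta>) - B powr (1 - \<beta>)\<bar> \<le> \<delta> powr (1 - \<beta>) + \<delta> powr (- \<beta>) * \<bar>A - B\<bar>"
proof -
  have *: "\<bar>A powr (1 - \<beta>) - B powr (1 - \<beta>)\<bar> \<le> \<delta> powr (1 - \<beta>) + \<delta> powr (- \<beta>) * \<bar>A - B\<bar>"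
    if AB: "0 \<le> B" "B \<le> A" for A B
  proof -
    have le: "B powr (1 - \<beta>) \<le> A powr (1 - \<beta>)" using AB \<beta> by (intro powr_mono2) auto
    have nn: "0 \<le> \<delta> powr (1 - \<beta>)" "0 \<le> \<delta> powr (- \<beta>) * \<bar>A - B\<bar>" "0 \<le> B powr (1 - \<beta>)" by auto
    show ?thesis
    proof (cases "A \<le> \<delta>")
      case True
      then have "A powr (1 - \<beta>) \<le> \<delta> powr (1 - \<beta>)" using AB \<beta> by (intro powr_mono2) auto
      then show ?thesis using le nn by linarith
    next
      case False
      then have A: "0 < A" using \<delta> by simp
      have Aeq: "A powr (1 - \<beta>) = A powr (- \<beta>) * A" using A powr_add[of A "- \<beta>" 1] by simp
      have "A powr (- \<beta>) * B \<le> B powr (1 - \<beta>)"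
      proof (cases "B = 0")
        case False
        then have "A powr (- \<beta>) * B \<le> B powr (- \<beta>) * B"
          using AB \<beta> by (intro mult_right_mono powr_mono2') auto
        then show ?thesis using False AB powr_add[of B "- \<beta>" 1] by simp
      qed simp
      then have "A powr (1 - \<beta>) - B powr (1 - \<beta>) \<le> A powr (- \<beta>) * (A - B)"
        unfolding Aeq by (simp add: algebra_simps)
      also have "\<dots> \<le> \<delta> powr (- \<beta>) * (A - B)"
        using AB False \<delta> \<beta> by (intro mult_right_mono powr_mono2') auto
      also have "\<dots> = \<delta> powr (- \<beta>) * \<bar>A - B\<bar>" using AB by simp
      finally show ?thesis using le nn by linarith
    qed
  qed
  show ?thesis
  proof (cases "B \<le> A")
    case True
    then show ?thesis using *[OF AB(2)] by blast
  next
    case False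
    then show ?thesis using *[OF AB(1), of B] by (simp add: abs_minus_commute)
  qed
qed

section \<open>Basic properties of weak solutions\<close>

text \<open>The energy \<open>y\<close> is dissipated by diffusion at the rate \<open>E\<close> and by the singular absorption at the
  rate \<open>\<Gamma>\<close>. The function \<open>w\<close> is the spatial derivative of \<open>u\<close>.\<close>

locale weak_solution_setting =
  fixes \<beta> p l :: real and f u\<^sub>0 :: "real \<Rightarrow> real" and u :: "real \<Rightarrow> real \<Rightarrow> real"
  assumes \<beta>: "0 < \<beta>" "\<beta> < 1" and p: "2 < p" and l: "0 < l" and f_nonneg: "\<And>s. 0 \<le> f s"
    and sol: "weak_solution \<beta> p l f u\<^sub>0 u"
begin

abbreviation I :: "real set" where "I \<equiv> {-l<..<l}"

definition w :: "real \<Rightarrow> real \<Rightarrow> real" where "w t = weak_derivative I (u t)"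
definition E :: "real \<Rightarrow> real" where "E t = (LINT x|lebesgue_on I. \<bar>w t x\<bar> powr p)"
definition absorption :: "real \<Rightarrow> real \<Rightarrow> real" where "absorption t x = singular_term \<beta> (u t x) + f (u t x)"
definition y :: "real \<Rightarrow> real" where "y t = (LINT x|lebesgue_on I. (u t x)\<^sup>2)"
definition \<Gamma> :: "real \<Rightarrow> real" where "\<Gamma> t = (LINT x|lebesgue_on I. \<bar>u t x\<bar> powr (1 - \<beta>))"
definition dist_L1 :: "real \<Rightarrow> real \<Rightarrow> real" where "dist_L1 r t = (LINT x|lebesgue_on I. \<bar>u r x - u t x\<bar>)"

lemma solD:
  "AE z in lebesgue_on (I \<times> {0<..}). case z of (x, t) \<Rightarrow> 0 \<le> u t x"
  "integrable (lebesgue_on (I \<times> {0<..})) (\<lambda>(x, t). f (u t x))"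
  "integrable (lebesgue_on (I \<times> {0<..})) (\<lambda>(x, t). singular_term \<beta> (u t x))"
  "u \<in> Lp_loc_Bochner p {0<..} (W1p_0 p I) (W1p_norm p I)"
  "(\<lambda>(x, t). u t x) \<in> Linf_loc (I \<times> {0<..}) (closure I \<times> {0<..})"
  "u \<in> C_L1 {0..} I"
  "\<And>\<phi>. test_function (I \<times> {0<..}) \<phi> \<Longrightarrow>
     (LINT t|lebesgue_on {0<..}. LINT x|lebesgue_on I.
        - u t x * deriv (\<lambda>s. \<phi> (x, s)) t
        + \<bar>w t x\<bar> powr (p - 2) * w t x * deriv (\<lambda>y. \<phi> (y, t)) x
        + singular_term \<beta> (u t x) * \<phi> (x, t)
        + f (u t x) * \<phi> (x, t)) = 0"
  using sol unfolding weak_solution_def Let_def w_def by auto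

lemma finite_I: "finite_measure (lebesgue_on I)"
  by (rule finite_measure_lebesgue_on) simp

lemma measure_I: "measure lebesgue I = 2 * l" "measure (lebesgue_on I) I = 2 * l"
  using l by (auto simp: measure_restrict_space)

lemma u_integrable: "0 \<le> t \<Longrightarrow> integrable (lebesgue_on I) (u t)"
  using solD(6) by (simp add: C_L1_def)

lemma u_measurable: "0 \<le> t \<Longrightarrow> u t \<in> borel_measurable (lebesgue_on I)"
  using u_integrable by (rule borel_measurable_integrable)

lemma u_continuous_L1: "0 < t \<Longrightarrow> ((\<lambda>r. dist_L1 r t) \<longlongrightarrow> 0) (at t)"
proof -
  assume t: "0 < t"
  have "((\<lambda>r. dist_L1 r t) \<longlongrightarrow> 0) (at t within {0..})"
    using solD(6) t by (simp add: C_L1_def dist_L1_def)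
  then have "((\<lambda>r. dist_L1 r t) \<longlongrightarrow> 0) (at t within {0<..})"
    by (rule tendsto_within_subset) auto
  then show ?thesis using at_within_open[of t "{0<..}"] t by simp
qed

lemma dist_L1_nonneg: "0 \<le> dist_L1 r t"
  unfolding dist_L1_def by (intro Bochner_Integration.integral_nonneg) simp

lemma dist_L1_triangle:
  assumes "0 \<le> r" "0 \<le> s" "0 \<le> t" shows "dist_L1 r t \<le> dist_L1 r s + dist_L1 t s"
proof -
  have i: "integrable (lebesgue_on I) (\<lambda>x. \<bar>u r x - u t x\<bar>)" if "0 \<le> r" "0 \<le> t" for r t
    using u_integrable[OF that(1)] u_integrable[OF that(2)] by auto
  have "dist_L1 r t \<le> (LINT x|lebesgue_on I. \<bar>u r x - u s x\<bar> + \<bar>u t x - u s x\<bar>)"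
    unfolding dist_L1_def using i assms by (intro Bochner_Integration.integral_mono) auto
  then show ?thesis unfolding dist_L1_def using i assms by simp
qed

text \<open>This is the Heine-Cantor theorem for the curve \<open>u\<close>, proved with a Lebesgue number of a covering.\<close>

lemma dist_L1_uniform:
  assumes a: "0 < a" and e: "0 < e"
  shows "\<exists>\<delta>>0. \<forall>r\<in>{a..b}. \<forall>t\<in>{a..b}. \<bar>r - t\<bar> < \<delta> \<longrightarrow> dist_L1 r t < e"
proof -
  have "\<exists>d>0. \<forall>r. \<bar>r - t\<bar> < d \<longrightarrow> dist_L1 r t < e / 2" if "t \<in> {a..b}" for t
  proof -
    have "0 < t" using that a by auto
    then have "\<forall>\<^sub>F r in at t. dist_L1 r t < e / 2"
      using e by (intro order_tendstoD(2)[OF u_continuous_L1]) auto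
    then obtain d where "0 < d" "\<And>r. r \<noteq> t \<Longrightarrow> dist r t < d \<Longrightarrow> dist_L1 r t < e / 2"
      by (auto simp: eventually_at)
    moreover have "dist_L1 t t < e / 2" using e by (simp add: dist_L1_def)
    ultimately show ?thesis by (metis dist_real_def)
  qed
  then obtain d where d: "\<And>t. t \<in> {a..b} \<Longrightarrow> 0 < d t" "\<And>t r. t \<in> {a..b} \<Longrightarrow> \<bar>r - t\<bar> < d t \<Longrightarrow> dist_L1 r t < e / 2"
    by metis
  have "{a..b} \<subseteq> \<Union> ((\<lambda>t. ball t (d t)) ` {a..b})" using d(1) by force
  have "\<exists>\<delta>>0. \<forall>x\<in>{a..b}. \<exists>G\<in>(\<lambda>t. ball t (d t)) ` {a..b}. ball x \<delta> \<subseteq> G"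
  proof -
    have op: "open G" if "G \<in> (\<lambda>t. ball t (d t)) ` {a..b}" for G using that by auto
    show ?thesis
      by (rule Heine_Borel_lemma[OF compact_Icc \<open>{a..b} \<subseteq> \<Union> ((\<lambda>t. ball t (d t)) ` {a..b})\<close> op]) (assumption, blast)
  qed
  then obtain \<delta> where \<delta>: "0 < \<delta>" "\<And>x. x \<in> {a..b} \<Longrightarrow> \<exists>G\<in>(\<lambda>t. ball t (d t)) ` {a..b}. ball x \<delta> \<subseteq> G"
    by blast
  have "dist_L1 r t < e" if rab: "r \<in> {a..b}" and tab: "t \<in> {a..b}" and rt: "\<bar>r - t\<bar> < \<delta>" for r t
  proof -
    obtain s where s: "s \<in> {a..b}" "ball t \<delta> \<subseteq> ball s (d s)" using \<delta>(2)[OF tab] by blast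
    have "t \<in> ball t \<delta>" "r \<in> ball t \<delta>" using \<delta>(1) rt by (auto simp: dist_real_def)
    then have "t \<in> ball s (d s)" "r \<in> ball s (d s)" using s(2) by blast+
    then have "\<bar>t - s\<bar> < d s" "\<bar>r - s\<bar> < d s" by (simp_all add: dist_real_def abs_minus_commute)
    then have "dist_L1 t s < e / 2" "dist_L1 r s < e / 2" using d(2) s(1) by auto
    then show ?thesis using dist_L1_triangle[of r s t] rab tab s a by auto
  qed
  then show ?thesis using \<delta>(1) by blast
qed

lemma u_nonneg: "0 < t \<Longrightarrow> AE x in lebesgue_on I. 0 \<le> u t x"
proof -
  assume t: "0 < t"
  have "AE t in lebesgue_on {0<..}. AE x in lebesgue_on I. 0 \<le> u t x"
    using AE_lebesgue_on_slice[OF solD(1)] by simp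
  then have "AE t in lebesgue_on {0<..<t + 1}. AE x in lebesgue_on I. u t x \<in> {0..}"
    using AE_lebesgue_on_subset[where T="{0<..}" and J="{0<..<t + 1}"] by (simp add: subset_iff)
  then have "AE x in lebesgue_on I. u t x \<in> {0..}"
  proof (rule closed_constraint_all_times[rotated 2])
    show "integrable (lebesgue_on I) (u r)" if "r \<in> {0<..<t + 1}" for r
      using that by (intro u_integrable) simp
    show "((\<lambda>s. LINT x|lebesgue_on I. \<bar>u s x - u r x\<bar>) \<longlongrightarrow> 0) (at r)" if "r \<in> {0<..<t + 1}" for r
      using u_continuous_L1[of r] that unfolding dist_L1_def by simp
  qed (use t in simp_all)
  then show ?thesis by simp
qed

lemma u_bounded:
  assumes a: "0 < a"
  shows "\<exists>C\<ge>0. \<forall>t\<in>{a..b}. AE x in lebesgue_on I. \<bar>u t x\<bar> \<le> C"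
proof -
  let ?K = "closure I \<times> {a/2..b + 1}"
  have "compact ?K" by (intro compact_Times compact_Icc) (simp add: compact_closure bounded_subset)
  moreover have "?K \<subseteq> closure I \<times> {0<..}" using a by auto
  ultimately obtain C where "AE z in lebesgue_on (I \<times> {0<..}). z \<in> ?K \<longrightarrow> \<bar>case z of (x, t) \<Rightarrow> u t x\<bar> \<le> C"
    using solD(5) unfolding Linf_loc_def by blast
  from AE_lebesgue_on_slice[OF this]
  have "AE t in lebesgue_on {0<..}. AE x in lebesgue_on I. (x, t) \<in> ?K \<longrightarrow> \<bar>u t x\<bar> \<le> C" by simp
  then have "AE t in lebesgue_on {a/2<..<b + 1}. AE x in lebesgue_on I. (x, t) \<in> ?K \<longrightarrow> \<bar>u t x\<bar> \<le> C"
    using AE_lebesgue_on_subset[where T="{0<..}" and J="{a/2<..<b + 1}"] a by (simp add: subset_iff)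
  then have ae: "AE t in lebesgue_on {a/2<..<b + 1}. AE x in lebesgue_on I. u t x \<in> {-max C 0..max C 0}"
    using AE_space
  proof eventually_elim
    case (elim t)
    show ?case using elim(1) AE_space
      by eventually_elim (use elim(2) closure_subset[of I] in \<open>auto simp: abs_le_iff\<close>)
  qed
  have "AE x in lebesgue_on I. \<bar>u t x\<bar> \<le> max C 0" if t: "t \<in> {a..b}" for t
  proof -
    have "AE x in lebesgue_on I. u t x \<in> {-max C 0..max C 0}"
    proof (rule closed_constraint_all_times[OF _ _ ae])
      show "integrable (lebesgue_on I) (u r)" if "r \<in> {a/2<..<b + 1}" for r
        using that a by (intro u_integrable) simp
      show "((\<lambda>s. LINT x|lebesgue_on I. \<bar>u s x - u r x\<bar>) \<longlongrightarrow> 0) (at r)" if "r \<in> {a/2<..<b + 1}" for r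
        using u_continuous_L1[of r] that a unfolding dist_L1_def by simp
    qed (use t a in simp_all)
    then show ?thesis by eventually_elim (auto simp: abs_le_iff)
  qed
  then show ?thesis by (intro exI[of _ "max C 0"]) auto
qed

section \<open>Regularity in time of the terms of the equation\<close>

lemma AE_W1p_0: "AE t in lebesgue_on {0<..}. u t \<in> W1p_0 p I"
  using solD(4) by (simp add: Lp_loc_Bochner_def)

lemma W1p_0_W1p: "g \<in> W1p_0 p I \<Longrightarrow> g \<in> W1p p I"
  by (simp add: W1p_0_def)

lemma w_Lp: "u t \<in> W1p_0 p I \<Longrightarrow> w t \<in> Lp_space p I"
  unfolding w_def by (rule W1p_weak_derivative(2)[OF W1p_0_W1p])

lemma AE_w_Lp: "AE t in lebesgue_on {0<..}. w t \<in> Lp_space p I"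
  using AE_W1p_0 by eventually_elim (rule w_Lp)

lemma E_nonneg: "0 \<le> E t" unfolding E_def by (rule Lp_integral_nonneg)

lemma weak_derivative_integral_le_norm:
  "(LINT x|lebesgue_on I. \<bar>weak_derivative I g x\<bar> powr p) \<le> W1p_norm p I g powr p"
proof -
  have "0 \<le> (LINT x|lebesgue_on I. \<bar>g x\<bar> powr p)" "0 \<le> (LINT x|lebesgue_on I. \<bar>weak_derivative I g x\<bar> powr p)"
    by (rule Lp_integral_nonneg)+
  then show ?thesis unfolding W1p_norm_def using p by (simp add: powr_powr)
qed

lemma weak_derivative_distance_le_norm:
  assumes "g \<in> W1p_0 p I" "h \<in> W1p_0 p I"
  shows "(LINT x|lebesgue_on I. \<bar>weak_derivative I g x - weak_derivative I h x\<bar> powr p)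
    \<le> W1p_norm p I (\<lambda>x. g x - h x) powr p"
proof -
  note gh = W1p_0_W1p[OF assms(1)] W1p_0_W1p[OF assms(2)]
  have m: "(\<lambda>x. weak_derivative I g x - weak_derivative I h x) \<in> borel_measurable (lebesgue_on I)"
    using W1p_weak_derivative(2)[OF gh(1)] W1p_weak_derivative(2)[OF gh(2)] by (auto simp: Lp_space_def)
  have m': "weak_derivative I (\<lambda>x. g x - h x) \<in> borel_measurable (lebesgue_on I)"
    by (rule borel_measurable_lebesgue_on_AE_cong[OF m]) (use weak_derivative_diff[OF gh] in \<open>auto elim: eventually_mono\<close>)
  have "(LINT x|lebesgue_on I. \<bar>weak_derivative I g x - weak_derivative I h x\<bar> powr p)
      = (LINT x|lebesgue_on I. \<bar>weak_derivative I (\<lambda>x. g x - h x) x\<bar> powr p)"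
    by (intro integral_cong_AE borel_measurable_abs_powr m m')
      (use weak_derivative_diff[OF gh] in \<open>eventually_elim, simp\<close>)
  also have "\<dots> \<le> W1p_norm p I (\<lambda>x. g x - h x) powr p" by (rule weak_derivative_integral_le_norm)
  finally show ?thesis .
qed

lemma gradient_strongly_measurable:
  "\<exists>\<sigma>. (\<forall>n::nat. simple_function (lebesgue_on {0<..}) (\<sigma> n)) \<and>
    (\<forall>n. \<forall>t\<in>{0<..}. \<sigma> n t \<in> Lp_space p I) \<and>
    (AE t in lebesgue_on {0<..}. (\<lambda>n. LINT x|lebesgue_on I. \<bar>\<sigma> n t x - w t x\<bar> powr p) \<longlonglongrightarrow> 0)"
proof -
  obtain s where s: "\<And>n::nat. simple_function (lebesgue_on {0<..}) (s n)" "\<And>n. s n ` {0<..} \<subseteq> W1p_0 p I"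
    "AE t in lebesgue_on {0<..}. (\<lambda>n. W1p_norm p I (\<lambda>x. s n t x - u t x)) \<longlonglongrightarrow> 0"
    using solD(4) unfolding Lp_loc_Bochner_def strongly_measurable_def by blast
  define \<sigma> where "\<sigma> n t = weak_derivative I (s n t)" for n t
  have "simple_function (lebesgue_on {0<..}) (\<sigma> n)" for n
    using simple_function_compose[OF s(1), of "weak_derivative I" n] by (simp add: \<sigma>_def[abs_def] o_def)
  moreover have "\<sigma> n t \<in> Lp_space p I" if "t \<in> {0<..}" for n t
    unfolding \<sigma>_def by (rule W1p_weak_derivative(2)[OF W1p_0_W1p]) (use s(2) that in blast)
  moreover have "AE t in lebesgue_on {0<..}. (\<lambda>n. LINT x|lebesgue_on I. \<bar>\<sigma> n t x - w t x\<bar> powr p) \<longlonglongrightarrow> 0"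
    using s(3) AE_W1p_0 AE_space
  proof eventually_elim
    case (elim t)
    have "(\<lambda>n. W1p_norm p I (\<lambda>x. s n t x - u t x) powr p) \<longlonglongrightarrow> 0 powr p"
      using elim(1) p by (intro tendsto_powr2 tendsto_const) (auto simp: W1p_norm_def)
    then have lim: "(\<lambda>n. W1p_norm p I (\<lambda>x. s n t x - u t x) powr p) \<longlonglongrightarrow> 0" by simp
    have st: "s n t \<in> W1p_0 p I" for n using s(2)[of n] elim(3) by auto
    show ?case
      by (rule tendsto_sandwich[OF _ _ tendsto_const lim])
        (use weak_derivative_distance_le_norm[OF st elim(2)] Lp_integral_nonneg in \<open>simp_all add: \<sigma>_def w_def\<close>)
  qed
  ultimately show ?thesis by blast
qed

lemma gradient_distance_measurable:
  assumes "c \<in> Lp_space p I"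
  shows "(\<lambda>t. LINT x|lebesgue_on I. \<bar>w t x - c x\<bar> powr p) \<in> borel_measurable (lebesgue_on {0<..})"
proof -
  obtain \<sigma> where \<sigma>: "\<And>n::nat. simple_function (lebesgue_on {0<..}) (\<sigma> n)"
    "\<And>n t. t \<in> {0<..} \<Longrightarrow> \<sigma> n t \<in> Lp_space p I"
    "AE t in lebesgue_on {0<..}. (\<lambda>n. LINT x|lebesgue_on I. \<bar>\<sigma> n t x - w t x\<bar> powr p) \<longlonglongrightarrow> 0"
    using gradient_strongly_measurable by blast
  show ?thesis
    by (rule borel_measurable_Lp_distance[OF \<sigma>(1,2) AE_w_Lp \<sigma>(3) assms]) (use p in auto)
qed

lemma E_measurable: "E \<in> borel_measurable (lebesgue_on {0<..})"
  using gradient_distance_measurable[OF Lp_zero] p unfolding E_def[abs_def] by simp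

lemma borel_measurable_lebesgue_on_Icc:
  "h \<in> borel_measurable (lebesgue_on {0<..}) \<Longrightarrow> 0 < a \<Longrightarrow> h \<in> borel_measurable (lebesgue_on {a..b})" for h :: "real \<Rightarrow> real"
  by (rule measurable_restrict_mono) auto

lemma E_integrable:
  assumes "0 < a" shows "integrable (lebesgue_on {a..b}) E"
proof (rule Bochner_Integration.integrable_bound)
  show "integrable (lebesgue_on {a..b}) (\<lambda>t. W1p_norm p I (u t) powr p)"
  proof -
    have "compact {a..b}" "{a..b} \<subseteq> {0<..}" using assms by auto
    then show ?thesis using solD(4) unfolding Lp_loc_Bochner_def by blast
  qed
  show "E \<in> borel_measurable (lebesgue_on {a..b})"
    by (rule borel_measurable_lebesgue_on_Icc[OF E_measurable assms])
  show "AE t in lebesgue_on {a..b}. norm (E t) \<le> norm (W1p_norm p I (u t) powr p)"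
    using weak_derivative_integral_le_norm E_nonneg by (simp add: E_def w_def)
qed

lemma gradient_modulus:
  assumes a: "0 < a" and \<epsilon>: "0 < \<epsilon>"
  shows "\<exists>\<kappa> \<delta> Z. integrable (lebesgue_on {a..b}) \<kappa> \<and> (\<forall>t. 0 \<le> \<kappa> t) \<and> (LINT t|lebesgue_on {a..b}. \<kappa> t) \<le> \<epsilon> \<and>
    0 < \<delta> \<and> negligible Z \<and>
    (\<forall>r\<in>{a..b} - Z. \<forall>t\<in>{a..b} - Z. \<bar>r - t\<bar> < \<delta> \<longrightarrow>
      (LINT x|lebesgue_on I. \<bar>w t x - w r x\<bar> powr p) \<le> \<kappa> r + \<kappa> t)"
proof -
  obtain \<sigma> where \<sigma>: "\<And>n::nat. simple_function (lebesgue_on {0<..}) (\<sigma> n)"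
    "\<And>n t. t \<in> {0<..} \<Longrightarrow> \<sigma> n t \<in> Lp_space p I"
    "AE t in lebesgue_on {0<..}. (\<lambda>n. LINT x|lebesgue_on I. \<bar>\<sigma> n t x - w t x\<bar> powr p) \<longlonglongrightarrow> 0"
    using gradient_strongly_measurable by blast
  have sub: "{a..b} \<subseteq> {0<..}" using a by auto
  show ?thesis
  proof (rule Bochner_modulus_of_continuity[OF _ _ _ _ _ _ \<epsilon>])
    show "simple_function (lebesgue_on {a..b}) (\<sigma> n)" for n
      by (rule simple_function_lebesgue_on_subset[OF \<sigma>(1) sub]) simp
    show "\<sigma> n t \<in> Lp_space p I" if "t \<in> {a..b}" for n t using \<sigma>(2) that sub by blast
    show "AE t in lebesgue_on {a..b}. w t \<in> Lp_space p I"
      by (rule AE_lebesgue_on_subset[OF AE_w_Lp sub]) simp_all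
    show "AE t in lebesgue_on {a..b}. (\<lambda>n. LINT x|lebesgue_on I. \<bar>\<sigma> n t x - w t x\<bar> powr p) \<longlonglongrightarrow> 0"
      by (rule AE_lebesgue_on_subset[OF \<sigma>(3) sub]) simp_all
    show "integrable (lebesgue_on {a..b}) (\<lambda>t. LINT x|lebesgue_on I. \<bar>w t x\<bar> powr p)"
      using E_integrable[OF a] unfolding E_def[abs_def] .
  qed (use p in simp)
qed

lemma absorption_nonneg: "0 \<le> absorption t x"
  using f_nonneg by (simp add: absorption_def singular_term_def)

lemma absorption_integrable_Q: "integrable (lebesgue_on (I \<times> {0<..})) (\<lambda>(x, t). absorption t x)"
  using Bochner_Integration.integrable_add[OF solD(3) solD(2)]
  by (simp add: absorption_def case_prod_unfold)

lemma absorption_slices: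
  "AE t in lebesgue_on {0<..}. integrable (lebesgue_on I) (absorption t)"
  "integrable (lebesgue_on {0<..}) (\<lambda>t. LINT x|lebesgue_on I. absorption t x)"
  using integrable_lebesgue_on_slice[OF absorption_integrable_Q] by auto

lemma absorption_pairing_integrable:
  assumes \<zeta>: "test_function I \<zeta>"
  shows "integrable (lebesgue_on {0<..}) (\<lambda>t. LINT x|lebesgue_on I. absorption t x * \<zeta> x)"
proof -
  obtain B where B: "\<And>x. \<bar>\<zeta> x\<bar> \<le> B" using test_function_bounded[OF \<zeta>] by metis
  have c: "continuous_on UNIV (\<lambda>z::real \<times> real. \<zeta> (fst z))"
    using test_function_continuous[OF \<zeta>, of UNIV] by (rule continuous_on_compose2) (auto intro!: continuous_intros)
  have "integrable (lebesgue_on (I \<times> {0<..})) (\<lambda>z. (case z of (x, t) \<Rightarrow> absorption t x) * \<zeta> (fst z))"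
    by (intro integrable_mult_bounded[where B=B] absorption_integrable_Q AE_I2 B
        borel_measurable_lebesgue_on_continuous c)
  then have "integrable (lebesgue_on (I \<times> {0<..})) (\<lambda>(x, t). absorption t x * \<zeta> x)"
    by (simp add: case_prod_unfold)
  from integrable_lebesgue_on_slice(2)[OF this] show ?thesis by simp
qed

definition flux_pairing :: "(real \<Rightarrow> real) \<Rightarrow> real \<Rightarrow> real" where
  "flux_pairing z t = (LINT x|lebesgue_on I. \<bar>w t x\<bar> powr (p - 2) * w t x * z x)"

lemma flux_pairing_measurable:
  assumes \<zeta>: "test_function I \<zeta>"
  shows "flux_pairing \<zeta> \<in> borel_measurable (lebesgue_on {0<..})"
proof -
  obtain Z where Z: "\<And>x. \<bar>\<zeta> x\<bar> \<le> Z" using test_function_bounded[OF \<zeta>] by metis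
  have zm: "\<zeta> \<in> borel_measurable (lebesgue_on I)"
    by (rule borel_measurable_lebesgue_on_continuous[OF test_function_continuous[OF \<zeta>]])
  have Il: "I \<in> lmeasurable" by simp
  have p1: "1 < p" using p by simp
  let ?q = "\<lambda>n t. (real (Suc n) * ((LINT x|lebesgue_on I. \<bar>w t x - (- \<zeta> x / real (Suc n))\<bar> powr p) - E t)) / p"
  show ?thesis
  proof (rule borel_measurable_lebesgue_on_AE_LIMSEQ)
    show "?q n \<in> borel_measurable (lebesgue_on {0<..})" for n
    proof -
      have "(\<lambda>x. - \<zeta> x / real (Suc n)) \<in> Lp_space p I"
        by (rule bounded_Lp_space_divide[OF zm Z Il]) (use p in simp)
      from gradient_distance_measurable[OF this] E_measurable show ?thesis by measurable
    qed
    show "AE t in lebesgue_on {0<..}. (\<lambda>n. ?q n t) \<longlonglongrightarrow> flux_pairing \<zeta> t"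
      using AE_w_Lp
    proof eventually_elim
      case (elim t)
      from tendsto_divide[OF flux_pairing_limit(1)[OF elim zm Z Il p1] tendsto_const[of p]] p
      show ?case unfolding E_def flux_pairing_def by simp
    qed
  qed simp
qed

lemma flux_pairing_integrable:
  assumes \<zeta>: "test_function I \<zeta>" and a: "0 < a"
  shows "integrable (lebesgue_on {a..b}) (flux_pairing \<zeta>)"
proof -
  obtain Z where Z: "\<And>x. \<bar>\<zeta> x\<bar> \<le> Z" using test_function_bounded[OF \<zeta>] by metis
  have zm: "\<zeta> \<in> borel_measurable (lebesgue_on I)"
    by (rule borel_measurable_lebesgue_on_continuous[OF test_function_continuous[OF \<zeta>]])
  have Il: "I \<in> lmeasurable" by simp
  have p1: "1 < p" using p by simp
  show ?thesis
  proof (rule Bochner_Integration.integrable_bound)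
    show "integrable (lebesgue_on {a..b}) (\<lambda>t. Z * (2 * l + E t))" using E_integrable[OF a] by auto
    show "flux_pairing \<zeta> \<in> borel_measurable (lebesgue_on {a..b})"
      by (rule borel_measurable_lebesgue_on_Icc[OF flux_pairing_measurable[OF \<zeta>] a])
    have "AE t in lebesgue_on {a..b}. w t \<in> Lp_space p I"
      by (rule AE_lebesgue_on_subset[OF AE_w_Lp]) (use a in auto)
    then show "AE t in lebesgue_on {a..b}. norm (flux_pairing \<zeta> t) \<le> norm (Z * (2 * l + E t))"
    proof eventually_elim
      case (elim t)
      from flux_pairing_limit(3)[OF elim zm Z Il p1] show ?case
        unfolding measure_I flux_pairing_def E_def by (simp add: order_trans[OF _ abs_ge_self])
    qed
  qed
qed

text \<open>By \<open>increment_test_function\<close> below, this is the rate at which the integral of \<open>u t\<close> against \<open>\<zeta>\<close>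
  decreases.\<close>

definition rate :: "(real \<Rightarrow> real) \<Rightarrow> real \<Rightarrow> real" where
  "rate \<zeta> t = flux_pairing (deriv \<zeta>) t + (LINT x|lebesgue_on I. absorption t x * \<zeta> x)"

lemma rate_integrable:
  assumes \<zeta>: "test_function I \<zeta>" and a: "0 < a"
  shows "integrable (lebesgue_on {a..b}) (rate \<zeta>)"
proof -
  have "integrable (lebesgue_on {a..b}) (\<lambda>t. LINT x|lebesgue_on I. absorption t x * \<zeta> x)"
    by (rule integrable_lebesgue_on_subset[OF absorption_pairing_integrable[OF \<zeta>]]) (use a in auto)
  then show ?thesis unfolding rate_def[abs_def]
    using flux_pairing_integrable[OF test_function_deriv[OF \<zeta>] a] by (intro Bochner_Integration.integrable_add)
qed

text \<open>Testing with a product of a function of \<open>x\<close> and a function of \<open>t\<close> shows that the pairing of the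
  solution with a fixed test function is absolutely continuous in time.\<close>

lemma increment_test_function:
  assumes \<zeta>: "test_function I \<zeta>" and ab: "0 < a" "a \<le> b"
  shows "(LINT x|lebesgue_on I. u b x * \<zeta> x) - (LINT x|lebesgue_on I. u a x * \<zeta> x) = - integral {a..b} (rate \<zeta>)"
proof (rule increment_of_weak_derivative_in_time[OF _ rate_integrable[OF \<zeta>] _ ab])
  obtain B where B: "\<And>x. \<bar>\<zeta> x\<bar> \<le> B" "0 \<le> B" using test_function_bounded[OF \<zeta>] by metis
  have zm: "\<zeta> \<in> borel_measurable (lebesgue_on I)"
    by (rule borel_measurable_lebesgue_on_continuous[OF test_function_continuous[OF \<zeta>]])
  have u\<zeta>: "integrable (lebesgue_on I) (\<lambda>x. u t x * \<zeta> x)" if "0 < t" for t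
    using that by (intro integrable_mult_bounded[OF u_integrable zm AE_I2[OF B(1)]]) simp
  define U where "U t = (LINT x|lebesgue_on I. u t x * \<zeta> x)" for t
  have Udiff: "\<bar>U r - U t\<bar> \<le> B * dist_L1 r t" if "0 < r" "0 < t" for r t
  proof -
    have i: "integrable (lebesgue_on I) (\<lambda>x. \<bar>u r x - u t x\<bar>)" using that u_integrable by auto
    have "U r - U t = (LINT x|lebesgue_on I. (u r x - u t x) * \<zeta> x)"
      unfolding U_def using u\<zeta> that by (simp add: left_diff_distrib)
    also have "\<bar>\<dots>\<bar> \<le> (LINT x|lebesgue_on I. \<bar>(u r x - u t x) * \<zeta> x\<bar>)" by (rule integral_abs_bound)
    also have "\<dots> \<le> (LINT x|lebesgue_on I. B * \<bar>u r x - u t x\<bar>)"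
    proof (rule Bochner_Integration.integral_mono)
      show "integrable (lebesgue_on I) (\<lambda>x. \<bar>(u r x - u t x) * \<zeta> x\<bar>)"
        using u\<zeta> that by (intro integrable_abs) (simp add: left_diff_distrib)
      show "integrable (lebesgue_on I) (\<lambda>x. B * \<bar>u r x - u t x\<bar>)" using i by simp
      show "\<bar>(u r x - u t x) * \<zeta> x\<bar> \<le> B * \<bar>u r x - u t x\<bar>" for x
        using mult_left_mono[OF B(1)[of x], of "\<bar>u r x - u t x\<bar>"] by (simp add: abs_mult mult.commute)
    qed
    finally show ?thesis by (simp add: dist_L1_def)
  qed
  have Ucont: "continuous_on {0<..} U"
  proof (rule continuous_at_imp_continuous_on, rule ballI)
    fix t :: real assume "t \<in> {0<..}"
    then have t: "0 < t" by simp
    have "((\<lambda>r. B * dist_L1 r t) \<longlongrightarrow> B * 0) (at t)" by (intro tendsto_intros u_continuous_L1 t)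
    then have g: "((\<lambda>r. B * dist_L1 r t) \<longlongrightarrow> 0) (at t)" by simp
    have "((\<lambda>r. U r - U t) \<longlongrightarrow> 0) (at t)"
    proof (rule Lim_null_comparison[OF _ g])
      have "\<forall>\<^sub>F r in at t. r \<in> {0<..}" using t by (intro eventually_at_in_open') auto
      then show "\<forall>\<^sub>F r in at t. norm (U r - U t) \<le> B * dist_L1 r t"
        by eventually_elim (use Udiff t in simp)
    qed
    then show "isCont U t" unfolding isCont_def by (rule LIM_zero_cancel)
  qed
  show "continuous_on {0<..} (\<lambda>t. LINT x|lebesgue_on I. u t x * \<zeta> x)"
    using Ucont unfolding U_def[abs_def] .
  fix \<theta> :: "real \<Rightarrow> real" assume \<theta>: "test_function {0<..} \<theta>"
  have "test_function (I \<times> {0<..}) (\<lambda>z. \<zeta> (fst z) * \<theta> (snd z))" by (rule test_function_tensor[OF \<zeta> \<theta>])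
  from solD(7)[OF this]
  have weak: "(LINT t|lebesgue_on {0<..}. LINT x|lebesgue_on I.
        - u t x * deriv (\<lambda>s. \<zeta> x * \<theta> s) t
        + \<bar>w t x\<bar> powr (p - 2) * w t x * deriv (\<lambda>y. \<zeta> y * \<theta> t) x
        + singular_term \<beta> (u t x) * (\<zeta> x * \<theta> t) + f (u t x) * (\<zeta> x * \<theta> t)) = 0" by simp
  obtain Z where Z: "\<And>x. \<bar>deriv \<zeta> x\<bar> \<le> Z" using test_function_bounded[OF test_function_deriv[OF \<zeta>]] by metis
  have dzm: "deriv \<zeta> \<in> borel_measurable (lebesgue_on I)"
    by (rule borel_measurable_lebesgue_on_continuous[OF test_function_continuous[OF test_function_deriv[OF \<zeta>]]])
  have d: "deriv (\<lambda>s. \<zeta> x * \<theta> s) t = \<zeta> x * deriv \<theta> t" "deriv (\<lambda>y. \<zeta> y * \<theta> t) x = deriv \<zeta> x * \<theta> t" for x t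
    by (auto intro!: DERIV_imp_deriv DERIV_cmult DERIV_cmult_right test_function_DERIV[OF \<zeta>] test_function_DERIV[OF \<theta>])
  have inner: "AE t in lebesgue_on {0<..}. (LINT x|lebesgue_on I.
        - u t x * deriv (\<lambda>s. \<zeta> x * \<theta> s) t
        + \<bar>w t x\<bar> powr (p - 2) * w t x * deriv (\<lambda>y. \<zeta> y * \<theta> t) x
        + singular_term \<beta> (u t x) * (\<zeta> x * \<theta> t) + f (u t x) * (\<zeta> x * \<theta> t)) = - U t * deriv \<theta> t + rate \<zeta> t * \<theta> t"
    using AE_w_Lp absorption_slices(1) AE_space
  proof eventually_elim
    case (elim t)
    then have t: "0 < t" by simp
    have i1: "integrable (lebesgue_on I) (\<lambda>x. \<bar>w t x\<bar> powr (p - 2) * w t x * deriv \<zeta> x)"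
      by (rule flux_pairing_limit(2)[OF elim(1) dzm Z]) (use p in auto)
    have i2: "integrable (lebesgue_on I) (\<lambda>x. absorption t x * \<zeta> x)"
      by (rule integrable_mult_bounded[OF elim(2) zm AE_I2[OF B(1)]])
    have "(LINT x|lebesgue_on I.
        - u t x * deriv (\<lambda>s. \<zeta> x * \<theta> s) t
        + \<bar>w t x\<bar> powr (p - 2) * w t x * deriv (\<lambda>y. \<zeta> y * \<theta> t) x
        + singular_term \<beta> (u t x) * (\<zeta> x * \<theta> t) + f (u t x) * (\<zeta> x * \<theta> t))
      = (LINT x|lebesgue_on I. (u t x * \<zeta> x) * (- deriv \<theta> t)
        + ((\<bar>w t x\<bar> powr (p - 2) * w t x * deriv \<zeta> x) * \<theta> t + (absorption t x * \<zeta> x) * \<theta> t))"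
      unfolding d absorption_def by (intro Bochner_Integration.integral_cong) (auto simp: algebra_simps)
    also have "\<dots> = U t * (- deriv \<theta> t) + (flux_pairing (deriv \<zeta>) t * \<theta> t
        + (LINT x|lebesgue_on I. absorption t x * \<zeta> x) * \<theta> t)"
      unfolding U_def flux_pairing_def using u\<zeta>[OF t] i1 i2 by simp
    finally show ?case by (simp add: rate_def algebra_simps)
  qed
  have "continuous_on {0<..} U" by (rule Ucont)
  then have "U \<in> borel_measurable (lebesgue_on {0<..})"
    by (rule continuous_imp_measurable_on_sets_lebesgue) simp
  moreover have "deriv \<theta> \<in> borel_measurable (lebesgue_on {0<..})" "\<theta> \<in> borel_measurable (lebesgue_on {0<..})"
    by (intro borel_measurable_lebesgue_on_continuous test_function_continuous[OF \<theta>]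
        test_function_continuous[OF test_function_deriv[OF \<theta>]])+
  moreover have "rate \<zeta> \<in> borel_measurable (lebesgue_on {0<..})"
    unfolding rate_def[abs_def]
    by (intro borel_measurable_add flux_pairing_measurable test_function_deriv \<zeta>
        borel_measurable_integrable[OF absorption_pairing_integrable[OF \<zeta>]])
  ultimately have R: "(\<lambda>t. - U t * deriv \<theta> t + rate \<zeta> t * \<theta> t) \<in> borel_measurable (lebesgue_on {0<..})"
    by measurable
  have inner': "AE t in lebesgue_on {0<..}. - U t * deriv \<theta> t + rate \<zeta> t * \<theta> t = (LINT x|lebesgue_on I.
        - u t x * deriv (\<lambda>s. \<zeta> x * \<theta> s) t
        + \<bar>w t x\<bar> powr (p - 2) * w t x * deriv (\<lambda>y. \<zeta> y * \<theta> t) x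
        + singular_term \<beta> (u t x) * (\<zeta> x * \<theta> t) + f (u t x) * (\<zeta> x * \<theta> t))"
    using inner by eventually_elim simp
  have "(LINT t|lebesgue_on {0<..}. - U t * deriv \<theta> t + rate \<zeta> t * \<theta> t) = 0"
    by (rule trans[OF integral_cong_AE[OF R borel_measurable_lebesgue_on_AE_cong[OF R inner'] inner'] weak]) simp
  then show "(LINT t|lebesgue_on {0<..}. - (LINT x|lebesgue_on I. u t x * \<zeta> x) * deriv \<theta> t + rate \<zeta> t * \<theta> t) = 0"
    unfolding U_def .
qed

section \<open>The energy inequality\<close>

lemma u_sq_integrable:
  assumes t: "0 < t" shows "integrable (lebesgue_on I) (\<lambda>x. (u t x)\<^sup>2)"
proof -
  obtain C where C: "AE x in lebesgue_on I. \<bar>u t x\<bar> \<le> C"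
    using u_bounded[OF t, of t] by auto
  then show ?thesis
    using integrable_mult_bounded[OF u_integrable[of t] u_measurable[of t] C] t by (simp add: power2_eq_square)
qed

lemma u_prod_integrable:
  assumes s: "0 < s" and t: "0 < t" shows "integrable (lebesgue_on I) (\<lambda>x. u s x * u t x)"
proof -
  obtain C where C: "AE x in lebesgue_on I. \<bar>u t x\<bar> \<le> C"
    using u_bounded[OF t, of t] by auto
  then show ?thesis using integrable_mult_bounded[OF u_integrable[of s] u_measurable[of t] C] s t by simp
qed

lemma u_powr_integrable:
  assumes t: "0 < t" shows "integrable (lebesgue_on I) (\<lambda>x. \<bar>u t x\<bar> powr (1 - \<beta>))"
proof (rule Bochner_Integration.integrable_bound)
  interpret finite_measure "lebesgue_on I" by (rule finite_I)
  show "integrable (lebesgue_on I) (\<lambda>x. 1 + \<bar>u t x\<bar>)" using u_integrable[of t] t by auto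
  show "(\<lambda>x. \<bar>u t x\<bar> powr (1 - \<beta>)) \<in> borel_measurable (lebesgue_on I)"
    by (rule borel_measurable_abs_powr[OF u_measurable]) (use t in simp)
  show "AE x in lebesgue_on I. norm (\<bar>u t x\<bar> powr (1 - \<beta>)) \<le> norm (1 + \<bar>u t x\<bar>)"
  proof (rule AE_I2)
    fix x
    show "norm (\<bar>u t x\<bar> powr (1 - \<beta>)) \<le> norm (1 + \<bar>u t x\<bar>)"
      using powr_mono2[of "1 - \<beta>" "\<bar>u t x\<bar>" 1] powr_mono[of "1 - \<beta>" 1 "\<bar>u t x\<bar>"] \<beta>
      by (cases "\<bar>u t x\<bar> \<le> 1") auto
  qed
qed

lemma u_dist_integrable:
  assumes "0 < s" "0 < t" shows "integrable (lebesgue_on I) (\<lambda>x. \<bar>u s x - u t x\<bar>)"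
  using u_integrable assms by auto

lemma continuous_on_if_dist_L1_bound:
  assumes a: "0 < a"
    and le: "\<And>e. 0 < e \<Longrightarrow> \<exists>K. \<forall>r\<in>{a..b}. \<forall>t\<in>{a..b}. \<bar>F r - F t\<bar> \<le> e + K * dist_L1 r t"
  shows "continuous_on {a..b} F"
  unfolding continuous_on_iff
proof (intro ballI allI impI)
  fix t e :: real assume t: "t \<in> {a..b}" and e: "0 < e"
  obtain K where K0: "\<forall>r\<in>{a..b}. \<forall>t\<in>{a..b}. \<bar>F r - F t\<bar> \<le> e / 2 + K * dist_L1 r t"
    using le[of "e / 2"] e by auto
  have K: "\<bar>F r - F t\<bar> \<le> e / 2 + K * dist_L1 r t" if "r \<in> {a..b}" for r
    using K0 that t by blast
  have "0 < e / (2 * (\<bar>K\<bar> + 1))" using e by simp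
  from dist_L1_uniform[OF a this, of b] obtain d where d: "0 < d"
    "\<And>r. r \<in> {a..b} \<Longrightarrow> \<bar>r - t\<bar> < d \<Longrightarrow> dist_L1 r t < e / (2 * (\<bar>K\<bar> + 1))" using t by blast
  have "dist (F r) (F t) < e" if r: "r \<in> {a..b}" "dist r t < d" for r
  proof -
    have "K * dist_L1 r t \<le> (\<bar>K\<bar> + 1) * dist_L1 r t" using dist_L1_nonneg by (intro mult_right_mono) auto
    also have "\<dots> < e / 2" using d(2)[of r] r by (simp add: dist_real_def field_simps)
    finally show ?thesis using K[OF r(1)] by (simp add: dist_real_def)
  qed
  then show "\<exists>d>0. \<forall>r\<in>{a..b}. dist r t < d \<longrightarrow> dist (F r) (F t) < e" using d(1) by blast
qed

lemma y_continuous: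
  assumes a: "0 < a" shows "continuous_on {a..b} y"
proof -
  obtain C where C: "0 \<le> C" "\<And>t. t \<in> {a..b} \<Longrightarrow> AE x in lebesgue_on I. \<bar>u t x\<bar> \<le> C"
    using u_bounded[OF a] by blast
  have le: "\<bar>y r - y t\<bar> \<le> 2 * C * dist_L1 r t" if rt: "r \<in> {a..b}" "t \<in> {a..b}" for r t
  proof -
    have pos: "0 < r" "0 < t" using rt a by auto
    have i: "integrable (lebesgue_on I) (\<lambda>x. (u r x)\<^sup>2 - (u t x)\<^sup>2)"
      using u_sq_integrable pos by auto
    have "y r - y t = (LINT x|lebesgue_on I. (u r x)\<^sup>2 - (u t x)\<^sup>2)"
      unfolding y_def using u_sq_integrable pos by simp
    also have "\<bar>\<dots>\<bar> \<le> (LINT x|lebesgue_on I. \<bar>(u r x)\<^sup>2 - (u t x)\<^sup>2\<bar>)" by (rule integral_abs_bound)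
    also have "\<dots> \<le> (LINT x|lebesgue_on I. 2 * C * \<bar>u r x - u t x\<bar>)"
    proof (rule integral_mono_AE[OF integrable_abs[OF i]])
      show "integrable (lebesgue_on I) (\<lambda>x. 2 * C * \<bar>u r x - u t x\<bar>)" using u_dist_integrable[OF pos] by simp
      show "AE x in lebesgue_on I. \<bar>(u r x)\<^sup>2 - (u t x)\<^sup>2\<bar> \<le> 2 * C * \<bar>u r x - u t x\<bar>"
        using C(2)[OF rt(1)] C(2)[OF rt(2)]
      proof eventually_elim
        case (elim x)
        have "(u r x)\<^sup>2 - (u t x)\<^sup>2 = (u r x + u t x) * (u r x - u t x)"
          by (simp add: power2_eq_square algebra_simps)
        moreover have "\<bar>u r x + u t x\<bar> * \<bar>u r x - u t x\<bar> \<le> 2 * C * \<bar>u r x - u t x\<bar>"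
          using elim by (intro mult_right_mono) auto
        ultimately show ?case by (simp add: abs_mult)
      qed
    qed
    finally show ?thesis by (simp add: dist_L1_def)
  qed
  show ?thesis
  proof (rule continuous_on_if_dist_L1_bound[OF a])
    fix e :: real assume "0 < e"
    then show "\<exists>K. \<forall>r\<in>{a..b}. \<forall>t\<in>{a..b}. \<bar>y r - y t\<bar> \<le> e + K * dist_L1 r t"
      using le by (intro exI[of _ "2 * C"] ballI) (simp add: add_increasing)
  qed
qed

lemma small_parameters:
  assumes "0 < e"
  shows "\<exists>\<delta> \<omega>. 0 < \<delta> \<and> 0 < \<omega> \<and> 2 * l * \<delta> powr (1 - \<beta>) + \<delta> powr (- \<beta>) * \<omega> \<le> e"
proof -
  define \<delta> where "\<delta> = (e / (4 * l)) powr (1 / (1 - \<beta>))"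
  define \<omega> where "\<omega> = \<delta> powr \<beta> * (e / 2)"
  have \<delta>: "0 < \<delta>" "\<delta> powr (1 - \<beta>) = e / (4 * l)"
    using assms l \<beta> by (auto simp: \<delta>_def powr_powr)
  have "\<delta> powr (- \<beta>) * \<omega> = e / 2"
    using \<delta>(1) by (simp add: \<omega>_def powr_minus)
  moreover have "2 * l * \<delta> powr (1 - \<beta>) = e / 2" using \<delta>(2) l by simp
  ultimately have "2 * l * \<delta> powr (1 - \<beta>) + \<delta> powr (- \<beta>) * \<omega> \<le> e" by linarith
  moreover have "0 < \<omega>" using \<delta>(1) assms by (simp add: \<omega>_def)
  ultimately show ?thesis using \<delta>(1) by blast
qed

lemma \<Gamma>_continuous:
  assumes a: "0 < a" shows "continuous_on {a..b} \<Gamma>"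
proof (rule continuous_on_if_dist_L1_bound[OF a])
  fix e :: real assume e: "0 < e"
  obtain \<delta> \<omega> where \<delta>: "0 < \<delta>" "0 < \<omega>" "2 * l * \<delta> powr (1 - \<beta>) + \<delta> powr (- \<beta>) * \<omega> \<le> e"
    using small_parameters[OF e] by blast
  have "\<bar>\<Gamma> r - \<Gamma> t\<bar> \<le> e + \<delta> powr (- \<beta>) * dist_L1 r t" if r: "r \<in> {a..b}" and t: "t \<in> {a..b}" for r t
  proof -
    interpret finite_measure "lebesgue_on I" by (rule finite_I)
    have pos: "0 < r" "0 < t" using r t a by auto
    note i = u_powr_integrable[OF pos(1)] u_powr_integrable[OF pos(2)]
    have "\<Gamma> r - \<Gamma> t = (LINT x|lebesgue_on I. \<bar>u r x\<bar> powr (1 - \<beta>) - \<bar>u t x\<bar> powr (1 - \<beta>))"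
      unfolding \<Gamma>_def using i by simp
    also have "\<bar>\<dots>\<bar> \<le> (LINT x|lebesgue_on I. \<bar>\<bar>u r x\<bar> powr (1 - \<beta>) - \<bar>u t x\<bar> powr (1 - \<beta>)\<bar>)" by (rule integral_abs_bound)
    also have "\<dots> \<le> (LINT x|lebesgue_on I. \<delta> powr (1 - \<beta>) + \<delta> powr (- \<beta>) * \<bar>u r x - u t x\<bar>)"
    proof (rule Bochner_Integration.integral_mono)
      show "integrable (lebesgue_on I) (\<lambda>x. \<bar>\<bar>u r x\<bar> powr (1 - \<beta>) - \<bar>u t x\<bar> powr (1 - \<beta>)\<bar>)"
        using i by auto
      show "integrable (lebesgue_on I) (\<lambda>x. \<delta> powr (1 - \<beta>) + \<delta> powr (- \<beta>) * \<bar>u r x - u t x\<bar>)"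
        using u_dist_integrable[OF pos] by auto
      fix x
      have "\<bar>\<bar>u r x\<bar> powr (1 - \<beta>) - \<bar>u t x\<bar> powr (1 - \<beta>)\<bar> \<le> \<delta> powr (1 - \<beta>) + \<delta> powr (- \<beta>) * \<bar>\<bar>u r x\<bar> - \<bar>u t x\<bar>\<bar>"
        by (rule powr_diff_le[OF \<beta> _ _ \<delta>(1)]) auto
      also have "\<delta> powr (- \<beta>) * \<bar>\<bar>u r x\<bar> - \<bar>u t x\<bar>\<bar> \<le> \<delta> powr (- \<beta>) * \<bar>u r x - u t x\<bar>"
        by (intro mult_left_mono abs_triangle_ineq3) simp
      finally show "\<bar>\<bar>u r x\<bar> powr (1 - \<beta>) - \<bar>u t x\<bar> powr (1 - \<beta>)\<bar> \<le> \<delta> powr (1 - \<beta>) + \<delta> powr (- \<beta>) * \<bar>u r x - u t x\<bar>"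
        by simp
    qed
    also have "\<dots> = 2 * l * \<delta> powr (1 - \<beta>) + \<delta> powr (- \<beta>) * dist_L1 r t"
      using u_dist_integrable[OF pos] measure_I by (simp add: dist_L1_def)
    finally have "\<bar>\<Gamma> r - \<Gamma> t\<bar> \<le> 2 * l * \<delta> powr (1 - \<beta>) + \<delta> powr (- \<beta>) * dist_L1 r t" .
    moreover have "0 \<le> \<delta> powr (- \<beta>) * \<omega>" using \<delta>(2) by simp
    ultimately show ?thesis using \<delta>(3) by linarith
  qed
  then show "\<exists>K. \<forall>r\<in>{a..b}. \<forall>t\<in>{a..b}. \<bar>\<Gamma> r - \<Gamma> t\<bar> \<le> e + K * dist_L1 r t" by blast
qed

text \<open>Here \<open>\<phi>\<close> approximates \<open>u t\<close>. The factor \<open>2 powr p\<close> stems from the triangle inequality with the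
  intermediate gradient \<open>w t\<close>.\<close>

lemma flux_pairing_coercive:
  assumes \<phi>: "test_function I \<phi>" and w: "w r \<in> Lp_space p I" "w t \<in> Lp_space p I"
    and e: "(LINT x|lebesgue_on I. \<bar>deriv \<phi> x - w t x\<bar> powr p) \<le> e"
    and k: "(LINT x|lebesgue_on I. \<bar>w r x - w t x\<bar> powr p) \<le> k"
  shows "E r / 2 - 2 powr (p - 1) * 2 powr p * (e + k) \<le> flux_pairing (deriv \<phi>) r"
proof -
  note d\<phi> = test_function_deriv[OF \<phi>]
  have \<phi>Lp: "deriv \<phi> \<in> Lp_space p I" using p by (intro test_function_Lp_space[OF d\<phi>]) auto
  obtain Z where Z: "\<And>x. \<bar>deriv \<phi> x\<bar> \<le> Z" using test_function_bounded[OF d\<phi>] by metis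
  have m: "deriv \<phi> \<in> borel_measurable (lebesgue_on I)" using \<phi>Lp by (simp add: Lp_space_def)
  have i1: "integrable (lebesgue_on I) (\<lambda>x. \<bar>w r x\<bar> powr (p - 2) * w r x * deriv \<phi> x)"
    by (rule flux_pairing_limit(2)[OF w(1) m Z]) (use p in auto)
  have i2: "integrable (lebesgue_on I) (\<lambda>x. \<bar>deriv \<phi> x - w r x\<bar> powr p)"
    using Lp_space_diff[OF \<phi>Lp w(1)] p by (simp add: Lp_space_def)
  have i3: "integrable (lebesgue_on I) (\<lambda>x. \<bar>w r x\<bar> powr p)" using w by (simp add: Lp_space_def)
  have "(LINT x|lebesgue_on I. \<bar>deriv \<phi> x - w r x\<bar> powr p) \<le> 2 powr p * (e + k)"
    by (rule order_trans[OF Lp_diff_integral_le[OF \<phi>Lp w] mult_left_mono[OF add_mono[OF e k]]]) (use p in auto)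
  then have "E r / 2 - 2 powr (p - 1) * 2 powr p * (e + k)
      \<le> E r / 2 - 2 powr (p - 1) * (LINT x|lebesgue_on I. \<bar>deriv \<phi> x - w r x\<bar> powr p)"
    using mult_left_mono[of _ _ "2 powr (p - 1)"] by (simp add: mult.assoc)
  also have "\<dots> = (LINT x|lebesgue_on I. \<bar>w r x\<bar> powr p / 2 - 2 powr (p - 1) * \<bar>deriv \<phi> x - w r x\<bar> powr p)"
    unfolding E_def using i2 i3 by simp
  also have "\<dots> \<le> flux_pairing (deriv \<phi>) r"
    unfolding flux_pairing_def using i1 i2 i3 p
    by (intro Bochner_Integration.integral_mono flux_coercive) auto
  finally show ?thesis .
qed

text \<open>Here \<open>\<phi>\<close> approximates \<open>u t\<close> uniformly, which matters since the absorption is merely integrable.\<close>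

lemma absorption_pairing_coercive:
  assumes \<phi>: "test_function I \<phi>" and rt: "0 < r" "0 < t" and G: "integrable (lebesgue_on I) (absorption r)"
    and e: "AE x in lebesgue_on I. \<bar>\<phi> x - u t x\<bar> \<le> e" and \<delta>: "0 < \<delta>"
  shows "\<Gamma> t - (2 * l * \<delta> powr (1 - \<beta>) + \<delta> powr (- \<beta>) * dist_L1 r t) - e * (LINT x|lebesgue_on I. absorption r x)
    \<le> (LINT x|lebesgue_on I. absorption r x * \<phi> x)"
proof -
  interpret finite_measure "lebesgue_on I" by (rule finite_I)
  obtain B where B: "\<And>x. \<bar>\<phi> x\<bar> \<le> B" using test_function_bounded[OF \<phi>] by metis
  have i: "integrable (lebesgue_on I) (\<lambda>x. absorption r x * \<phi> x)"
    by (intro integrable_mult_bounded[OF G _ AE_I2[OF B]] borel_measurable_lebesgue_on_continuous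
        test_function_continuous[OF \<phi>])
  note ints = u_powr_integrable[OF rt(2)] u_dist_integrable[OF rt] G
  have "\<Gamma> t - (2 * l * \<delta> powr (1 - \<beta>) + \<delta> powr (- \<beta>) * dist_L1 r t) - e * (LINT x|lebesgue_on I. absorption r x)
    = (LINT x|lebesgue_on I. \<bar>u t x\<bar> powr (1 - \<beta>) - (\<delta> powr (1 - \<beta>) + \<delta> powr (- \<beta>) * \<bar>u r x - u t x\<bar>) - e * absorption r x)"
    using ints measure_I by (simp add: \<Gamma>_def dist_L1_def)
  also have "\<dots> \<le> (LINT x|lebesgue_on I. absorption r x * \<phi> x)"
  proof (rule integral_mono_AE[OF _ i])
    show "integrable (lebesgue_on I) (\<lambda>x. \<bar>u t x\<bar> powr (1 - \<beta>) - (\<delta> powr (1 - \<beta>) + \<delta> powr (- \<beta>) * \<bar>u r x - u t x\<bar>) - e * absorption r x)"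
      using ints by auto
    show "AE x in lebesgue_on I. \<bar>u t x\<bar> powr (1 - \<beta>) - (\<delta> powr (1 - \<beta>) + \<delta> powr (- \<beta>) * \<bar>u r x - u t x\<bar>) - e * absorption r x
        \<le> absorption r x * \<phi> x"
      using u_nonneg[OF rt(1)] u_nonneg[OF rt(2)] e
    proof eventually_elim
      case (elim x)
      have "u t x powr (1 - \<beta>) - \<delta> powr (1 - \<beta>) - \<delta> powr (- \<beta>) * \<bar>u r x - u t x\<bar> \<le> singular_term \<beta> (u r x) * u t x"
        by (rule singular_term_coercive[OF \<beta> elim(1,2) \<delta>])
      also have "\<dots> \<le> absorption r x * u t x"
        using elim(2) f_nonneg[of "u r x"] by (intro mult_right_mono) (auto simp: absorption_def)
      finally have 1: "u t x powr (1 - \<beta>) - \<delta> powr (1 - \<beta>) - \<delta> powr (- \<beta>) * \<bar>u r x - u t x\<bar> \<le> absorption r x * u t x" .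
      have "absorption r x * (u t x - e) \<le> absorption r x * \<phi> x"
        using elim(3) absorption_nonneg by (intro mult_left_mono) auto
      then have "absorption r x * u t x - e * absorption r x \<le> absorption r x * \<phi> x" by (simp add: algebra_simps)
      then show ?case using 1 elim(2) by simp
    qed
  qed
  finally show ?thesis .
qed

text \<open>This is the equation tested with \<open>u t\<close> on a short time interval ending at \<open>t\<close>. Since \<open>u t\<close> is not
  smooth, it is first approximated by test functions, uniformly and in the gradient. In the flux and
  in the absorption the solution still sits at the earlier time \<open>r\<close>; replacing it by its value at \<open>t\<close>
  costs the terms with \<open>\<kappa>\<close> and \<open>\<omega>\<close>.\<close>

lemma energy_step:
  fixes \<kappa> :: "real \<Rightarrow> real"
  defines "K \<equiv> 2 powr (p - 1) * 2 powr p"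
  assumes st: "0 < s" "s \<le> t" and ut: "u t \<in> W1p_0 p I"
    and \<kappa>: "integrable (lebesgue_on {s..t}) \<kappa>"
    and near: "AE r in lebesgue_on {s..t}. (LINT x|lebesgue_on I. \<bar>w r x - w t x\<bar> powr p) \<le> \<kappa> r + \<kappa> t"
    and near_L1: "\<And>r. r \<in> {s..t} \<Longrightarrow> dist_L1 r t \<le> \<omega>" and \<delta>: "0 < \<delta>"
  shows "(y t - y s) / 2 \<le> - integral {s..t} E / 2 + K * (integral {s..t} \<kappa> + (t - s) * \<kappa> t)
    - (t - s) * (\<Gamma> t - (2 * l * \<delta> powr (1 - \<beta>) + \<delta> powr (- \<beta>) * \<omega>))"
proof -
  let ?J = "lebesgue_on {s..t}"
  interpret J: finite_measure ?J by (rule finite_measure_lebesgue_on) simp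
  have t: "0 < t" using st by simp
  define c where "c = 2 * l * \<delta> powr (1 - \<beta>) + \<delta> powr (- \<beta>) * \<omega>"
  define g where "g r = (LINT x|lebesgue_on I. absorption r x)" for r
  define A where "A = (LINT x|lebesgue_on I. u t x * u t x - u s x * u t x)"
  define M where "M = K * (t - s) + integral {s..t} g + dist_L1 t s"
  have sub: "{s..t} \<subseteq> {0<..}" using st by auto
  have Ei: "integrable ?J E" by (rule E_integrable[OF st(1)])
  have gi: "integrable ?J g"
    unfolding g_def[abs_def] by (rule integrable_lebesgue_on_subset[OF absorption_slices(2) sub]) auto
  have HK: "(LINT r|?J. h r) = integral {s..t} h" if "integrable ?J h" for h :: "real \<Rightarrow> real"
    by (rule lebesgue_integral_eq_integral[OF that]) simp
  have length: "measure (lebesgue_on {s..t}) {s..t} = t - s"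
    using st by (simp add: measure_restrict_space)
  have yA: "(y t - y s) / 2 \<le> A"
  proof -
    note i = u_sq_integrable[OF t] u_sq_integrable[OF st(1)] u_prod_integrable[OF t t] u_prod_integrable[OF st(1) t]
    have "(y t - y s) / 2 = (LINT x|lebesgue_on I. ((u t x)\<^sup>2 - (u s x)\<^sup>2) / 2)"
      unfolding y_def using i by simp
    also have "\<dots> \<le> A" unfolding A_def
    proof (rule Bochner_Integration.integral_mono)
      show "integrable (lebesgue_on I) (\<lambda>x. ((u t x)\<^sup>2 - (u s x)\<^sup>2) / 2)" using i by auto
      show "integrable (lebesgue_on I) (\<lambda>x. u t x * u t x - u s x * u t x)" using i by auto
      show "((u t x)\<^sup>2 - (u s x)\<^sup>2) / 2 \<le> u t x * u t x - u s x * u t x" for x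
        using zero_le_power2[of "u t x - u s x"] by (simp add: power2_eq_square field_simps)
    qed
    finally show ?thesis .
  qed
  have bound: "A \<le> - integral {s..t} E / 2 + K * (integral {s..t} \<kappa> + (t - s) * \<kappa> t) - (t - s) * (\<Gamma> t - c) + e * M"
    if e: "0 < e" for e
  proof -
    obtain \<psi> where \<psi>: "\<And>n::nat. test_function I (\<psi> n)"
      and lim: "(\<lambda>n. LINT x|lebesgue_on I. \<bar>deriv (\<psi> n) x - w t x\<bar> powr p) \<longlonglongrightarrow> 0"
      and unif: "\<And>e. 0 < e \<Longrightarrow> \<forall>\<^sub>F n in sequentially. AE x in lebesgue_on I. \<bar>\<psi> n x - u t x\<bar> \<le> e"
      using W1p_0_approximation[OF ut _ l] p unfolding w_def by auto
    from eventually_conj[OF order_tendstoD(2)[OF lim e] unif[OF e]]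
    obtain n where n: "(LINT x|lebesgue_on I. \<bar>deriv (\<psi> n) x - w t x\<bar> powr p) < e"
      "AE x in lebesgue_on I. \<bar>\<psi> n x - u t x\<bar> \<le> e"
      by (auto simp: eventually_sequentially)
    define \<phi> where "\<phi> = \<psi> n"
    have \<phi>: "test_function I \<phi>" "(LINT x|lebesgue_on I. \<bar>deriv \<phi> x - w t x\<bar> powr p) \<le> e"
      "AE x in lebesgue_on I. \<bar>\<phi> x - u t x\<bar> \<le> e"
      using \<psi> n by (auto simp: \<phi>_def)
    obtain B where B: "\<And>x. \<bar>\<phi> x\<bar> \<le> B" using test_function_bounded[OF \<phi>(1)] by metis
    have u\<phi>: "integrable (lebesgue_on I) (\<lambda>x. u r x * \<phi> x)" if "0 < r" for r
      using that by (intro integrable_mult_bounded[OF u_integrable _ AE_I2[OF B]]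
          borel_measurable_lebesgue_on_continuous test_function_continuous[OF \<phi>(1)]) simp
    have "A \<le> (LINT x|lebesgue_on I. (u t x * \<phi> x - u s x * \<phi> x) + e * \<bar>u t x - u s x\<bar>)"
      unfolding A_def
    proof (rule integral_mono_AE)
      show "integrable (lebesgue_on I) (\<lambda>x. u t x * u t x - u s x * u t x)"
        using u_prod_integrable[OF t t] u_prod_integrable[OF st(1) t] by auto
      show "integrable (lebesgue_on I) (\<lambda>x. (u t x * \<phi> x - u s x * \<phi> x) + e * \<bar>u t x - u s x\<bar>)"
        using u\<phi>[OF t] u\<phi>[OF st(1)] u_dist_integrable[OF t st(1)] by auto
      show "AE x in lebesgue_on I. u t x * u t x - u s x * u t x \<le> (u t x * \<phi> x - u s x * \<phi> x) + e * \<bar>u t x - u s x\<bar>"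
        using \<phi>(3)
      proof eventually_elim
        case (elim x)
        have "(u t x - u s x) * (u t x - \<phi> x) \<le> \<bar>u t x - u s x\<bar> * \<bar>u t x - \<phi> x\<bar>"
          using abs_ge_self[of "(u t x - u s x) * (u t x - \<phi> x)"] by (simp add: abs_mult)
        also have "\<dots> \<le> \<bar>u t x - u s x\<bar> * e"
          using elim by (intro mult_left_mono) (auto simp: abs_minus_commute)
        finally show ?case by (simp add: algebra_simps)
      qed
    qed
    also have "\<dots> = ((LINT x|lebesgue_on I. u t x * \<phi> x) - (LINT x|lebesgue_on I. u s x * \<phi> x)) + e * dist_L1 t s"
      using u\<phi>[OF t] u\<phi>[OF st(1)] u_dist_integrable[OF t st(1)] by (simp add: dist_L1_def)
    also have "\<dots> = - integral {s..t} (rate \<phi>) + e * dist_L1 t s"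
      using increment_test_function[OF \<phi>(1) st] by simp
    finally have 1: "A \<le> - integral {s..t} (rate \<phi>) + e * dist_L1 t s" .
    let ?low = "\<lambda>r. E r / 2 - K * (e + (\<kappa> r + \<kappa> t)) + (\<Gamma> t - c - e * g r)"
    have lowi: "integrable ?J ?low" using Ei \<kappa> gi by auto
    have "(LINT r|?J. ?low r) \<le> (LINT r|?J. rate \<phi> r)"
    proof (rule integral_mono_AE[OF lowi rate_integrable[OF \<phi>(1) st(1)]])
      have "AE r in ?J. w r \<in> Lp_space p I" by (rule AE_lebesgue_on_subset[OF AE_w_Lp sub]) simp_all
      moreover have "AE r in ?J. integrable (lebesgue_on I) (absorption r)"
        by (rule AE_lebesgue_on_subset[OF absorption_slices(1) sub]) simp_all
      ultimately show "AE r in ?J. ?low r \<le> rate \<phi> r" using near AE_space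
      proof eventually_elim
        case (elim r)
        then have r: "r \<in> {s..t}" "0 < r" using st by auto
        have "E r / 2 - K * (e + (\<kappa> r + \<kappa> t)) \<le> flux_pairing (deriv \<phi>) r"
          unfolding K_def by (rule flux_pairing_coercive[OF \<phi>(1) elim(1) w_Lp[OF ut] \<phi>(2) elim(3)])
        moreover have "\<Gamma> t - c - e * g r \<le> (LINT x|lebesgue_on I. absorption r x * \<phi> x)"
        proof -
          have "\<delta> powr (- \<beta>) * dist_L1 r t \<le> \<delta> powr (- \<beta>) * \<omega>" by (intro mult_left_mono near_L1 r) simp
          then show ?thesis
            using absorption_pairing_coercive[OF \<phi>(1) r(2) t elim(2) \<phi>(3) \<delta>] unfolding c_def g_def by linarith
        qed
        ultimately show ?case unfolding rate_def by linarith
      qed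
    qed
    also have "(LINT r|?J. rate \<phi> r) = integral {s..t} (rate \<phi>)"
      by (rule HK[OF rate_integrable[OF \<phi>(1) st(1)]])
    also have "(LINT r|?J. ?low r) = integral {s..t} E / 2 - K * ((t - s) * e + (integral {s..t} \<kappa> + (t - s) * \<kappa> t))
        + ((t - s) * (\<Gamma> t - c) - e * integral {s..t} g)"
      using Ei \<kappa> gi by (simp add: length HK)
    finally show ?thesis using 1 unfolding M_def by (simp add: algebra_simps)
  qed
  have Mnn: "0 \<le> M"
  proof -
    have "0 \<le> (LINT r|?J. g r)"
      unfolding g_def by (intro Bochner_Integration.integral_nonneg absorption_nonneg)
    then show ?thesis unfolding M_def K_def using HK[OF gi] st dist_L1_nonneg by simp
  qed
  have "A \<le> - integral {s..t} E / 2 + K * (integral {s..t} \<kappa> + (t - s) * \<kappa> t) - (t - s) * (\<Gamma> t - c)"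
  proof (rule field_le_epsilon)
    fix e :: real assume "0 < e"
    then have "0 < e / (M + 1)" using Mnn by simp
    from bound[OF this] have "A \<le> - integral {s..t} E / 2 + K * (integral {s..t} \<kappa> + (t - s) * \<kappa> t)
        - (t - s) * (\<Gamma> t - c) + e / (M + 1) * M" .
    moreover have "e / (M + 1) * M \<le> e" using Mnn \<open>0 < e\<close> by (simp add: field_simps)
    ultimately show "A \<le> - integral {s..t} E / 2 + K * (integral {s..t} \<kappa> + (t - s) * \<kappa> t) - (t - s) * (\<Gamma> t - c) + e" by simp
  qed
  then show ?thesis using yA unfolding c_def by simp
qed

text \<open>After division by the length of the interval, \<open>energy_step\<close> bounds a difference quotient of a
  continuous function, namely of \<open>y\<close> corrected by primitives of \<open>E\<close> and of the error \<open>\<kappa>\<close>, almost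
  everywhere and with a uniform step size. All errors tend to zero with \<open>e\<close>.\<close>

lemma energy_inequality:
  assumes sb: "0 < s" "s \<le> b"
  shows "y b - y s \<le> - integral {s..b} E - 2 * integral {s..b} \<Gamma>"
proof -
  \<comment> \<open>Left difference quotients at \<open>s\<close> need some room to the left of \<open>s\<close>.\<close>
  define a where "a = s / 2"
  have a: "0 < a" "a < s" using sb by (auto simp: a_def)
  define K where "K = 2 powr (p - 1) * 2 powr p"
  have Knn: "0 \<le> K" by (simp add: K_def)
  have Ei: "E integrable_on {c..d}" if "0 < c" for c d
    by (rule integrable_on_lebesgue_on[OF E_integrable[OF that]]) simp
  have \<Gamma>i: "\<Gamma> integrable_on {s..b}" by (rule integrable_continuous_real[OF \<Gamma>_continuous[OF sb(1)]])
  have main: "(y b - y s) / 2 \<le> - integral {s..b} E / 2 - integral {s..b} \<Gamma> + e * (2 * K + (b - s))" if e: "0 < e" for e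
  proof -
    obtain \<kappa> \<delta>\<^sub>1 Z where \<kappa>: "integrable (lebesgue_on {a..b}) \<kappa>" "\<And>t. 0 \<le> \<kappa> t" "(LINT t|lebesgue_on {a..b}. \<kappa> t) \<le> e"
      and \<delta>\<^sub>1: "0 < \<delta>\<^sub>1" and Z: "negligible Z"
      and near: "\<And>r t. r \<in> {a..b} - Z \<Longrightarrow> t \<in> {a..b} - Z \<Longrightarrow> \<bar>r - t\<bar> < \<delta>\<^sub>1 \<Longrightarrow>
        (LINT x|lebesgue_on I. \<bar>w t x - w r x\<bar> powr p) \<le> \<kappa> r + \<kappa> t"
      using gradient_modulus[OF a(1) e, of b] by blast
    obtain \<delta> \<omega> where \<delta>: "0 < \<delta>" "0 < \<omega>" "2 * l * \<delta> powr (1 - \<beta>) + \<delta> powr (- \<beta>) * \<omega> \<le> e"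
      using small_parameters[OF e] by blast
    obtain \<delta>\<^sub>2 where \<delta>\<^sub>2: "0 < \<delta>\<^sub>2" "\<And>r t. r \<in> {a..b} \<Longrightarrow> t \<in> {a..b} \<Longrightarrow> \<bar>r - t\<bar> < \<delta>\<^sub>2 \<Longrightarrow> dist_L1 r t < \<omega>"
      using dist_L1_uniform[OF a(1) \<delta>(2), of b] by blast
    have \<kappa>i: "integrable (lebesgue_on {c..d}) \<kappa>" if "a \<le> c" "d \<le> b" for c d
      by (rule integrable_lebesgue_on_subset[OF \<kappa>(1)]) (use that in auto)
    have \<kappa>HK: "\<kappa> integrable_on {c..d}" if "a \<le> c" "d \<le> b" for c d
      by (rule integrable_on_lebesgue_on[OF \<kappa>i[OF that]]) simp
    \<comment> \<open>The integrals over short intervals in \<open>energy_step\<close> become increments of \<open>Y\<close>.\<close>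
    define Y where "Y t = y t / 2 + integral {a..t} E / 2 - K * integral {a..t} \<kappa>" for t
    define N where "N = Z \<union> {t \<in> {a..b}. u t \<notin> W1p_0 p I}"
    have "AE t in lebesgue_on {a..b}. u t \<in> W1p_0 p I"
      by (rule AE_lebesgue_on_subset[OF AE_W1p_0]) (use a in auto)
    then have N: "negligible N" using Z by (simp add: N_def AE_lebesgue_on_iff_negligible)
    have "Y b - Y s \<le> integral {s..b} (\<lambda>t. K * \<kappa> t - \<Gamma> t + e)"
    proof (rule increment_le_integral[OF _ a(2) sb(2) _ _ N])
      show "continuous_on {a..b} Y"
        unfolding Y_def[abs_def]
        by (intro continuous_intros y_continuous[OF a(1)] indefinite_integral_continuous_1 Ei[OF a(1)] \<kappa>HK) auto
      show "(\<lambda>t. K * \<kappa> t - \<Gamma> t + e) integrable_on {s..b}"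
        using \<kappa>HK[of s b] \<Gamma>i a by (intro Henstock_Kurzweil_Integration.integrable_add
            Henstock_Kurzweil_Integration.integrable_diff integrable_on_mult_right integrable_const_ivl) auto
      show "0 < min \<delta>\<^sub>1 \<delta>\<^sub>2" using \<delta>\<^sub>1 \<delta>\<^sub>2 by simp
      fix t k assume t: "t \<in> {s..b}" "t \<notin> N" and k: "0 < k" "k < min \<delta>\<^sub>1 \<delta>\<^sub>2" "a \<le> t - k"
      have tab: "t \<in> {a..b}" "0 < t - k" "t - k \<le> t" using t a k by auto
      have "AE r in lebesgue_on {t - k..t}. r \<notin> Z"
        by (subst AE_lebesgue_on_iff_negligible) (auto intro: negligible_subset[OF Z])
      then have near': "AE r in lebesgue_on {t - k..t}. (LINT x|lebesgue_on I. \<bar>w r x - w t x\<bar> powr p) \<le> \<kappa> r + \<kappa> t"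
        using AE_space
      proof eventually_elim
        case (elim r)
        have "(LINT x|lebesgue_on I. \<bar>w t x - w r x\<bar> powr p) \<le> \<kappa> r + \<kappa> t"
          by (rule near) (use elim t k tab in \<open>auto simp: N_def\<close>)
        then show ?case by (simp add: abs_minus_commute)
      qed
      have step: "(y t - y (t - k)) / 2 \<le> - integral {t - k..t} E / 2 + K * (integral {t - k..t} \<kappa> + (t - (t - k)) * \<kappa> t)
          - (t - (t - k)) * (\<Gamma> t - (2 * l * \<delta> powr (1 - \<beta>) + \<delta> powr (- \<beta>) * \<omega>))"
        unfolding K_def
      proof (rule energy_step[OF tab(2,3) _ \<kappa>i near' _ \<delta>(1)])
        show "u t \<in> W1p_0 p I" using t tab by (auto simp: N_def)
        show "dist_L1 r t \<le> \<omega>" if "r \<in> {t - k..t}" for r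
          using \<delta>\<^sub>2(2)[of r t] that tab k by force
      qed (use k t in auto)
      have split: "integral {a..t} h - integral {a..t - k} h = integral {t - k..t} h" if "h integrable_on {a..t}" for h :: "real \<Rightarrow> real"
        using Henstock_Kurzweil_Integration.integral_combine[OF k(3) tab(3) that] by simp
      have "Y t - Y (t - k) = (y t - y (t - k)) / 2 + integral {t - k..t} E / 2 - K * integral {t - k..t} \<kappa>"
        unfolding Y_def using split[OF Ei[OF a(1)]] split[OF \<kappa>HK[OF order_refl]] tab
        by (simp add: field_simps)
      also have "\<dots> \<le> k * (K * \<kappa> t - \<Gamma> t + (2 * l * \<delta> powr (1 - \<beta>) + \<delta> powr (- \<beta>) * \<omega>))"
        using step by (simp add: algebra_simps)
      also have "\<dots> \<le> k * (K * \<kappa> t - \<Gamma> t + e)"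
        using \<delta>(3) k(1) by (intro mult_left_mono) auto
      finally show "Y t - Y (t - k) \<le> k * (K * \<kappa> t - \<Gamma> t + e)" .
    qed
    also have "\<dots> = K * integral {s..b} \<kappa> - integral {s..b} \<Gamma> + e * (b - s)"
    proof (rule integral_unique)
      have "\<kappa> integrable_on {s..b}" using a by (intro \<kappa>HK) auto
      from has_integral_add[OF has_integral_diff[OF has_integral_mult_right[OF integrable_integral[OF this], of K]
            integrable_integral[OF \<Gamma>i]] has_integral_const_real[of e s b]]
      show "((\<lambda>t. K * \<kappa> t - \<Gamma> t + e) has_integral (K * integral {s..b} \<kappa> - integral {s..b} \<Gamma> + e * (b - s))) {s..b}"
        using sb by (simp add: mult.commute)
    qed
    finally have Yle: "Y b - Y s \<le> K * integral {s..b} \<kappa> - integral {s..b} \<Gamma> + e * (b - s)" .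
    have split: "integral {a..b} h - integral {a..s} h = integral {s..b} h" if "h integrable_on {a..b}" for h :: "real \<Rightarrow> real"
      using Henstock_Kurzweil_Integration.integral_combine[OF less_imp_le[OF a(2)] sb(2) that] by simp
    have Yeq: "Y b - Y s = (y b - y s) / 2 + integral {s..b} E / 2 - K * integral {s..b} \<kappa>"
      unfolding Y_def using split[OF Ei[OF a(1)]] split[OF \<kappa>HK[OF order_refl order_refl]]
      by (simp add: algebra_simps diff_divide_distrib)
    have "integral {s..b} \<kappa> \<le> integral {a..b} \<kappa>"
      using \<kappa>(2) a by (intro integral_subset_le \<kappa>HK) auto
    also have "\<dots> \<le> e" using \<kappa>(3) lebesgue_integral_eq_integral[OF \<kappa>(1)] by simp
    finally have "K * integral {s..b} \<kappa> \<le> K * e" using Knn by (rule mult_left_mono)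
    then show ?thesis using Yle Yeq by (simp add: algebra_simps)
  qed
  have "(y b - y s) / 2 \<le> - integral {s..b} E / 2 - integral {s..b} \<Gamma>"
  proof (rule field_le_epsilon)
    fix e :: real assume e: "0 < e"
    let ?M = "2 * K + (b - s)"
    have M: "0 \<le> ?M" using Knn sb by simp
    have "0 < e / (?M + 1)" using e M by simp
    from main[OF this] have "(y b - y s) / 2 \<le> - integral {s..b} E / 2 - integral {s..b} \<Gamma> + e / (?M + 1) * ?M" .
    moreover have "e / (?M + 1) * ?M \<le> e"
    proof -
      have "e * ?M \<le> e * (?M + 1)" using e by simp
      then show ?thesis using M by (simp add: pos_divide_le_eq)
    qed
    ultimately show "(y b - y s) / 2 \<le> - integral {s..b} E / 2 - integral {s..b} \<Gamma> + e" by linarith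
  qed
  then show ?thesis by simp
qed

section \<open>Interpolation and extinction\<close>

text \<open>The parameter of \<open>W1p_0_sup_le\<close> is chosen as \<open>E t powr (1 / p)\<close>, or arbitrarily small if \<open>E t\<close>
  vanishes.\<close>

lemma sup_le_E:
  assumes ut: "u t \<in> W1p_0 p I"
  shows "AE x in lebesgue_on I. \<bar>u t x\<bar> \<le> (2 * l + 2 + 2 powr p) * E t powr (1 / p)"
proof -
  have sup: "AE x in lebesgue_on I. \<bar>u t x\<bar> \<le> (2 * l + 2) * \<rho> + \<rho> powr (1 - p) * 2 powr p * E t" if "0 < \<rho>" for \<rho>
    using W1p_0_sup_le[OF ut _ l that] p unfolding E_def w_def by simp
  show ?thesis
  proof (cases "E t = 0")
    case True
    have "AE x in lebesgue_on I. \<forall>n. \<bar>u t x\<bar> \<le> (2 * l + 2) * (1 / real (Suc n))"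
      unfolding AE_all_countable
    proof
      fix n show "AE x in lebesgue_on I. \<bar>u t x\<bar> \<le> (2 * l + 2) * (1 / real (Suc n))"
        using sup[of "1 / real (Suc n)"] True by simp
    qed
    then show ?thesis
    proof eventually_elim
      case (elim x)
      have "(\<lambda>n. (2 * l + 2) * inverse (real (Suc n))) \<longlonglongrightarrow> (2 * l + 2) * 0"
        by (intro tendsto_mult tendsto_const LIMSEQ_inverse_real_of_nat)
      then have "\<bar>u t x\<bar> \<le> (2 * l + 2) * 0"
        by (rule LIMSEQ_le_const) (use elim in \<open>auto simp: inverse_eq_divide\<close>)
      then show ?case using True by simp
    qed
  next
    case False
    then have E: "0 < E t" using E_nonneg[of t] by simp
    let ?\<rho> = "E t powr (1 / p)"
    have "?\<rho> powr (1 - p) * E t = E t powr ((1 - p) / p + 1)"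
      using E by (simp add: powr_powr powr_add)
    also have "(1 - p) / p + 1 = 1 / p" using p by (simp add: field_simps)
    finally have eq: "?\<rho> powr (1 - p) * E t = ?\<rho>" .
    have "AE x in lebesgue_on I. \<bar>u t x\<bar> \<le> (2 * l + 2) * ?\<rho> + ?\<rho> powr (1 - p) * 2 powr p * E t"
      using E by (intro sup) simp
    then show ?thesis
    proof eventually_elim
      case (elim x)
      have "?\<rho> powr (1 - p) * 2 powr p * E t = 2 powr p * (?\<rho> powr (1 - p) * E t)" by (simp only: mult_ac)
      then show ?case using elim unfolding eq by (simp only: distrib_right)
    qed
  qed
qed

lemma y_nonneg: "0 \<le> y t"
  unfolding y_def by (intro Bochner_Integration.integral_nonneg) simp

lemma \<Gamma>_nonneg: "0 \<le> \<Gamma> t"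
  unfolding \<Gamma>_def by (rule Lp_integral_nonneg)

lemma y_le:
  assumes ut: "u t \<in> W1p_0 p I" and t: "0 < t"
  defines "M \<equiv> (2 * l + 2 + 2 powr p) * E t powr (1 / p)"
  shows "y t \<le> 2 * l * M\<^sup>2" and "y t \<le> M powr (1 + \<beta>) * \<Gamma> t"
proof -
  interpret finite_measure "lebesgue_on I" by (rule finite_I)
  have sup: "AE x in lebesgue_on I. \<bar>u t x\<bar> \<le> M" unfolding M_def by (rule sup_le_E[OF ut])
  have "y t \<le> (LINT x|lebesgue_on I. M\<^sup>2)" unfolding y_def
  proof (rule integral_mono_AE[OF u_sq_integrable[OF t]])
    show "AE x in lebesgue_on I. (u t x)\<^sup>2 \<le> M\<^sup>2"
      using sup by eventually_elim (metis abs_ge_zero power2_abs power_mono)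
  qed simp
  then show "y t \<le> 2 * l * M\<^sup>2" using measure_I by simp
  have "y t \<le> (LINT x|lebesgue_on I. M powr (1 + \<beta>) * \<bar>u t x\<bar> powr (1 - \<beta>))" unfolding y_def
  proof (rule integral_mono_AE[OF u_sq_integrable[OF t] integrable_mult_right[OF u_powr_integrable[OF t]]])
    show "AE x in lebesgue_on I. (u t x)\<^sup>2 \<le> M powr (1 + \<beta>) * \<bar>u t x\<bar> powr (1 - \<beta>)"
      using sup
    proof eventually_elim
      case (elim x)
      have "(u t x)\<^sup>2 = \<bar>u t x\<bar> powr (1 + \<beta>) * \<bar>u t x\<bar> powr (1 - \<beta>)"
        by (cases "u t x = 0") (simp_all flip: powr_add)
      also have "\<dots> \<le> M powr (1 + \<beta>) * \<bar>u t x\<bar> powr (1 - \<beta>)"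
        using elim \<beta> by (intro mult_right_mono powr_mono2) auto
      finally show ?case .
    qed
  qed
  then show "y t \<le> M powr (1 + \<beta>) * \<Gamma> t" by (simp add: \<Gamma>_def)
qed

definition C\<^sub>0 :: real where "C\<^sub>0 = 2 * l + 2 + 2 powr p"

definition \<theta> :: real where "\<theta> = p / (p + 1 + \<beta>)"

definition c :: real where "c = min ((2 * l * C\<^sub>0\<^sup>2) powr (- (p / 2))) (C\<^sub>0 powr (- (1 + \<beta>) * \<theta>))"

lemma C\<^sub>0_pos: "0 < C\<^sub>0" using l by (simp add: C\<^sub>0_def add_pos_nonneg)

lemma c_pos: "0 < c" using C\<^sub>0_pos l by (simp add: c_def)

text \<open>The power \<open>p / 2\<close> comes from the diffusion alone. For the power \<open>\<theta>\<close> the supremum bound by the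
  diffusion is combined with the absorption.\<close>

lemma dissipation_lower_bounds:
  assumes ut: "u t \<in> W1p_0 p I" and t: "0 < t"
  shows "c * y t powr (p / 2) \<le> E t + \<Gamma> t" and "c * y t powr \<theta> \<le> E t + \<Gamma> t"
proof -
  let ?D = "E t + \<Gamma> t"
  have D: "0 \<le> E t" "0 \<le> \<Gamma> t" "E t \<le> ?D" "\<Gamma> t \<le> ?D" using E_nonneg \<Gamma>_nonneg by auto
  have M2: "(C\<^sub>0 * E t powr (1 / p))\<^sup>2 = C\<^sub>0\<^sup>2 * E t powr (2 / p)"
    by (simp add: power_mult_distrib power2_eq_square flip: powr_add)
  have K: "0 < 2 * l * C\<^sub>0\<^sup>2" using C\<^sub>0_pos l by simp
  have "y t powr (p / 2) \<le> (2 * l * C\<^sub>0\<^sup>2 * E t powr (2 / p)) powr (p / 2)"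
    using y_le(1)[OF ut t] M2 y_nonneg p by (intro powr_mono2) (auto simp: C\<^sub>0_def)
  also have "\<dots> = (2 * l * C\<^sub>0\<^sup>2) powr (p / 2) * E t"
    using K p D(1) by (subst powr_mult) (auto simp: powr_powr)
  finally have "c * y t powr (p / 2) \<le> (2 * l * C\<^sub>0\<^sup>2) powr (- (p / 2)) * ((2 * l * C\<^sub>0\<^sup>2) powr (p / 2) * E t)"
    using K by (intro mult_mono) (auto simp: c_def)
  also have "\<dots> = E t"
  proof -
    have "(2 * l * C\<^sub>0\<^sup>2) powr (- (p / 2)) * (2 * l * C\<^sub>0\<^sup>2) powr (p / 2) = 1"
      unfolding powr_add[symmetric] using l C\<^sub>0_pos by simp
    then show ?thesis by (simp only: mult.assoc[symmetric] mult_1)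
  qed
  finally show "c * y t powr (p / 2) \<le> ?D" using D by linarith
  have \<theta>: "0 < \<theta>" "\<theta> * ((1 + \<beta>) / p + 1) = 1"
  proof -
    show "0 < \<theta>" using p \<beta> by (simp add: \<theta>_def)
    have "(1 + \<beta>) / p + 1 = (p + 1 + \<beta>) / p" using p by (simp add: field_simps)
    then show "\<theta> * ((1 + \<beta>) / p + 1) = 1" using p \<beta> by (simp add: \<theta>_def)
  qed
  have "y t \<le> (C\<^sub>0 * E t powr (1 / p)) powr (1 + \<beta>) * \<Gamma> t"
    using y_le(2)[OF ut t] by (simp add: C\<^sub>0_def)
  also have "\<dots> = C\<^sub>0 powr (1 + \<beta>) * (E t powr ((1 + \<beta>) / p) * \<Gamma> t)"
    using C\<^sub>0_pos by (simp add: powr_mult powr_powr)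
  also have "\<dots> \<le> C\<^sub>0 powr (1 + \<beta>) * (?D powr ((1 + \<beta>) / p) * ?D)"
    using D p \<beta> by (intro mult_left_mono mult_mono powr_mono2) auto
  also have "?D powr ((1 + \<beta>) / p) * ?D = ?D powr ((1 + \<beta>) / p + 1)"
    using D by (cases "?D = 0") (simp_all add: powr_add)
  finally have "y t powr \<theta> \<le> (C\<^sub>0 powr (1 + \<beta>) * ?D powr ((1 + \<beta>) / p + 1)) powr \<theta>"
    using y_nonneg \<theta> by (intro powr_mono2) auto
  also have "\<dots> = C\<^sub>0 powr ((1 + \<beta>) * \<theta>) * ?D"
    using D \<theta> by (simp add: powr_mult powr_powr mult.commute)
  finally have "c * y t powr \<theta> \<le> C\<^sub>0 powr (- (1 + \<beta>) * \<theta>) * (C\<^sub>0 powr ((1 + \<beta>) * \<theta>) * ?D)"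
    by (intro mult_mono) (auto simp: c_def)
  also have "\<dots> = ?D"
  proof -
    have "C\<^sub>0 powr (- (1 + \<beta>) * \<theta>) * C\<^sub>0 powr ((1 + \<beta>) * \<theta>) = C\<^sub>0 powr 0"
      unfolding powr_add[symmetric] by (simp add: algebra_simps)
    also have "\<dots> = 1" using C\<^sub>0_pos by simp
    finally show ?thesis by (simp only: mult.assoc[symmetric] mult_1)
  qed
  finally show "c * y t powr \<theta> \<le> ?D" .
qed

lemma E_integrable_on: "0 < s \<Longrightarrow> E integrable_on {s..b}"
  by (rule integrable_on_lebesgue_on[OF E_integrable]) simp_all

lemma \<Gamma>_integrable_on: "0 < s \<Longrightarrow> \<Gamma> integrable_on {s..b}"
  by (rule integrable_continuous_real[OF \<Gamma>_continuous])

lemma y_antimono: "0 < s \<Longrightarrow> s \<le> b \<Longrightarrow> y b \<le> y s"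
  using energy_inequality[of s b] Henstock_Kurzweil_Integration.integral_nonneg[OF E_integrable_on, of s b]
    Henstock_Kurzweil_Integration.integral_nonneg[OF \<Gamma>_integrable_on, of s b] E_nonneg \<Gamma>_nonneg by simp

text \<open>As \<open>y\<close> is nonincreasing, its value at \<open>b\<close> bounds the dissipation from below on all of \<open>{s..b}\<close>.\<close>

lemma y_decay:
  assumes sb: "0 < s" "s \<le> b" and e: "0 \<le> e"
    and low: "\<And>t. u t \<in> W1p_0 p I \<Longrightarrow> 0 < t \<Longrightarrow> c * y t powr e \<le> E t + \<Gamma> t"
  shows "y b + (b - s) * (c * y b powr e) \<le> y s"
proof -
  define N where "N = {t \<in> {s..b}. u t \<notin> W1p_0 p I}"
  have "AE t in lebesgue_on {s..b}. u t \<in> W1p_0 p I"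
    by (rule AE_lebesgue_on_subset[OF AE_W1p_0]) (use sb in auto)
  then have N: "negligible N" by (simp add: N_def AE_lebesgue_on_iff_negligible)
  let ?k = "c * y b powr e"
  have D: "(\<lambda>t. E t + \<Gamma> t) integrable_on {s..b}"
    by (intro Henstock_Kurzweil_Integration.integrable_add E_integrable_on \<Gamma>_integrable_on sb)
  have "(b - s) * ?k = integral {s..b} (\<lambda>t. ?k)" using sb by simp
  also have "\<dots> \<le> integral {s..b} (\<lambda>t. if t \<in> N then ?k else E t + \<Gamma> t)"
  proof (rule integral_le)
    show "(\<lambda>t. if t \<in> N then ?k else E t + \<Gamma> t) integrable_on {s..b}"
      by (rule integrable_spike[OF D N]) simp
    fix t assume t: "t \<in> {s..b}"
    show "?k \<le> (if t \<in> N then ?k else E t + \<Gamma> t)"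
    proof (cases "t \<in> N")
      case False
      then have ut: "u t \<in> W1p_0 p I" "0 < t" using t sb by (auto simp: N_def)
      have "y b \<le> y t" using t sb by (intro y_antimono) auto
      then have "c * y b powr e \<le> c * y t powr e"
        using c_pos y_nonneg e by (intro mult_left_mono powr_mono2) auto
      then show ?thesis using low[OF ut] False by simp
    qed simp
  qed (rule integrable_const_ivl)
  also have "\<dots> = integral {s..b} (\<lambda>t. E t + \<Gamma> t)" by (rule integral_spike[OF N]) simp
  also have "\<dots> = integral {s..b} E + integral {s..b} \<Gamma>"
    by (intro Henstock_Kurzweil_Integration.integral_add E_integrable_on \<Gamma>_integrable_on sb)
  finally have "(b - s) * ?k \<le> integral {s..b} E + 2 * integral {s..b} \<Gamma>"
    using Henstock_Kurzweil_Integration.integral_nonneg[OF \<Gamma>_integrable_on[OF sb(1)], of b] \<Gamma>_nonneg by simp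
  then show ?thesis using energy_inequality[OF sb] by simp
qed

lemma extinction:
  assumes t: "1 + 1 / (c * (1 - 2 powr (1 - p / 2))) + 1 / (c * (1 - 2 powr (\<theta> - 1))) \<le> t"
  shows "AE x in lebesgue_on I. u t x = 0"
proof -
  have \<theta>: "0 \<le> \<theta>" "\<theta> < 1" using p \<beta> by (auto simp: \<theta>_def)
  \<comment> \<open>The energy is known to be finite at positive times only; it is followed from time one on.\<close>
  have "y t = 0"
  proof (rule extinction_time[OF _ _ _ \<theta> c_pos _ t])
    show "y t + (t - s) * (c * y t powr (p / 2)) \<le> y s" if "1 \<le> s" "s \<le> t" for s t
      using that p by (intro y_decay dissipation_lower_bounds) auto
    show "y t + (t - s) * (c * y t powr \<theta>) \<le> y s" if "1 \<le> s" "s \<le> t" for s t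
      using that \<theta> by (intro y_decay dissipation_lower_bounds) auto
  qed (use p y_nonneg in auto)
  moreover have "0 < t"
  proof -
    have "0 < c * (1 - 2 powr (1 - p / 2))" "0 < c * (1 - 2 powr (\<theta> - 1))"
      using c_pos p \<theta> powr_less_mono[of "1 - p / 2" 0 2] powr_less_mono[of "\<theta> - 1" 0 2] by auto
    then have "0 \<le> 1 / (c * (1 - 2 powr (1 - p / 2)))" "0 \<le> 1 / (c * (1 - 2 powr (\<theta> - 1)))" by auto
    then show ?thesis using t by linarith
  qed
  ultimately have "AE x in lebesgue_on I. (u t x)\<^sup>2 = 0"
    using integral_nonneg_eq_0_iff_AE[OF u_sq_integrable[of t]] by (simp add: y_def)
  then show ?thesis by eventually_elim simp
qed

end

text \<open>These are the constants \<open>C\<^sub>0\<close>, \<open>\<theta>\<close> and \<open>c\<close> above, as functions of the parameters. The maximum with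
  zero makes the bound nonnegative for all real arguments.\<close>

definition extinction_bound :: "real \<Rightarrow> real \<Rightarrow> real \<Rightarrow> real" where
  "extinction_bound \<beta> p l =
    (let C = 2 * l + 2 + 2 powr p; \<theta> = p / (p + 1 + \<beta>);
         c = min ((2 * l * C\<^sup>2) powr (- (p / 2))) (C powr (- (1 + \<beta>) * \<theta>))
     in max 0 (1 + 1 / (c * (1 - 2 powr (1 - p / 2))) + 1 / (c * (1 - 2 powr (\<theta> - 1)))))"

theorem theorem9:
  shows "\<exists>T\<^sub>0 :: real \<Rightarrow> real \<Rightarrow> real \<Rightarrow> real \<Rightarrow> real.
    \<forall>(\<beta>::real) (p::real) (l::real) (f :: real \<Rightarrow> real) (u\<^sub>0 :: real \<Rightarrow> real) (v :: real \<Rightarrow> real \<Rightarrow> real).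
      0 < \<beta> \<and> \<beta> < 1 \<and> 2 < p \<and> 0 < l \<and>
      continuous_on UNIV f \<and> mono f \<and> (\<forall>s. 0 \<le> f s) \<and> f 0 = 0 \<and>
      integrable (lebesgue_on {-l<..<l}) u\<^sub>0 \<and> (AE x in lebesgue_on {-l<..<l}. 0 \<le> u\<^sub>0 x) \<and>
      weak_solution \<beta> p l f u\<^sub>0 v \<longrightarrow>
      (let \<tau> = T\<^sub>0 \<beta> p (measure lebesgue {-l<..<l}) (LINT x|lebesgue_on {-l<..<l}. \<bar>u\<^sub>0 x\<bar>) in
         0 \<le> \<tau> \<and> (\<forall>t\<ge>\<tau>. AE x in lebesgue_on {-l<..<l}. v t x = 0))"
proof (intro exI[of _ "\<lambda>\<beta> p L m. extinction_bound \<beta> p (L / 2)"] allI impI, elim conjE)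
  fix \<beta> p l :: real and f u\<^sub>0 :: "real \<Rightarrow> real" and v :: "real \<Rightarrow> real \<Rightarrow> real"
  assume "0 < \<beta>" "\<beta> < 1" "2 < p" "0 < l" "\<forall>s. 0 \<le> f s" "weak_solution \<beta> p l f u\<^sub>0 v"
  then interpret weak_solution_setting \<beta> p l f u\<^sub>0 v by unfold_locales auto
  have "measure lebesgue I / 2 = l" using measure_I(1) by simp
  moreover have "0 \<le> extinction_bound \<beta> p l" by (simp add: extinction_bound_def Let_def)
  moreover have "AE x in lebesgue_on I. v t x = 0" if "extinction_bound \<beta> p l \<le> t" for t
    using that by (intro extinction) (simp add: extinction_bound_def Let_def c_def \<theta>_def C\<^sub>0_def)
  ultimately show "let \<tau> = extinction_bound \<beta> p (measure lebesgue I / 2) in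
      0 \<le> \<tau> \<and> (\<forall>t\<ge>\<tau>. AE x in lebesgue_on I. v t x = 0)"
    by (simp add: Let_def)
qed

end
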